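(* Assume that $n\ge2$. For any given $\lambda>2n-1$, let $a,b\in L^\infty(\mathrm{D}^{\mathrm{I}}_{n\times n})$ be symbols such that: (i) $a(Z)=a\big((Z^*Z)^{\frac12}\big)$ for almost every $Z\in\mathrm{D}^{\mathrm{I}}_{n\times n}$, the unital Banach algebra generated by $T^{(\lambda)}_a$ is commutative and non-$C^*$, and the unital $C^*$-algebra generated by $T^{(\lambda)}_a$ is not commutative; (ii) $b(Z)=b\big((ZZ^* )^{\frac12}\big)$ for almost every $Z\in\mathrm{D}^{\mathrm{I}}_{n\times n}$, the unital Banach algebra generated by $T^{(\lambda)}_b$ is commutative and non-$C^*$, and the unital $C^*$-algebra generated by $T^{(\lambda)}_b$ is not commutative. Then, the unital Banach algebra generated by $T^{(\lambda)}_a$ and $T^{(\lambda)}_b$ is commutative and non-$C^*$. In particular, the unital $C^*$-algebra generated by these two Toeplitz operators is not commutative.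
   Context: $\mathrm{D}^{\mathrm{I}}_{n\times n}=\{Z\in M_{n\times n}(\mathbb{C}): Z^*Z<I_n\}$. For $\lambda>2n-1$, $dv_\lambda(Z)=c_\lambda\det(I_n-ZZ^* )^{\lambda-2n}dv(Z)$, with $dv$ Lebesgue measure and $c_\lambda>0$ such that $v_\lambda(\mathrm{D}^{\mathrm{I}}_{n\times n})=1$. $\mathcal{A}^2_\lambda(\mathrm{D}^{\mathrm{I}}_{n\times n})$ is the weighted Bergman space of holomorphic functions in $L^2(\mathrm{D}^{\mathrm{I}}_{n\times n},v_\lambda)$, with orthogonal projection $B_\lambda$ from $L^2(\mathrm{D}^{\mathrm{I}}_{n\times n},v_\lambda)$. For $a\in L^\infty(\mathrm{D}^{\mathrm{I}}_{n\times n})$, $T^{(\lambda)}_a(f)=B_\lambda(af)$ on $\mathcal{A}^2_\lambda(\mathrm{D}^{\mathrm{I}}_{n\times n})$. In the conditions on $a$ and $b$, symbols are measurable essentially bounded functions defined at every point of $\mathrm{D}^{\mathrm{I}}_{n\times n}$. The unital Banach algebra generated by a set of bounded operators is the smallest norm-closed subalgebra of the bounded operators on $\mathcal{A}^2_\lambda(\mathrm{D}^{\mathrm{I}}_{n\times n})$ containing the set and the identity; it is non-$C^*$ if it is not closed under taking adjoints. *)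

theory Defs
  imports "HOL-Analysis.Analysis" "HOL-Library.FuncSet"
begin

section \<open>Matrices and the domain\<close>

definition ctranspose :: "complex ^ 'n ^ 'm \<Rightarrow> complex ^ 'm ^ 'n" where
  "ctranspose Z = (\<chi> i j. cnj (Z $ j $ i))"

definition qform :: "complex ^ 'n ^ 'n \<Rightarrow> complex ^ 'n \<Rightarrow> complex" where
  "qform A x = (\<Sum>i\<in>UNIV. (A *v x) $ i * cnj (x $ i))"

text \<open>For Hermitian \<open>A\<close> the values of \<open>qform A\<close> are real, so passing to \<open>Re\<close> loses nothing.\<close>

definition pos_semidef :: "complex ^ 'n ^ 'n \<Rightarrow> bool" where
  "pos_semidef A \<longleftrightarrow> ctranspose A = A \<and> (\<forall>x. 0 \<le> Re (qform A x))"

definition pos_def :: "complex ^ 'n ^ 'n \<Rightarrow> bool" where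
  "pos_def A \<longleftrightarrow> ctranspose A = A \<and> (\<forall>x. x \<noteq> 0 \<longrightarrow> 0 < Re (qform A x))"

definition mat_sqrt :: "complex ^ 'n ^ 'n \<Rightarrow> complex ^ 'n ^ 'n" where
  "mat_sqrt A = (THE P. pos_semidef P \<and> P ** P = A)"

definition cartan_domain :: "(complex ^ 'n ^ 'n) set" where
  "cartan_domain = {Z. pos_def (mat 1 - ctranspose Z ** Z)}"


section \<open>Weighted measures and Bergman spaces\<close>

definition weight :: "real \<Rightarrow> complex ^ 'n ^ 'n \<Rightarrow> real" where
  "weight lam Z = Re (det (mat 1 - Z ** ctranspose Z)) powr (lam - 2 * real CARD('n))"

text \<open>
  The factor \<open>c\<close> is the only constant giving \<open>cartan_domain\<close> total mass \<open>1\<close>; the integral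
  is finite and positive precisely for \<open>lam > 2 * n - 1\<close>, the only range that is used.
\<close>

definition bergman_measure :: "real \<Rightarrow> (complex ^ 'n ^ 'n) measure" where
  "bergman_measure lam =
     (let c = 1 / (\<integral>W. weight lam W \<partial>lebesgue_on (cartan_domain :: (complex ^ 'n ^ 'n) set))
      in density (lebesgue_on cartan_domain) (\<lambda>Z. ennreal (c * weight lam Z)))"

text \<open>
  Elements of \<open>L2\<close> are functions, not classes; only their values on \<open>cartan_domain\<close>, which is
  the space of \<open>bergman_measure lam\<close>, matter.
\<close>

definition L2 :: "real \<Rightarrow> (complex ^ 'n ^ 'n \<Rightarrow> complex) set" where
  "L2 lam = {f \<in> borel_measurable (bergman_measure lam).
               integrable (bergman_measure lam) (\<lambda>Z. (norm (f Z))\<^sup>2)}"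

definition L2_inner ::
  "real \<Rightarrow> (complex ^ 'n ^ 'n \<Rightarrow> complex) \<Rightarrow> (complex ^ 'n ^ 'n \<Rightarrow> complex) \<Rightarrow> complex" where
  "L2_inner lam f g = (\<integral>Z. f Z * cnj (g Z) \<partial>bergman_measure lam)"

definition L2_norm :: "real \<Rightarrow> (complex ^ 'n ^ 'n \<Rightarrow> complex) \<Rightarrow> real" where
  "L2_norm lam f = sqrt (\<integral>Z. (norm (f Z))\<^sup>2 \<partial>bergman_measure lam)"

text \<open>Holomorphy in several variables: a complex-linear derivative at every point.\<close>

definition mat_holomorphic_on ::
  "(complex ^ 'n ^ 'n \<Rightarrow> complex) \<Rightarrow> (complex ^ 'n ^ 'n) set \<Rightarrow> bool" where
  "mat_holomorphic_on f S \<longleftrightarrow>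
     (\<forall>Z\<in>S. \<exists>L. (f has_derivative L) (at Z) \<and>
        (\<forall>c W. L (\<chi> i j. c * W $ i $ j) = c * L W))"

text \<open>
  A function on \<open>cartan_domain\<close> is represented by its extension by zero, so that equality of
  elements of the Bergman space is equality of functions.
\<close>

definition bergman_space :: "real \<Rightarrow> (complex ^ 'n ^ 'n \<Rightarrow> complex) set" where
  "bergman_space lam =
     {f \<in> L2 lam. mat_holomorphic_on f cartan_domain \<and> (\<forall>Z. Z \<notin> cartan_domain \<longrightarrow> f Z = 0)}"

definition bergman_proj ::
  "real \<Rightarrow> (complex ^ 'n ^ 'n \<Rightarrow> complex) \<Rightarrow> complex ^ 'n ^ 'n \<Rightarrow> complex" where
  "bergman_proj lam f =
     (THE g. g \<in> bergman_space lam \<and>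
        (\<forall>h\<in>bergman_space lam. L2_inner lam (\<lambda>Z. f Z - g Z) h = 0))"

text \<open>
  Symbols are honest functions, so that they can be evaluated on the null set of positive
  semidefinite matrices.
\<close>

definition Linf :: "(complex ^ 'n ^ 'n \<Rightarrow> complex) set" where
  "Linf = {a \<in> borel_measurable (lebesgue_on cartan_domain).
             \<exists>C. AE Z in lebesgue_on cartan_domain. norm (a Z) \<le> C}"


section \<open>Operators on the Bergman space\<close>

text \<open>Operators are extensional functions (\<open>undefined\<close> off \<open>bergman_space lam\<close>).\<close>

type_synonym 'n operator = "(complex ^ 'n ^ 'n \<Rightarrow> complex) \<Rightarrow> complex ^ 'n ^ 'n \<Rightarrow> complex"

definition toeplitz :: "real \<Rightarrow> (complex ^ 'n ^ 'n \<Rightarrow> complex) \<Rightarrow> ('n::finite) operator" where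
  "toeplitz lam a = (\<lambda>f\<in>bergman_space lam. bergman_proj lam (\<lambda>Z. a Z * f Z))"

definition bounded_ops :: "real \<Rightarrow> ('n::finite) operator set" where
  "bounded_ops lam =
     {T \<in> bergman_space lam \<rightarrow>\<^sub>E bergman_space lam.
        (\<forall>f\<in>bergman_space lam. \<forall>g\<in>bergman_space lam.
           T (\<lambda>Z. f Z + g Z) = (\<lambda>Z. T f Z + T g Z)) \<and>
        (\<forall>c. \<forall>f\<in>bergman_space lam. T (\<lambda>Z. c * f Z) = (\<lambda>Z. c * T f Z)) \<and>
        (\<exists>C. \<forall>f\<in>bergman_space lam. L2_norm lam (T f) \<le> C * L2_norm lam f)}"

definition op_id :: "real \<Rightarrow> ('n::finite) operator" where
  "op_id lam = (\<lambda>f\<in>bergman_space lam. f)"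

definition op_add :: "real \<Rightarrow> ('n::finite) operator \<Rightarrow> ('n::finite) operator \<Rightarrow> ('n::finite) operator" where
  "op_add lam S T = (\<lambda>f\<in>bergman_space lam. \<lambda>Z. S f Z + T f Z)"

definition op_scale :: "real \<Rightarrow> complex \<Rightarrow> ('n::finite) operator \<Rightarrow> ('n::finite) operator" where
  "op_scale lam c T = (\<lambda>f\<in>bergman_space lam. \<lambda>Z. c * T f Z)"

definition op_mult :: "real \<Rightarrow> ('n::finite) operator \<Rightarrow> ('n::finite) operator \<Rightarrow> ('n::finite) operator" where
  "op_mult lam S T = compose (bergman_space lam) S T"

definition op_norm :: "real \<Rightarrow> ('n::finite) operator \<Rightarrow> real" where
  "op_norm lam T = (SUP f\<in>{f \<in> bergman_space lam. L2_norm lam f \<le> 1}. L2_norm lam (T f))"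

definition op_adjoint :: "real \<Rightarrow> ('n::finite) operator \<Rightarrow> ('n::finite) operator" where
  "op_adjoint lam T =
     (THE S. S \<in> bounded_ops lam \<and>
        (\<forall>f\<in>bergman_space lam. \<forall>g\<in>bergman_space lam.
           L2_inner lam (T f) g = L2_inner lam f (S g)))"


section \<open>Operator algebras\<close>

definition norm_closed :: "real \<Rightarrow> ('n::finite) operator set \<Rightarrow> bool" where
  "norm_closed lam M \<longleftrightarrow>
     (\<forall>X. \<forall>T\<in>bounded_ops lam. (\<forall>k::nat. X k \<in> M) \<and>
        (\<lambda>k. op_norm lam (op_add lam (X k) (op_scale lam (- 1) T))) \<longlonglongrightarrow> 0 \<longrightarrow> T \<in> M)"

definition closed_unital_subalgebra :: "real \<Rightarrow> ('n::finite) operator set \<Rightarrow> bool" where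
  "closed_unital_subalgebra lam M \<longleftrightarrow>
     M \<subseteq> bounded_ops lam \<and> op_id lam \<in> M \<and>
     (\<forall>S\<in>M. \<forall>T\<in>M. op_add lam S T \<in> M) \<and>
     (\<forall>c. \<forall>T\<in>M. op_scale lam c T \<in> M) \<and>
     (\<forall>S\<in>M. \<forall>T\<in>M. op_mult lam S T \<in> M) \<and>
     norm_closed lam M"

definition adjoint_closed :: "real \<Rightarrow> ('n::finite) operator set \<Rightarrow> bool" where
  "adjoint_closed lam M \<longleftrightarrow> (\<forall>T\<in>M. op_adjoint lam T \<in> M)"

definition commutative_ops :: "real \<Rightarrow> ('n::finite) operator set \<Rightarrow> bool" where
  "commutative_ops lam M \<longleftrightarrow> (\<forall>S\<in>M. \<forall>T\<in>M. op_mult lam S T = op_mult lam T S)"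

definition banach_algebra_gen :: "real \<Rightarrow> ('n::finite) operator set \<Rightarrow> ('n::finite) operator set" where
  "banach_algebra_gen lam G = closed_unital_subalgebra lam hull G"

definition cstar_algebra_gen :: "real \<Rightarrow> ('n::finite) operator set \<Rightarrow> ('n::finite) operator set" where
  "cstar_algebra_gen lam G =
     (\<lambda>M. closed_unital_subalgebra lam M \<and> adjoint_closed lam M) hull G"

end

theory Submission
  imports Defs "HOL-Complex_Analysis.Complex_Analysis"
begin

text \<open>
  Everything rests on the identity \<open>T\<^sub>a T\<^sub>b = T\<^sub>b T\<^sub>a\<close>. A symbol depending on \<open>Z\<^sup>*Z\<close> only is invariant under
  \<open>Z \<mapsto> U Z\<close> for unitary \<open>U\<close>, and a symbol depending on \<open>Z Z\<^sup>*\<close> only is invariant under \<open>Z \<mapsto> Z U\<close>.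
  Since the weighted measure is invariant under both actions of the unitary group, \<open>T\<^sub>a\<close> commutes with
  all left translations of functions and \<open>T\<^sub>b\<close> with all right translations
  (\<open>has_symbol_symmetry\<close>).

  Both actions contain the rotations \<open>Z \<mapsto> e\<^sup>i\<^sup>\<theta> Z\<close>. Averaging over them extracts the homogeneous part
  of degree \<open>d\<close> of a holomorphic function, so both operators respect homogeneous parts
  (\<open>has_symbol_hom_part\<close>), and the question is reduced to forms of degree \<open>d\<close>: holomorphic
  functions on all matrices that are homogeneous of degree \<open>d\<close>. Such forms are polynomials, hence a
  finite-dimensional space in which every form is recovered from its values on a finite grid of
  matrices (\<open>hform_expansion\<close>).

  A form vanishing on the unitary group is zero (\<open>hform_zero_on_unitary\<close>); therefore an operator on
  forms that commutes with left translations by unitary matrices commutes with left translations by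
  all matrices, and evaluating at the identity matrix gives \<open>(T p)(W) = \<Sum>\<^sub>k t\<^sub>k p(W W\<^sub>k)\<close>: it is a
  combination of right translations. Likewise an operator commuting with right translations is a
  combination of left translations. Left and right translations commute, hence so do the two
  operators. This is the principle that, in a unital algebra, the linear maps commuting with all left
  multiplications are the right multiplications.

  The rest is formal. The Banach algebra generated by two commuting operators is commutative, by two
  applications of the commutant. If it were closed under adjoints it would contain the
  \<open>C\<^sup>*\<close>-algebra generated by \<open>T\<^sub>a\<close>, which is not commutative; and the \<open>C\<^sup>*\<close>-algebra generated by both
  operators contains that one as well.
\<close>

unbundle no fps_syntax

section \<open>Scalar multiples of matrices\<close>

definition cmul :: "complex \<Rightarrow> complex ^ 'n ^ 'n \<Rightarrow> complex ^ 'n ^ 'n" where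
  "cmul w Z = (\<chi> i j. w * Z $ i $ j)"

lemma cmul_nth [simp]: "cmul w Z $ i $ j = w * Z $ i $ j"
  by (simp add: cmul_def)

lemma cmul_1 [simp]: "cmul 1 Z = Z"
  and cmul_0 [simp]: "cmul 0 Z = 0"
  and cmul_cmul [simp]: "cmul v (cmul w Z) = cmul (v * w) Z"
  and cmul_add_right: "cmul w (Y + Z) = cmul w Y + cmul w Z"
  by (simp_all add: vec_eq_iff algebra_simps)

lemma matrix_mult_cmul_right: "A ** cmul w Z = cmul w (A ** Z)"
  by (simp add: vec_eq_iff matrix_matrix_mult_def sum_distrib_left algebra_simps)

lemma matrix_mult_cmul_left: "cmul w A ** Z = cmul w (A ** Z)"
  by (simp add: vec_eq_iff matrix_matrix_mult_def sum_distrib_left algebra_simps)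

lemma cmul_mult_vec: "cmul w Z *v x = w *s (Z *v x)"
  by (simp add: vec_eq_iff matrix_vector_mult_def sum_distrib_left algebra_simps)

lemma continuous_on_cmul [continuous_intros]:
  "continuous_on S f \<Longrightarrow> continuous_on S g \<Longrightarrow> continuous_on S (\<lambda>x. cmul (f x) (g x))"
  unfolding cmul_def by (intro continuous_intros)

lemma continuous_on_matrix_mult [continuous_intros]:
  fixes f g :: "_ \<Rightarrow> complex ^ 'n ^ 'n"
  shows "continuous_on S f \<Longrightarrow> continuous_on S g \<Longrightarrow> continuous_on S (\<lambda>x. f x ** g x)"
  unfolding matrix_matrix_mult_def by (intro continuous_intros)

lemma norm_vec_scalar_mult: "norm (w *s x) = norm w * norm (x :: complex ^ 'n)"
  by (simp add: norm_vec_def L2_set_def norm_mult power_mult_distrib flip: sum_distrib_left)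
     (simp add: real_sqrt_mult)

lemma norm_cmul: "norm (cmul w Z) = norm w * norm Z"
proof -
  have "cmul w Z $ i = w *s (Z $ i)" for i
    by (simp add: vec_eq_iff)
  then show ?thesis
    by (simp add: norm_vec_def[of "cmul w Z"] norm_vec_def[of Z] norm_vec_scalar_mult L2_set_def
        power_mult_distrib real_sqrt_mult flip: sum_distrib_left)
qed

section \<open>Adjoints and unitary matrices\<close>

lemma ctranspose_nth [simp]: "ctranspose Z $ i $ j = cnj (Z $ j $ i)"
  by (simp add: ctranspose_def)

lemma ctranspose_mult: "ctranspose (A ** B) = ctranspose B ** ctranspose (A :: complex ^ 'n ^ 'n)"
  by (simp add: vec_eq_iff matrix_matrix_mult_def algebra_simps)

lemma ctranspose_ctranspose [simp]: "ctranspose (ctranspose A) = A"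
  by (simp add: vec_eq_iff)

lemma ctranspose_add: "ctranspose (A + B) = ctranspose A + ctranspose B"
  and ctranspose_diff: "ctranspose (A - B) = ctranspose A - ctranspose B"
  by (simp_all add: vec_eq_iff)

lemma ctranspose_mat_1 [simp]: "ctranspose (mat 1 :: complex ^ 'n ^ 'n) = mat 1"
  by (simp add: vec_eq_iff mat_def)

lemma det_ctranspose: "det (ctranspose A) = cnj (det A)"
proof -
  have "det (ctranspose A) = det (transpose (\<chi> i j. cnj (A $ i $ j)))"
    by (rule arg_cong[where f = det]) (simp add: vec_eq_iff transpose_def)
  also have "\<dots> = cnj (det A)"
    unfolding det_transpose by (simp add: det_def)
  finally show ?thesis .
qed

lemma norm_ctranspose: "norm (ctranspose Z) = norm (Z :: complex ^ 'n ^ 'n)"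
proof -
  have "(\<Sum>i\<in>UNIV. \<Sum>j\<in>UNIV. (cmod (Z $ j $ i))\<^sup>2) = (\<Sum>j\<in>UNIV. \<Sum>i\<in>UNIV. (cmod (Z $ j $ i))\<^sup>2)"
    by (rule sum.swap)
  then show ?thesis
    by (simp add: norm_vec_def L2_set_def sum_nonneg)
qed

lemma norm_vec_power2: "(norm (x :: complex ^ 'n))\<^sup>2 = Re (\<Sum>i\<in>UNIV. x $ i * cnj (x $ i))"
  by (simp add: norm_vec_def L2_set_def sum_nonneg complex_norm_square[symmetric] del: of_real_power)

lemma sesquilinear_ctranspose:
  "(\<Sum>i\<in>UNIV. (ctranspose A *v x) $ i * cnj (y $ i)) = (\<Sum>i\<in>UNIV. x $ i * cnj ((A *v y) $ i))"
proof -
  have "(\<Sum>i\<in>UNIV. (ctranspose A *v x) $ i * cnj (y $ i)) = (\<Sum>i\<in>UNIV. \<Sum>j\<in>UNIV. cnj (A $ j $ i) * x $ j * cnj (y $ i))"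
    by (simp add: matrix_vector_mult_def sum_distrib_right)
  also have "\<dots> = (\<Sum>j\<in>UNIV. \<Sum>i\<in>UNIV. cnj (A $ j $ i) * x $ j * cnj (y $ i))"
    by (rule sum.swap)
  also have "\<dots> = (\<Sum>i\<in>UNIV. x $ i * cnj ((A *v y) $ i))"
    by (simp add: matrix_vector_mult_def sum_distrib_left algebra_simps)
  finally show ?thesis .
qed

lemma qform_defect:
  "Re (qform (mat 1 - ctranspose Z ** Z) x) = (norm x)\<^sup>2 - (norm (Z *v x))\<^sup>2"
proof -
  have "(\<Sum>i\<in>UNIV. ((ctranspose Z ** Z) *v x) $ i * cnj (x $ i))
      = (\<Sum>i\<in>UNIV. (Z *v x) $ i * cnj ((Z *v x) $ i))"
    by (simp add: sesquilinear_ctranspose flip: matrix_vector_mul_assoc)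
  then show ?thesis
    by (simp add: qform_def norm_vec_power2 matrix_vector_mult_diff_rdistrib left_diff_distrib
        sum_subtractf)
qed

text \<open>
  The domain is the open unit ball of the operator norm. In this form its invariance under unitary
  matrices, its openness and its boundedness can be read off.
\<close>

lemma cartan_domain_iff:
  "Z \<in> cartan_domain \<longleftrightarrow> (\<forall>x. x \<noteq> 0 \<longrightarrow> norm (Z *v x) < norm x)"
  by (simp add: cartan_domain_def pos_def_def qform_defect ctranspose_diff ctranspose_mult
      abs_le_square_iff linorder_not_le[symmetric])

definition unitary :: "complex ^ 'n ^ 'n \<Rightarrow> bool" where
  "unitary U \<longleftrightarrow> ctranspose U ** U = mat 1 \<and> U ** ctranspose U = mat 1"

lemma unitary_scalar:
  assumes "norm w = 1"
  shows "unitary (cmul w (mat 1) :: complex ^ 'n ^ 'n)"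
proof -
  have "w * cnj w = 1" using assms by (simp add: complex_norm_square[symmetric])
  moreover have "ctranspose (cmul w (mat 1)) = cmul (cnj w) (mat 1 :: complex ^ 'n ^ 'n)"
    by (simp add: vec_eq_iff mat_def)
  ultimately show ?thesis
    unfolding unitary_def by (simp add: matrix_mult_cmul_left mult.commute)
qed

lemma unitary_ctranspose: "unitary U \<Longrightarrow> unitary (ctranspose U)"
  by (simp add: unitary_def)

lemma norm_unitary_vec: "unitary U \<Longrightarrow> norm (U *v x) = norm x"
proof -
  assume "unitary U"
  then have "Re (qform (mat 1 - ctranspose U ** U) x) = 0"
    by (simp add: unitary_def qform_def)
  then show ?thesis
    by (simp add: qform_defect)
qed

text \<open>
  The Frobenius norm is preserved because left multiplication by \<open>U\<close> acts on every column
  separately; the columns are the rows of the adjoint, up to conjugation.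
\<close>

lemma norm_mult_unitary_left:
  fixes U Z :: "complex ^ 'n ^ 'n"
  assumes "unitary U"
  shows "norm (U ** Z) = norm Z"
proof -
  define V where "V = transpose (ctranspose U)"
  have "ctranspose V = transpose U"
    by (simp add: V_def vec_eq_iff transpose_def)
  then have V: "unitary V"
    using assms unfolding unitary_def V_def by (metis matrix_transpose_mul transpose_mat)
  have row: "ctranspose (U ** Z) $ i = V *v (ctranspose Z $ i)" for i
    by (simp add: vec_eq_iff V_def transpose_def matrix_vector_mult_def matrix_matrix_mult_def)
  have "norm (ctranspose (U ** Z)) = norm (ctranspose Z)"
    by (simp add: norm_vec_def[of "ctranspose (U ** Z)"] norm_vec_def[of "ctranspose Z"] row
        norm_unitary_vec[OF V])
  then show ?thesis
    by (simp add: norm_ctranspose)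
qed

lemma norm_mult_unitary_right:
  fixes U Z :: "complex ^ 'n ^ 'n"
  assumes "unitary U"
  shows "norm (Z ** U) = norm Z"
  using norm_mult_unitary_left[OF unitary_ctranspose[OF assms], of "ctranspose Z"]
  by (metis ctranspose_mult norm_ctranspose)

lemma unitary_left_cancel: 
  "unitary U \<Longrightarrow> ctranspose U ** (U ** Z) = Z" "unitary U \<Longrightarrow> U ** (ctranspose U ** Z) = Z"
  by (simp_all add: unitary_def matrix_mul_assoc)

lemma unitary_right_cancel: 
  "unitary U \<Longrightarrow> (Z ** U) ** ctranspose U = Z" "unitary U \<Longrightarrow> (Z ** ctranspose U) ** U = Z"
  by (simp_all add: unitary_def flip: matrix_mul_assoc)

lemma cartan_mult_unitary_left:
  assumes "unitary U"
  shows "U ** Z \<in> cartan_domain \<longleftrightarrow> Z \<in> cartan_domain"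
  by (simp add: cartan_domain_iff norm_unitary_vec[OF assms] flip: matrix_vector_mul_assoc)

lemma cartan_mult_unitary_right:
  fixes U Z :: "complex ^ 'n ^ 'n"
  assumes "unitary U"
  shows "Z ** U \<in> cartan_domain \<longleftrightarrow> Z \<in> cartan_domain"
proof -
  have *: "Z ** U \<in> cartan_domain" if "Z \<in> cartan_domain" "unitary U" for Z U :: "complex ^ 'n ^ 'n"
    unfolding cartan_domain_iff
  proof (intro allI impI)
    fix x :: "complex ^ 'n"
    assume "x \<noteq> 0"
    then have "U *v x \<noteq> 0"
      using norm_unitary_vec[OF that(2), of x] by (metis norm_eq_zero)
    then have "norm (Z *v (U *v x)) < norm (U *v x)"
      using that(1) cartan_domain_iff by blast
    then show "norm ((Z ** U) *v x) < norm x"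
      by (simp add: norm_unitary_vec[OF that(2)] matrix_vector_mul_assoc)
  qed
  show ?thesis
    using *[OF _ assms] *[OF _ unitary_ctranspose[OF assms]] unitary_right_cancel[OF assms] by metis
qed

section \<open>Geometry of the domain\<close>

lemma continuous_on_matrix_vec [continuous_intros]:
  fixes f :: "_ \<Rightarrow> complex ^ 'n ^ 'n"
  shows "continuous_on S f \<Longrightarrow> continuous_on S g \<Longrightarrow> continuous_on S (\<lambda>x. f x *v g x)"
  unfolding matrix_vector_mult_def by (intro continuous_intros)

text \<open>
  The complement is the set of \<open>Z\<close> with \<open>norm x \<le> norm (Z *v x)\<close> for some unit vector \<open>x\<close>, the
  projection of a closed set along the compact unit sphere.
\<close>

lemma open_cartan_domain: "open (cartan_domain :: (complex ^ 'n ^ 'n) set)"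
proof -
  let ?T = "{(x :: complex ^ 'n, Z :: complex ^ 'n ^ 'n). norm x \<le> norm (Z *v x)}"
  have "closed ?T"
    unfolding case_prod_beta' by (intro closed_Collect_le continuous_intros)
  then have cl: "closed {Z. \<exists>x. x \<in> sphere 0 1 \<and> (x, Z) \<in> ?T}"
    by (rule closed_compact_projection[OF compact_sphere])
  have "Z \<in> cartan_domain \<longleftrightarrow> Z \<notin> {Z. \<exists>x. x \<in> sphere 0 1 \<and> (x, Z) \<in> ?T}" for Z :: "complex ^ 'n ^ 'n"
  proof
    assume R: "Z \<notin> {Z. \<exists>x. x \<in> sphere 0 1 \<and> (x, Z) \<in> ?T}"
    show "Z \<in> cartan_domain"
      unfolding cartan_domain_iff
    proof (intro allI impI)
      fix x :: "complex ^ 'n"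
      assume "x \<noteq> 0"
      define y where "y = x /\<^sub>R norm x"
      have "norm y = 1" using \<open>x \<noteq> 0\<close> by (simp add: y_def)
      then have "norm (Z *v y) < norm y" using R by auto
      then show "norm (Z *v x) < norm x"
        using \<open>x \<noteq> 0\<close> unfolding y_def
        by (simp add: linear_scale[OF matrix_vector_mul_linear] matrix_vector_mult_scaleR field_simps)
    qed
  next
    assume Z: "Z \<in> cartan_domain"
    have "norm (Z *v x) < norm x" if "norm x = 1" for x
    proof -
      have "x \<noteq> 0" using that by auto
      then show ?thesis using Z cartan_domain_iff by blast
    qed
    then show "Z \<notin> {Z. \<exists>x. x \<in> sphere 0 1 \<and> (x, Z) \<in> ?T}"
      by fastforce
  qed
  then have eq: "cartan_domain = - {Z :: complex ^ 'n ^ 'n. \<exists>x. x \<in> sphere 0 1 \<and> (x, Z) \<in> ?T}"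
    by blast
  show ?thesis
    unfolding eq using cl by (rule open_Compl)
qed

lemma zero_in_cartan_domain: "0 \<in> cartan_domain"
  by (simp add: cartan_domain_iff)

lemma cmul_in_cartan_domain: "Z \<in> cartan_domain \<Longrightarrow> norm w \<le> 1 \<Longrightarrow> cmul w Z \<in> cartan_domain"
  unfolding cartan_domain_iff cmul_mult_vec norm_vec_scalar_mult
  by (metis mult_left_le_one_le norm_ge_zero order_le_less_trans)

lemma cmul_in_cartan_domain_iff: "norm w = 1 \<Longrightarrow> cmul w Z \<in> cartan_domain \<longleftrightarrow> Z \<in> cartan_domain"
  by (simp add: cartan_domain_iff cmul_mult_vec norm_vec_scalar_mult)

lemma norm_vec_le_sum: "norm (x :: 'a :: real_normed_vector ^ 'n) \<le> (\<Sum>i\<in>UNIV. norm (x $ i))"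
  by (simp add: norm_vec_def L2_set_le_sum)

lemma bounded_cartan_domain: "bounded (cartan_domain :: (complex ^ 'n ^ 'n) set)"
proof -
  have "norm Z \<le> real CARD('n) * real CARD('n)" if Z: "Z \<in> cartan_domain" for Z :: "complex ^ 'n ^ 'n"
  proof -
    have e: "norm (Z $ i $ j) \<le> 1" for i j
    proof -
      have "norm (Z *v axis j 1) < norm (axis j (1 :: complex))"
        using Z cartan_domain_iff[of Z] by (metis axis_eq_0_iff zero_neq_one)
      moreover have "norm (Z $ i $ j) \<le> norm (Z *v axis j 1)"
        using Finite_Cartesian_Product.norm_nth_le[of "Z *v axis j 1" i] 
        by (simp add: matrix_vector_mult_def axis_def if_distrib cong: if_cong)
      moreover have "norm (axis j (1 :: complex) :: complex ^ 'n) = 1"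
        by (simp add: norm_vec_def L2_set_def axis_def if_distrib[of norm] if_distrib[of "\<lambda>x. x\<^sup>2"] cong: if_cong)
      ultimately show ?thesis by simp
    qed
    have "norm (Z $ i) \<le> real CARD('n)" for i
      using order_trans[OF norm_vec_le_sum sum_bounded_above[of UNIV "\<lambda>j. norm (Z $ i $ j)" 1]] e by simp
    then show ?thesis
      using order_trans[OF norm_vec_le_sum sum_bounded_above[of UNIV "\<lambda>i. norm (Z $ i)" "real CARD('n)"]] by simp
  qed
  then show ?thesis by (auto simp: bounded_iff)
qed

text \<open>
  By this shrinking, homogeneous functions inherit on all matrices what is known on the domain.
\<close>

lemma exists_cmul_in_cartan_domain: "\<exists>r>0. \<forall>Z\<in>cball (0 :: complex ^ 'n ^ 'n) R. cmul (of_real r) Z \<in> cartan_domain"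
proof -
  obtain e where e: "e > 0" "ball 0 e \<subseteq> (cartan_domain :: (complex ^ 'n ^ 'n) set)"
    using open_cartan_domain zero_in_cartan_domain by (auto simp: open_contains_ball)
  define r where "r = e / (2 * (\<bar>R\<bar> + 1))"
  have r: "r > 0" using e by (simp add: r_def field_simps)
  have "cmul (of_real r) Z \<in> cartan_domain" if "Z \<in> cball 0 R" for Z :: "complex ^ 'n ^ 'n"
  proof -
    have "norm (cmul (of_real r) Z) \<le> r * (\<bar>R\<bar> + 1)"
      using that r by (simp add: norm_cmul)
    also have "\<dots> < e"
      using e by (simp add: r_def field_simps add_pos_nonneg)
    finally show ?thesis using e by auto
  qed
  with r show ?thesis by blast
qed

text \<open>
  The matrix is Hermitian, so its determinant is real; it is injective, because \<open>Z Z\<^sup>* x = x\<close> makes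
  \<open>Z\<^sup>* x\<close> a fixed vector of \<open>Z\<^sup>* Z\<close>, hence \<open>0\<close>. Since \<open>powr\<close> of a nonzero base is positive, the weight is
  positive on the domain.
\<close>

lemma weight_base_nonzero:
  fixes Z :: "complex ^ 'n ^ 'n"
  assumes "Z \<in> cartan_domain"
  shows "Re (det (mat 1 - Z ** ctranspose Z)) \<noteq> 0"
proof -
  let ?A = "mat 1 - Z ** ctranspose Z"
  have inj: "x = 0" if "?A *v x = 0" for x
  proof -
    have x: "x = Z *v (ctranspose Z *v x)"
      using that by (simp add: matrix_vector_mult_diff_rdistrib matrix_vector_mul_assoc)
    define y where "y = ctranspose Z *v x"
    have "ctranspose Z *v (Z *v y) = y" using x by (simp add: y_def)
    then have "Re (qform (mat 1 - ctranspose Z ** Z) y) = 0"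
      by (simp add: qform_def matrix_vector_mult_diff_rdistrib flip: matrix_vector_mul_assoc)
    then have "y = 0"
      using assms by (auto simp: cartan_domain_def pos_def_def)
    then show "x = 0" using x by (simp add: y_def)
  qed
  then have "invertible ?A"
    by (metis invertible_left_inverse matrix_left_invertible_ker)
  then have "det ?A \<noteq> 0" by (simp add: invertible_det_nz)
  moreover have "ctranspose ?A = ?A"
    by (simp add: ctranspose_diff ctranspose_mult)
  then have "cnj (det ?A) = det ?A" by (metis det_ctranspose)
  then have "Im (det ?A) = 0" by (simp add: complex_eq_iff)
  ultimately show ?thesis by (simp add: complex_eq_iff)
qed

section \<open>Homogeneous parts\<close>

text \<open>
  Continuity together with holomorphy along every complex line. It is implied by the
  complex-linear differentiability that defines the Bergman space, and unlike that notion it passes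
  to circle averages by a one-variable argument.
\<close>

definition line_hol :: "(complex ^ 'n ^ 'n) set \<Rightarrow> (complex ^ 'n ^ 'n \<Rightarrow> complex) \<Rightarrow> bool" where
  "line_hol S f \<longleftrightarrow> continuous_on S f \<and>
     (\<forall>A B. (\<lambda>w. f (A + cmul w B)) holomorphic_on {w. A + cmul w B \<in> S})"

text \<open>
  The term of degree \<open>d\<close> in the expansion of \<open>f\<close> at the origin. Only the values of \<open>f\<close> near the
  origin enter, so the result is a function on all matrices even if \<open>f\<close> lives on the domain.
\<close>

definition hom_part :: "nat \<Rightarrow> (complex ^ 'n ^ 'n \<Rightarrow> complex) \<Rightarrow> complex ^ 'n ^ 'n \<Rightarrow> complex" where
  "hom_part d f Z = (deriv ^^ d) (\<lambda>w. f (cmul w Z)) 0 / fact d"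

definition hforms :: "nat \<Rightarrow> (complex ^ 'n ^ 'n \<Rightarrow> complex) set" where
  "hforms d = {p. line_hol UNIV p \<and> (\<forall>w Z. p (cmul w Z) = w ^ d * p Z)}"

lemma open_line: "open S \<Longrightarrow> open {w. A + cmul w B \<in> S}"
  by (rule open_vimage[of S "\<lambda>w. A + cmul w B", unfolded vimage_def])
     (auto intro!: continuous_intros)

lemma line_hol_subset: "line_hol T f \<Longrightarrow> S \<subseteq> T \<Longrightarrow> line_hol S f"
  unfolding line_hol_def
  by (meson Collect_mono continuous_on_subset holomorphic_on_subset subsetD)

lemma hforms_D:
  assumes "p \<in> hforms d"
  shows "line_hol UNIV p" "p (cmul w Z) = w ^ d * p Z" "continuous_on S p"
    "(\<lambda>w. p (A + cmul w B)) holomorphic_on UNIV"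
  using assms by (auto simp: hforms_def line_hol_def intro: continuous_on_subset)

lemma line_hol_cmul:
  assumes "line_hol S f"
  shows "(\<lambda>w. f (cmul w Z)) holomorphic_on {w. cmul w Z \<in> S}"
  using assms unfolding line_hol_def by (metis (no_types, lifting) Collect_cong add_0 holomorphic_cong)

text \<open>
  Morera's theorem: by Fubini the integral of the average over a triangle is the average of the
  integrals over the triangle, and these vanish by Cauchy's theorem.
\<close>

lemma holomorphic_integral_param:
  fixes F :: "complex \<Rightarrow> real \<Rightarrow> complex"
  assumes "open S"
    and cont: "continuous_on (S \<times> {0..1}) (\<lambda>(z, t). F z t)"
    and hol: "\<And>t. t \<in> {0..1} \<Longrightarrow> (\<lambda>z. F z t) holomorphic_on S"
  shows "(\<lambda>z. integral {0..1} (F z)) holomorphic_on S"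
proof -
  let ?I = "\<lambda>z. integral {0..1} (F z)"
  have contI: "continuous_on S ?I"
    using integral_continuous_on_param[of S 0 1 F] cont by (simp add: cbox_interval)
  have line: "contour_integral (linepath a b) ?I
      = integral {0..1} (\<lambda>t. contour_integral (linepath a b) (\<lambda>z. F z t))
    \<and> (\<lambda>t. contour_integral (linepath a b) (\<lambda>z. F z t)) integrable_on {0..1}"
    if ab: "closed_segment a b \<subseteq> S" for a b
  proof -
    have in_S: "linepath a b s \<in> S" if "s \<in> {0..1}" for s
      using that ab linepath_in_path by blast
    have c2: "continuous_on ({0..1} \<times> {0..1}) (\<lambda>(s, t). F (linepath a b s) t * (b - a))"
    proof -
      have "continuous_on ({0..1} \<times> {0..1}) (\<lambda>x. (\<lambda>(z, t). F z t) (linepath a b (fst x), snd x))"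
      proof (rule continuous_on_compose2[OF cont])
        show "continuous_on ({0..1} \<times> {0..1}) (\<lambda>x. (linepath a b (fst x), snd x))"
          unfolding linepath_def by (intro continuous_intros)
      qed (auto intro!: in_S)
      then show ?thesis
        by (auto simp: case_prod_beta' intro!: continuous_intros)
    qed
    have ci: "contour_integral (linepath a b) g = integral {0..1} (\<lambda>s. g (linepath a b s) * (b - a))" for g
      by (simp add: contour_integral_integral)
    have "contour_integral (linepath a b) ?I
        = integral {0..1} (\<lambda>s. integral {0..1} (\<lambda>t. F (linepath a b s) t * (b - a)))"
      by (simp add: ci)
    also have "\<dots> = integral {0..1} (\<lambda>t. integral {0..1} (\<lambda>s. F (linepath a b s) t * (b - a)))"
      using integral_swap_continuous[of 0 0 1 1 "\<lambda>s t. F (linepath a b s) t * (b - a)"] c2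
      unfolding cbox_Pair_eq unfolding cbox_interval by blast
    finally have 1: "contour_integral (linepath a b) ?I
        = integral {0..1} (\<lambda>t. integral {0..1} (\<lambda>s. F (linepath a b s) t * (b - a)))" .
    have "continuous_on ({0..1} \<times> {0..1}) (\<lambda>(t, s). F (linepath a b s) t * (b - a))"
      using continuous_on_compose2[OF c2 continuous_on_swap, of "{0..1} \<times> {0..1}"]
      by (force simp: case_prod_beta' prod.swap_def)
    then have "continuous_on {0..1} (\<lambda>t. integral {0..1} (\<lambda>s. F (linepath a b s) t * (b - a)))"
      using integral_continuous_on_param[of "{0..1}" 0 1 "\<lambda>t s. F (linepath a b s) t * (b - a)"]
      by (simp add: cbox_interval)
    then have "(\<lambda>t. integral {0..1} (\<lambda>s. F (linepath a b s) t * (b - a))) integrable_on {0..1}"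
      by (rule integrable_continuous_interval)
    with 1 show ?thesis by (simp add: ci)
  qed
  have "?I analytic_on S"
  proof (rule Morera_triangle[OF contI \<open>open S\<close>], rule impI)
    fix a b c
    assume abc: "convex hull {a, b, c} \<subseteq> S"
    have seg: "closed_segment a b \<subseteq> S" "closed_segment b c \<subseteq> S" "closed_segment c a \<subseteq> S"
      by (intro order_trans[OF closed_segment_subset abc]; simp add: hull_inc)+
    let ?C = "\<lambda>u v t. contour_integral (linepath u v) (\<lambda>z. F z t)"
    have zero: "?C a b t + ?C b c t + ?C c a t = 0" if "t \<in> {0..1}" for t
    proof -
      have h: "(\<lambda>z. F z t) holomorphic_on convex hull {a, b, c}"
        using hol[OF that] abc holomorphic_on_subset by blast
      have ct: "continuous_on S (\<lambda>z. F z t)"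
        using hol[OF that] by (rule holomorphic_on_imp_continuous_on)
      have i: "(\<lambda>z. F z t) contour_integrable_on linepath u v" if "closed_segment u v \<subseteq> S" for u v
        by (rule contour_integrable_continuous_linepath) (rule continuous_on_subset[OF ct that])
      have "((\<lambda>z. F z t) has_contour_integral 0) (linepath a b +++ linepath b c +++ linepath c a)"
        by (rule Cauchy_theorem_triangle[OF h])
      then have "contour_integral (linepath a b +++ linepath b c +++ linepath c a) (\<lambda>z. F z t) = 0"
        by (rule contour_integral_unique)
      then show ?thesis
        by (simp add: i seg add.assoc)
    qed
    have "contour_integral (linepath a b) ?I + contour_integral (linepath b c) ?I + contour_integral (linepath c a) ?I
        = integral {0..1} (\<lambda>t. ?C a b t + ?C b c t + ?C c a t)"
      using line seg by (simp add: integral_add integrable_add)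
    also have "\<dots> = integral {0..1} (\<lambda>t :: real. 0)"
      by (rule Henstock_Kurzweil_Integration.integral_cong) (rule zero)
    finally show "contour_integral (linepath a b) ?I + contour_integral (linepath b c) ?I
        + contour_integral (linepath c a) ?I = 0" by simp
  qed
  then show ?thesis by (rule analytic_imp_holomorphic)
qed

definition circ :: "real \<Rightarrow> complex" where
  "circ t = exp (2 * of_real pi * \<i> * of_real t)"

lemma norm_circ [simp]: "norm (circ t) = 1"
  by (simp add: circ_def)

lemma circ_nonzero [simp]: "circ t \<noteq> 0"
  by (simp add: circ_def)

lemma continuous_on_circ [continuous_intros]: "continuous_on S f \<Longrightarrow> continuous_on S (\<lambda>x. circ (f x))"
  unfolding circ_def by (intro continuous_intros)

lemma cball_line_cartan:
  assumes "Z \<in> cartan_domain"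
  shows "cball 0 1 \<subseteq> {w. cmul w Z \<in> cartan_domain}"
  using cmul_in_cartan_domain[OF assms] by auto

text \<open>
  Cauchy's formula on the unit circle of the slice through \<open>Z\<close>; the closed unit disc of the slice lies
  in the domain.
\<close>

lemma hom_part_integral:
  assumes f: "line_hol cartan_domain f" and Z: "Z \<in> cartan_domain"
  shows "hom_part d f Z = integral {0..1} (\<lambda>t. f (cmul (circ t) Z) / circ t ^ d)"
proof -
  let ?g = "\<lambda>w. f (cmul w Z)"
  have h: "?g holomorphic_on cball 0 1"
    using line_hol_cmul[OF f] cball_line_cartan[OF Z] holomorphic_on_subset by blast
  have "((\<lambda>u. ?g u / (u - 0) ^ Suc d) has_contour_integral
      (2 * pi * \<i>) / fact d * (deriv ^^ d) ?g 0) (circlepath 0 1)"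
    by (rule Cauchy_has_contour_integral_higher_derivative_circlepath)
       (use h in \<open>auto intro: holomorphic_on_imp_continuous_on holomorphic_on_subset\<close>)
  then have "contour_integral (circlepath 0 1) (\<lambda>u. ?g u / (u - 0) ^ Suc d)
      = (2 * pi * \<i>) / fact d * (deriv ^^ d) ?g 0"
    by (rule contour_integral_unique)
  then have "(2 * pi * \<i>) / fact d * (deriv ^^ d) ?g 0
      = integral {0..1} (\<lambda>t. ?g (circlepath 0 1 t) / circlepath 0 1 t ^ Suc d
          * vector_derivative (circlepath 0 1) (at t))"
    by (simp add: contour_integral_integral)
  also have "\<dots> = integral {0..1} (\<lambda>t. (2 * pi * \<i>) * (?g (circ t) / circ t ^ d))"
    by (rule Henstock_Kurzweil_Integration.integral_cong)
       (simp add: vector_derivative_circlepath, simp add: circlepath circ_def)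
  also have "\<dots> = (2 * pi * \<i>) * integral {0..1} (\<lambda>t. ?g (circ t) / circ t ^ d)"
    by (rule integral_mult_right)
  finally show ?thesis
    by (simp add: hom_part_def field_simps)
qed

text \<open>
  On a bounded set \<open>p\<close> is, up to the constant factor \<open>r\<^sup>d\<close>, the composition of \<open>p\<close> with a shrinking
  into the domain.
\<close>

lemma line_hol_UNIV_homogeneous:
  fixes p :: "complex ^ 'n ^ 'n \<Rightarrow> complex"
  assumes p: "line_hol cartan_domain p" and hom: "\<And>w Z. w \<noteq> 0 \<Longrightarrow> p (cmul w Z) = w ^ d * p Z"
  shows "line_hol UNIV p"
proof -
  have eq: "p Z = p (cmul (of_real r) Z) / of_real r ^ d" if "r > 0" for r Z
    using hom[of "of_real r" Z] that by simp
  have "continuous_on UNIV p"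
    unfolding continuous_on_eq_continuous_at[OF open_UNIV]
  proof
    fix Z :: "complex ^ 'n ^ 'n"
    obtain r where r: "r > 0" "\<And>Y :: complex ^ 'n ^ 'n. Y \<in> cball 0 (norm Z + 1) \<Longrightarrow> cmul (of_real r) Y \<in> cartan_domain"
      using exists_cmul_in_cartan_domain by blast
    have "continuous_on (ball 0 (norm Z + 1)) (\<lambda>Y. p (cmul (of_real r) Y))"
    proof (rule continuous_on_compose2[of cartan_domain p])
      show "continuous_on cartan_domain p"
        using p by (simp add: line_hol_def)
      show "(\<lambda>Y. cmul (of_real r) Y) ` ball (0 :: complex ^ 'n ^ 'n) (norm Z + 1) \<subseteq> cartan_domain"
        using r(2) by (auto simp: less_imp_le)
    qed (intro continuous_intros)
    then have "continuous_on (ball 0 (norm Z + 1)) (\<lambda>Y. p (cmul (of_real r) Y) / of_real r ^ d)"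
      using r(1) by (intro continuous_on_divide continuous_on_const) auto
    then have "continuous_on (ball 0 (norm Z + 1)) p"
      by (simp flip: eq[OF \<open>r > 0\<close>])
    then show "isCont p Z"
      by (rule continuous_on_interior) simp
  qed
  moreover have "(\<lambda>w. p (A + cmul w B)) holomorphic_on UNIV" for A B
  proof -
    have "(\<lambda>w. p (A + cmul w B)) holomorphic_on ball 0 R" for R
    proof -
      obtain r where r: "r > 0" "\<And>Y :: complex ^ 'n ^ 'n. Y \<in> cball 0 (norm A + R * norm B) \<Longrightarrow> cmul (of_real r) Y \<in> cartan_domain"
        using exists_cmul_in_cartan_domain by blast
      have sub: "ball 0 R \<subseteq> {w. cmul (of_real r) A + cmul w (cmul (of_real r) B) \<in> cartan_domain}"
      proof
        fix w :: complex
        assume "w \<in> ball 0 R"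
        then have "norm (A + cmul w B) \<le> norm A + R * norm B"
          by (intro norm_triangle_le add_left_mono) (simp add: norm_cmul mult_right_mono)
        then have "cmul (of_real r) (A + cmul w B) \<in> cartan_domain"
          using r(2) by simp
        then show "w \<in> {w. cmul (of_real r) A + cmul w (cmul (of_real r) B) \<in> cartan_domain}"
          by (simp add: cmul_add_right mult.commute)
      qed
      have "(\<lambda>w. p (cmul (of_real r) A + cmul w (cmul (of_real r) B)) / of_real r ^ d) holomorphic_on ball 0 R"
      proof (rule holomorphic_on_divide)
        have "(\<lambda>w. p (cmul (of_real r) A + cmul w (cmul (of_real r) B))) holomorphic_on
            {w. cmul (of_real r) A + cmul w (cmul (of_real r) B) \<in> cartan_domain}"
          using p unfolding line_hol_def by blast
        then show "(\<lambda>w. p (cmul (of_real r) A + cmul w (cmul (of_real r) B))) holomorphic_on ball 0 R"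
          using sub by (rule holomorphic_on_subset)
      qed (use \<open>r > 0\<close> in auto)
      moreover have "p (cmul (of_real r) A + cmul w (cmul (of_real r) B)) / of_real r ^ d = p (A + cmul w B)" for w
        unfolding eq[OF \<open>r > 0\<close>, of "A + cmul w B"] by (simp add: cmul_add_right mult.commute)
      ultimately show ?thesis by simp
    qed
    then have "(\<lambda>w. p (A + cmul w B)) holomorphic_on (\<Union>R. ball 0 R)"
      by (intro holomorphic_on_UN_open) auto
    moreover have "(\<Union>R. ball (0 :: complex) R) = UNIV"
      by (auto simp: gt_ex)
    ultimately show ?thesis by simp
  qed
  ultimately show ?thesis
    by (simp add: line_hol_def)
qed

lemma hom_part_cmul:
  fixes f :: "complex ^ 'n ^ 'n \<Rightarrow> complex"
  assumes f: "line_hol cartan_domain f"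
  shows "hom_part d f (cmul v Z) = v ^ d * hom_part d f Z"
proof -
  let ?T = "{w. cmul w Z \<in> cartan_domain}" and ?S = "{w. cmul w (cmul v Z) \<in> cartan_domain}"
  have "open {w. cmul w Y \<in> cartan_domain}" for Y :: "complex ^ 'n ^ 'n"
    using open_line[OF open_cartan_domain, of 0 Y] by simp
  from this[of Z] this[of "cmul v Z"] have "(deriv ^^ d) (\<lambda>w. f (cmul (v * w) Z)) 0 = v ^ d * (deriv ^^ d) (\<lambda>w. f (cmul w Z)) (v * 0)"
    by (intro higher_deriv_compose_linear[of "\<lambda>w. f (cmul w Z)" ?T ?S] line_hol_cmul[OF f])
       (simp_all add: zero_in_cartan_domain mult.commute[of v])
  then show ?thesis
    by (simp add: hom_part_def mult.commute)
qed

text \<open>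
  The integral formula transfers continuity and holomorphy from \<open>f\<close> to its homogeneous part on the
  domain; homogeneity extends both to all matrices.
\<close>

lemma hom_part_hforms:
  fixes f :: "complex ^ 'n ^ 'n \<Rightarrow> complex"
  assumes f: "line_hol cartan_domain f"
  shows "hom_part d f \<in> hforms d"
proof -
  let ?D = "cartan_domain :: (complex ^ 'n ^ 'n) set"
  let ?J = "\<lambda>Z. integral {0..1} (\<lambda>t. f (cmul (circ t) Z) / circ t ^ d)"
  have cf: "continuous_on ?D f"
    using f by (simp add: line_hol_def)
  have "continuous_on ?D ?J"
  proof -
    have "continuous_on (?D \<times> {0..1}) (\<lambda>x. f (cmul (circ (snd x)) (fst x)) / circ (snd x) ^ d)"
      by (intro continuous_intros continuous_on_compose2[OF cf])
         (auto simp: cmul_in_cartan_domain)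
    then show ?thesis
      using integral_continuous_on_param[of ?D 0 1 "\<lambda>Z t. f (cmul (circ t) Z) / circ t ^ d"]
      by (simp add: cbox_interval case_prod_beta')
  qed
  then have c: "continuous_on ?D (hom_part d f)"
    by (rule continuous_on_eq) (simp add: hom_part_integral[OF f])
  have "(\<lambda>w. ?J (A + cmul w B)) holomorphic_on {w. A + cmul w B \<in> ?D}" for A B
  proof (rule holomorphic_integral_param)
    show "continuous_on ({w. A + cmul w B \<in> ?D} \<times> {0..1})
        (\<lambda>(w, t). f (cmul (circ t) (A + cmul w B)) / circ t ^ d)"
      unfolding case_prod_beta'
      by (intro continuous_intros continuous_on_compose2[OF cf])
         (auto simp: cmul_in_cartan_domain)
    fix t :: real
    have "(\<lambda>w. f (cmul (circ t) A + cmul w (cmul (circ t) B))) holomorphic_on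
        {w. cmul (circ t) A + cmul w (cmul (circ t) B) \<in> ?D}"
      using f unfolding line_hol_def by blast
    moreover have "cmul (circ t) A + cmul w (cmul (circ t) B) = cmul (circ t) (A + cmul w B)" for w
      by (simp add: cmul_add_right mult.commute)
    ultimately show "(\<lambda>w. f (cmul (circ t) (A + cmul w B)) / circ t ^ d) holomorphic_on {w. A + cmul w B \<in> ?D}"
      by (simp add: cmul_in_cartan_domain_iff holomorphic_on_divide)
  qed (rule open_line[OF open_cartan_domain])
  then have "(\<lambda>w. hom_part d f (A + cmul w B)) holomorphic_on {w. A + cmul w B \<in> ?D}" for A B
    by (rule holomorphic_transform) (simp add: hom_part_integral[OF f])
  with c have "line_hol ?D (hom_part d f)"
    by (simp add: line_hol_def)
  then show ?thesis
    unfolding hforms_def using line_hol_UNIV_homogeneous hom_part_cmul[OF f] by blast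
qed

lemma hom_part_hform:
  assumes "p \<in> hforms d"
  shows "hom_part d p = p"
proof
  fix Z
  have "(\<lambda>w. p (cmul w Z)) = (\<lambda>w. p Z * w ^ d)"
    using hforms_D(2)[OF assms] by (simp add: mult.commute)
  moreover have "(deriv ^^ d) (\<lambda>w. p Z * w ^ d) 0 = p Z * (deriv ^^ d) (\<lambda>w. w ^ d) 0"
    by (rule higher_deriv_cmult[of _ UNIV]) (auto intro!: holomorphic_intros)
  moreover have "(deriv ^^ d) (\<lambda>w. w ^ d) (0 :: complex) = fact d"
    using higher_deriv_power[of d 0 d 0] by (simp add: pochhammer_fact)
  ultimately show "hom_part d p Z = p Z"
    by (simp add: hom_part_def)
qed

text \<open>
  The homogeneous parts at \<open>Z\<close> are the Taylor coefficients of the slice function \<open>w \<mapsto> g (w Z)\<close>, whose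
  domain of definition is star-shaped about \<open>0\<close> and contains \<open>1\<close>.
\<close>

lemma hom_part_zero_imp_zero:
  assumes g: "line_hol cartan_domain g" and zero: "\<And>d. hom_part d g Z = 0" and Z: "Z \<in> cartan_domain"
  shows "g Z = 0"
proof -
  let ?S = "{w. cmul w Z \<in> cartan_domain}"
  have "open ?S" using open_line[OF open_cartan_domain, of 0 Z] by simp
  have "starlike ?S"
    unfolding starlike_def
  proof (intro bexI ballI subsetI)
    fix w z
    assume w: "w \<in> ?S" and "z \<in> closed_segment 0 w"
    then obtain u where u: "0 \<le> u" "u \<le> 1" "z = of_real u * w"
      by (auto simp: closed_segment_def scaleR_conv_of_real)
    then have "cmul z Z = cmul (of_real u) (cmul w Z)" by simp
    then show "z \<in> ?S"
      using cmul_in_cartan_domain[of "cmul w Z" "of_real u"] w u by simp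
  qed (simp add: zero_in_cartan_domain)
  then have "connected ?S" by (rule starlike_imp_connected)
  have "(\<lambda>w. g (cmul w Z)) 1 = 0"
    by (rule holomorphic_fun_eq_0_on_connected[OF line_hol_cmul[OF g] \<open>open ?S\<close> \<open>connected ?S\<close>, of 0])
       (use zero Z in \<open>auto simp: hom_part_def zero_in_cartan_domain\<close>)
  then show ?thesis by simp
qed

lemma line_hol_add: "line_hol S f \<Longrightarrow> line_hol S g \<Longrightarrow> line_hol S (\<lambda>Z. f Z + g Z)"
  and line_hol_mult: "line_hol S f \<Longrightarrow> line_hol S g \<Longrightarrow> line_hol S (\<lambda>Z. f Z * g Z)"
  and line_hol_const [simp]: "line_hol S (\<lambda>Z. c)"
  unfolding line_hol_def by (auto intro!: continuous_intros holomorphic_intros)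

lemma line_hol_sum: "(\<And>k. k \<in> K \<Longrightarrow> line_hol S (f k)) \<Longrightarrow> line_hol S (\<lambda>Z. \<Sum>k\<in>K. f k Z)"
  by (induction K rule: infinite_finite_induct) (auto intro: line_hol_add)

lemma line_hol_prod: "(\<And>k. k \<in> K \<Longrightarrow> line_hol S (f k)) \<Longrightarrow> line_hol S (\<lambda>Z. \<Prod>k\<in>K. f k Z)"
  by (induction K rule: infinite_finite_induct) (auto intro: line_hol_mult)

lemma hom_part_sum:
  assumes "finite K" and f: "\<And>k. k \<in> K \<Longrightarrow> line_hol cartan_domain (f k)"
  shows "hom_part d (\<lambda>Z. \<Sum>k\<in>K. c k * f k Z) Z = (\<Sum>k\<in>K. c k * hom_part d (f k) Z)"
proof -
  let ?S = "{w. cmul w Z \<in> cartan_domain}"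
  have S: "open ?S" "0 \<in> ?S"
    using open_line[OF open_cartan_domain, of 0 Z] by (simp_all add: zero_in_cartan_domain)
  have "(deriv ^^ d) (\<lambda>w. \<Sum>k\<in>K. c k * f k (cmul w Z)) 0 = (\<Sum>k\<in>K. c k * (deriv ^^ d) (\<lambda>w. f k (cmul w Z)) 0)"
    using assms
  proof (induction K rule: finite_induct)
    case (insert k K)
    have "(deriv ^^ d) (\<lambda>w. c k * f k (cmul w Z) + (\<Sum>k\<in>K. c k * f k (cmul w Z))) 0
        = (deriv ^^ d) (\<lambda>w. c k * f k (cmul w Z)) 0 + (deriv ^^ d) (\<lambda>w. \<Sum>k\<in>K. c k * f k (cmul w Z)) 0"
      by (rule higher_deriv_add[OF _ _ S]) (auto intro!: line_hol_cmul line_hol_sum line_hol_mult insert.prems)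
    moreover have "(deriv ^^ d) (\<lambda>w. c k * f k (cmul w Z)) 0 = c k * (deriv ^^ d) (\<lambda>w. f k (cmul w Z)) 0"
      by (rule higher_deriv_cmult[OF line_hol_cmul S(2) S(1)]) (simp add: insert.prems)
    ultimately show ?case
      using insert by simp
  qed simp
  then show ?thesis
    by (simp add: hom_part_def sum_divide_distrib)
qed

section \<open>Interpolation of homogeneous forms\<close>

text \<open>
  For \<open>norm z \<ge> 1\<close> homogeneity gives \<open>p (A + z B) = z\<^sup>d p (A / z + B)\<close>, and the second factor is
  bounded by compactness. Liouville's theorem turns this growth bound into a degree bound.
\<close>

lemma hform_line_poly:
  fixes A B :: "complex ^ 'n ^ 'n"
  assumes p: "p \<in> hforms d"
  shows "\<exists>q. degree q \<le> d \<and> (\<forall>z. p (A + cmul z B) = poly q z)"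
proof -
  let ?g = "\<lambda>z. p (A + cmul z B)"
  have "compact ((\<lambda>u. p (cmul u A + B)) ` cball 0 1)"
    by (intro compact_continuous_image continuous_on_compose2[OF hforms_D(3)[OF p, of UNIV]] continuous_intros) auto
  then obtain C where C: "\<And>u. norm u \<le> 1 \<Longrightarrow> norm (p (cmul u A + B)) \<le> C"
    by (force dest!: compact_imp_bounded simp: bounded_iff)
  have "norm (?g z) \<le> C * norm z ^ d" if "1 \<le> norm z" for z
  proof -
    have "z \<noteq> 0" using that by auto
    then have "A + cmul z B = cmul z (cmul (1 / z) A + B)"
      by (simp add: cmul_add_right)
    then have "norm (?g z) = norm z ^ d * norm (p (cmul (1 / z) A + B))"
      by (simp only: hforms_D(2)[OF p] norm_mult norm_power)
    also have "\<dots> \<le> norm z ^ d * C"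
      by (intro mult_left_mono C) (use that in \<open>auto simp: norm_divide divide_simps\<close>)
    finally show ?thesis by (simp add: mult.commute)
  qed
  then have eq: "?g z = (\<Sum>k\<le>d. (deriv ^^ k) ?g 0 / fact k * z ^ k)" for z
    using Liouville_polynomial[OF hforms_D(4)[OF p]] by blast
  define q where "q = (\<Sum>k\<le>d. monom ((deriv ^^ k) ?g 0 / fact k) k)"
  have "degree q \<le> d"
    unfolding q_def by (rule degree_sum_le) (auto intro: order_trans[OF degree_monom_le])
  moreover have "?g z = poly q z" for z
    unfolding q_def eq[of z] by (simp add: poly_sum poly_monom)
  ultimately show ?thesis by blast
qed

definition lagrange_basis :: "nat \<Rightarrow> nat \<Rightarrow> complex \<Rightarrow> complex" where
  "lagrange_basis d k z = (\<Prod>j\<in>{..d} - {k}. (z - of_nat j) / (of_nat k - of_nat j))"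

lemma lagrange_interpolation:
  fixes q :: "complex poly"
  assumes "degree q \<le> d"
  shows "poly q z = (\<Sum>k\<le>d. poly q (of_nat k) * lagrange_basis d k z)"
proof -
  define l where "l k = (\<Prod>j\<in>{..d} - {k}. [:- of_nat j / (of_nat k - of_nat j), 1 / (of_nat k - of_nat j):] :: complex poly)" for k
  define r where "r = (\<Sum>k\<le>d. smult (poly q (of_nat k)) (l k))"
  have l: "poly (l k) z = lagrange_basis d k z" for k z
    by (simp add: l_def lagrange_basis_def poly_prod diff_divide_distrib)
  have deg_l: "degree (l k) \<le> d" if "k \<le> d" for k
  proof -
    have "degree (l k) \<le> sum (degree \<circ> (\<lambda>j. [:- of_nat j / (of_nat k - of_nat j), 1 / (of_nat k - of_nat j) :: complex:])) ({..d} - {k})"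
      unfolding l_def by (rule degree_prod_sum_le) simp
    also have "\<dots> \<le> (\<Sum>j\<in>{..d} - {k}. 1)"
      by (intro sum_mono) auto
    also have "\<dots> = d" using that by simp
    finally show ?thesis .
  qed
  have "degree r \<le> d"
    unfolding r_def by (rule degree_sum_le) (auto intro: order_trans[OF degree_smult_le] deg_l)
  have delta: "lagrange_basis d k (of_nat m) = (if k = m then 1 else 0)" if "m \<le> d" for k m
    using that by (auto simp: lagrange_basis_def intro!: prod.neutral)
  have "poly r (of_nat m) = poly q (of_nat m)" if "m \<le> d" for m
    using that by (simp add: r_def poly_sum l delta if_distrib cong: if_cong)
  moreover have "card (of_nat ` {..d} :: complex set) = Suc d"
    by (simp add: card_image inj_on_def)
  ultimately have "q = r"
    by (intro poly_eqI_degree[of "of_nat ` {..d}"]) (use assms \<open>degree r \<le> d\<close> in auto)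
  then have "poly q z = poly r z" by simp
  then show ?thesis
    by (simp add: r_def poly_sum l)
qed

definition override_entries ::
  "('n \<times> 'n) set \<Rightarrow> ('n \<times> 'n \<Rightarrow> nat) \<Rightarrow> complex ^ 'n ^ 'n \<Rightarrow> complex ^ 'n ^ 'n" where
  "override_entries I \<kappa> Z = (\<chi> i j. if (i, j) \<in> I then of_nat (\<kappa> (i, j)) else Z $ i $ j)"

text \<open>
  A form has degree at most \<open>d\<close> in each matrix entry, so Lagrange interpolation at the nodes
  \<open>0, \<dots>, d\<close> can be carried out in one entry after another.
\<close>

lemma hform_partial_interpolation:
  fixes Z :: "complex ^ 'n ^ 'n"
  assumes p: "p \<in> hforms d" and "finite I"
  shows "p Z = (\<Sum>\<kappa>\<in>I \<rightarrow>\<^sub>E {..d}. p (override_entries I \<kappa> Z) * (\<Prod>x\<in>I. lagrange_basis d (\<kappa> x) (Z $ fst x $ snd x)))"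
  using \<open>finite I\<close>
proof (induction I rule: finite_induct)
  case empty
  show ?case by (simp add: override_entries_def)
next
  case (insert x I)
  let ?l = "\<lambda>k x. lagrange_basis d k (Z $ fst x $ snd x)"
  let ?P = "\<lambda>I \<kappa>. \<Prod>x\<in>I. ?l (\<kappa> x) x"
  have step: "p (override_entries I \<kappa> Z)
      = (\<Sum>k\<le>d. p (override_entries (insert x I) (\<kappa>(x := k)) Z) * ?l k x)" for \<kappa>
  proof -
    define A where "A = (\<chi> i j. if (i, j) = x then 0 else override_entries I \<kappa> Z $ i $ j)"
    define E :: "complex ^ 'n ^ 'n" where "E = (\<chi> i j. if (i, j) = x then 1 else 0)"
    have 1: "override_entries I \<kappa> Z = A + cmul (Z $ fst x $ snd x) E"
      using insert.hyps(2) by (auto simp: vec_eq_iff A_def E_def override_entries_def)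
    have 2: "override_entries (insert x I) (\<kappa>(x := k)) Z = A + cmul (of_nat k) E" for k
      using insert.hyps(2) by (auto simp: vec_eq_iff A_def E_def override_entries_def)
    obtain q where q: "degree q \<le> d" "\<And>z. p (A + cmul z E) = poly q z"
      using hform_line_poly[OF p] by blast
    show ?thesis
      unfolding 1 2 q(2) by (rule lagrange_interpolation[OF q(1)])
  qed
  have inj: "inj_on (\<lambda>(k, \<kappa>). \<kappa>(x := k)) ({..d} \<times> (I \<rightarrow>\<^sub>E {..d}))"
    by (rule inj_combinator[OF insert.hyps(2)])
  have "(\<Sum>\<kappa>\<in>insert x I \<rightarrow>\<^sub>E {..d}. p (override_entries (insert x I) \<kappa> Z) * ?P (insert x I) \<kappa>)
      = (\<Sum>(k, \<kappa>)\<in>{..d} \<times> (I \<rightarrow>\<^sub>E {..d}). p (override_entries (insert x I) (\<kappa>(x := k)) Z) * ?P (insert x I) (\<kappa>(x := k)))"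
    unfolding PiE_insert_eq using inj by (simp add: sum.reindex case_prod_beta')
  also have "\<dots> = (\<Sum>(k, \<kappa>)\<in>{..d} \<times> (I \<rightarrow>\<^sub>E {..d}). p (override_entries (insert x I) (\<kappa>(x := k)) Z) * ?l k x * ?P I \<kappa>)"
  proof (rule sum.cong[OF refl])
    fix y
    assume "y \<in> {..d} \<times> (I \<rightarrow>\<^sub>E {..d})"
    have "?P I (\<kappa>(x := k)) = ?P I \<kappa>" for \<kappa> k
      using insert.hyps(2) by (intro prod.cong) auto
    then have "?P (insert x I) (\<kappa>(x := k)) = ?l k x * ?P I \<kappa>" for \<kappa> k
      using insert.hyps by (simp del: fun_upd_apply) simp
    then show "(case y of (k, \<kappa>) \<Rightarrow> p (override_entries (insert x I) (\<kappa>(x := k)) Z) * ?P (insert x I) (\<kappa>(x := k)))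
      = (case y of (k, \<kappa>) \<Rightarrow> p (override_entries (insert x I) (\<kappa>(x := k)) Z) * ?l k x * ?P I \<kappa>)"
      by (simp add: case_prod_beta' mult.assoc)
  qed
  also have "\<dots> = (\<Sum>k\<le>d. \<Sum>\<kappa>\<in>I \<rightarrow>\<^sub>E {..d}. p (override_entries (insert x I) (\<kappa>(x := k)) Z) * ?l k x * ?P I \<kappa>)"
    by (simp add: sum.cartesian_product)
  also have "\<dots> = (\<Sum>\<kappa>\<in>I \<rightarrow>\<^sub>E {..d}. \<Sum>k\<le>d. p (override_entries (insert x I) (\<kappa>(x := k)) Z) * ?l k x * ?P I \<kappa>)"
    by (rule sum.swap)
  also have "\<dots> = (\<Sum>\<kappa>\<in>I \<rightarrow>\<^sub>E {..d}. p (override_entries I \<kappa> Z) * ?P I \<kappa>)"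
    unfolding step by (simp add: sum_distrib_right)
  also have "\<dots> = p Z"
    using insert.IH by simp
  finally show ?case by simp
qed

definition grid :: "('n \<times> 'n \<Rightarrow> nat) \<Rightarrow> complex ^ 'n ^ 'n" where
  "grid \<kappa> = (\<chi> i j. of_nat (\<kappa> (i, j)))"

definition grid_basis :: "nat \<Rightarrow> ('n::finite \<times> 'n \<Rightarrow> nat) \<Rightarrow> complex ^ 'n ^ 'n \<Rightarrow> complex" where
  "grid_basis d \<kappa> Z = (\<Prod>x\<in>UNIV. lagrange_basis d (\<kappa> x) (Z $ fst x $ snd x))"

abbreviation grid_index :: "nat \<Rightarrow> ('n \<times> 'n \<Rightarrow> nat) set" where
  "grid_index d \<equiv> UNIV \<rightarrow>\<^sub>E {..d}"

lemma finite_grid_index: "finite (grid_index d :: ('n::finite \<times> 'n \<Rightarrow> nat) set)"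
  by (rule finite_PiE) auto

lemma hform_grid_interpolation:
  assumes "p \<in> hforms d"
  shows "p Z = (\<Sum>\<kappa>\<in>grid_index d. p (grid \<kappa>) * grid_basis d \<kappa> Z)"
  using hform_partial_interpolation[OF assms finite, of Z UNIV]
  by (simp add: override_entries_def grid_def grid_basis_def)

lemma line_hol_grid_basis: "line_hol S (grid_basis d \<kappa>)"
proof -
  have "line_hol S (\<lambda>Z. lagrange_basis d k (Z $ i $ j))" for k i j
  proof -
    have "line_hol S (\<lambda>Z. Z $ i $ j)"
      unfolding line_hol_def by (auto intro!: continuous_intros holomorphic_intros)
    then have "line_hol S (\<lambda>Z. (Z $ i $ j + (- a)) * inverse b)" for a b
      by (intro line_hol_mult line_hol_add line_hol_const)
    then show ?thesis
      unfolding lagrange_basis_def by (intro line_hol_prod) (simp add: divide_inverse)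
  qed
  then show ?thesis
    unfolding grid_basis_def[abs_def] by (intro line_hol_prod) auto
qed

text \<open>
  The products of Lagrange polynomials are not homogeneous, but taking the homogeneous part of degree
  \<open>d\<close> on both sides of the interpolation formula replaces them by forms. A linear operator can then be
  applied termwise, with the values of \<open>p\<close> on the grid as coefficients.
\<close>

lemma hform_expansion:
  assumes p: "p \<in> hforms d"
  shows "p Z = (\<Sum>\<kappa>\<in>grid_index d. p (grid \<kappa>) * hom_part d (grid_basis d \<kappa>) Z)"
proof -
  have "p = (\<lambda>Z. \<Sum>\<kappa>\<in>grid_index d. p (grid \<kappa>) * grid_basis d \<kappa> Z)"
    by (rule ext) (rule hform_grid_interpolation[OF p])
  then have "hom_part d p Z = hom_part d (\<lambda>Z. \<Sum>\<kappa>\<in>grid_index d. p (grid \<kappa>) * grid_basis d \<kappa> Z) Z"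
    by (rule arg_cong)
  also have "\<dots> = (\<Sum>\<kappa>\<in>grid_index d. p (grid \<kappa>) * hom_part d (grid_basis d \<kappa>) Z)"
    by (rule hom_part_sum[OF finite_grid_index line_hol_grid_basis])
  finally show ?thesis
    by (simp only: hom_part_hform[OF p])
qed

lemma hform_compose_holomorphic:
  fixes \<gamma> :: "complex \<Rightarrow> complex ^ 'n ^ 'n"
  assumes p: "p \<in> hforms d" and "\<And>i j. (\<lambda>z. \<gamma> z $ i $ j) holomorphic_on S"
  shows "(\<lambda>z. p (\<gamma> z)) holomorphic_on S"
proof -
  have "(\<lambda>z. p (\<gamma> z)) = (\<lambda>z. \<Sum>\<kappa>\<in>grid_index d. p (grid \<kappa>) * grid_basis d \<kappa> (\<gamma> z))"
    by (rule ext) (rule hform_grid_interpolation[OF p])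
  moreover have "\<dots> holomorphic_on S"
    unfolding grid_basis_def lagrange_basis_def divide_inverse by (intro holomorphic_intros assms(2))
  ultimately show ?thesis by simp
qed

lemma matrix_add_rdistrib: "(A + B) ** C = A ** C + B ** (C :: complex ^ 'n ^ 'n)"
  and matrix_diff_rdistrib: "(A - B) ** C = A ** C - B ** (C :: complex ^ 'n ^ 'n)"
  and matrix_diff_ldistrib: "A ** (B - C) = A ** B - A ** (C :: complex ^ 'n ^ 'n)"
  by (simp_all add: vec_eq_iff matrix_matrix_mult_def algebra_simps sum.distrib sum_subtractf)

lemma hforms_mult_left:
  assumes p: "p \<in> hforms d"
  shows "(\<lambda>Z. p (A ** Z)) \<in> hforms d"
  unfolding hforms_def line_hol_def mem_Collect_eq
proof (intro conjI allI)
  show "continuous_on UNIV (\<lambda>Z. p (A ** Z))"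
    by (intro continuous_on_compose2[OF hforms_D(3)[OF p, of UNIV]] continuous_intros) auto
  show "(\<lambda>w. p (A ** (X + cmul w B))) holomorphic_on {w. X + cmul w B \<in> UNIV}" for X B
    using hforms_D(4)[OF p, of "A ** X" "A ** B"] by (simp add: matrix_add_ldistrib matrix_mult_cmul_right)
qed (simp add: matrix_mult_cmul_right hforms_D(2)[OF p])

lemma hforms_mult_right:
  assumes p: "p \<in> hforms d"
  shows "(\<lambda>Z. p (Z ** A)) \<in> hforms d"
  unfolding hforms_def line_hol_def mem_Collect_eq
proof (intro conjI allI)
  show "continuous_on UNIV (\<lambda>Z. p (Z ** A))"
    by (intro continuous_on_compose2[OF hforms_D(3)[OF p, of UNIV]] continuous_intros) auto
  show "(\<lambda>w. p ((X + cmul w B) ** A)) holomorphic_on {w. X + cmul w B \<in> UNIV}" for X B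
    using hforms_D(4)[OF p, of "X ** A" "B ** A"] by (simp add: matrix_add_rdistrib matrix_mult_cmul_left)
qed (simp add: matrix_mult_cmul_left hforms_D(2)[OF p])

lemma hforms_combination:
  assumes "finite K" "\<And>k. k \<in> K \<Longrightarrow> f k \<in> hforms d"
  shows "(\<lambda>Z. \<Sum>k\<in>K. c k * f k Z) \<in> hforms d"
  using assms unfolding hforms_def
  by (auto intro!: line_hol_sum line_hol_mult simp: sum_distrib_left algebra_simps)

lemma hforms_diff:
  assumes "p \<in> hforms d" "q \<in> hforms d"
  shows "(\<lambda>Z. p Z - q Z) \<in> hforms d"
  using assms unfolding hforms_def line_hol_def
  by (auto intro!: continuous_intros holomorphic_intros simp: right_diff_distrib)

section \<open>The unitary group is a set of uniqueness\<close>

text \<open>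
  Cramer's formula. In contrast to the inverse, its entries are polynomials in the entries of \<open>A\<close>.
\<close>

definition adjugate :: "complex ^ 'n ^ 'n \<Rightarrow> complex ^ 'n ^ 'n" where
  "adjugate A = (\<chi> k l. det (\<chi> i j. if j = k then (if i = l then 1 else 0) else A $ i $ j))"

lemma mult_adjugate:
  fixes A :: "complex ^ 'n ^ 'n"
  assumes "det A \<noteq> 0"
  shows "A ** adjugate A = cmul (det A) (mat 1)"
proof -
  have "(A ** adjugate A) $ m $ l = det A * mat 1 $ m $ l" for m l
  proof -
    let ?b = "(\<chi> i. if i = l then 1 else 0) :: complex ^ 'n"
    have "A *v (\<chi> k. adjugate A $ k $ l / det A) = ?b"
      unfolding cramer[OF assms] by (simp add: adjugate_def vec_eq_iff cong: if_cong)
    then have "(\<Sum>k\<in>UNIV. A $ m $ k * (adjugate A $ k $ l / det A)) = (if m = l then 1 else 0)"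
      by (simp add: matrix_vector_mult_def vec_eq_iff)
    then have "(\<Sum>k\<in>UNIV. A $ m $ k * adjugate A $ k $ l) / det A = (if m = l then 1 else 0)"
      by (simp add: sum_divide_distrib)
    then show ?thesis
      using assms by (auto simp: matrix_matrix_mult_def mat_def field_simps split: if_splits)
  qed
  then show ?thesis by (simp add: vec_eq_iff)
qed

lemma adjugate_eq:
  fixes A :: "complex ^ 'n ^ 'n"
  assumes "M ** A = mat 1" "det A \<noteq> 0"
  shows "adjugate A = cmul (det A) M"
proof -
  have "adjugate A = M ** (A ** adjugate A)"
    by (simp add: matrix_mul_assoc assms(1))
  also have "\<dots> = cmul (det A) M"
    by (simp add: mult_adjugate[OF assms(2)] matrix_mult_cmul_right)
  finally show ?thesis .
qed

lemma holomorphic_on_det: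
  fixes \<gamma> :: "complex \<Rightarrow> complex ^ 'n ^ 'n"
  assumes "\<And>i j. (\<lambda>z. \<gamma> z $ i $ j) holomorphic_on S"
  shows "(\<lambda>z. det (\<gamma> z)) holomorphic_on S"
  unfolding det_def by (intro holomorphic_intros assms)

lemma complex_neg_eq_self: "- s = s \<Longrightarrow> s = (0 :: complex)"
  by (simp add: complex_eq_iff)

lemma det_one_minus_skew:
  fixes X :: "complex ^ 'n ^ 'n"
  assumes "ctranspose X = - X"
  shows "det (mat 1 - X) \<noteq> 0"
proof -
  have "x = 0" if "(mat 1 - X) *v x = 0" for x
  proof -
    have x: "X *v x = x"
      using that by (simp add: matrix_vector_mult_diff_rdistrib)
    have "ctranspose X *v x = - x"
      using assms x matrix_vector_mult_diff_rdistrib[of 0 X x] by simp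
    then have "- (\<Sum>i\<in>UNIV. x $ i * cnj (x $ i)) = (\<Sum>i\<in>UNIV. x $ i * cnj (x $ i))"
      using sesquilinear_ctranspose[of X x x] x by (simp add: sum_negf)
    then have "(\<Sum>i\<in>UNIV. x $ i * cnj (x $ i)) = 0"
      by (rule complex_neg_eq_self)
    then have "(norm x)\<^sup>2 = 0"
      by (simp only: norm_vec_power2 zero_complex.sel(1))
    then show "x = 0" by simp
  qed
  then show ?thesis
    by (metis invertible_det_nz invertible_left_inverse matrix_left_invertible_ker)
qed

lemma cayley_unitary:
  fixes X :: "complex ^ 'n ^ 'n"
  assumes X: "ctranspose X = - X" and M: "(mat 1 - X) ** M = mat 1" "M ** (mat 1 - X) = mat 1"
  shows "unitary ((mat 1 + X) ** M)"
proof -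
  define N where "N = ctranspose M"
  have ct: "ctranspose (mat 1 - X) = mat 1 + X" "ctranspose (mat 1 + X) = mat 1 - X"
    by (simp_all add: ctranspose_diff ctranspose_add X)
  have N: "N ** (mat 1 + X) = mat 1" "(mat 1 + X) ** N = mat 1"
    unfolding N_def ct(1)[symmetric] ctranspose_mult[symmetric] using M by simp_all
  have comm: "(mat 1 - X) ** (mat 1 + X) = (mat 1 + X) ** (mat 1 - X)"
    by (simp add: matrix_add_ldistrib matrix_add_rdistrib matrix_diff_rdistrib matrix_diff_ldistrib)
  have U: "ctranspose ((mat 1 + X) ** M) = N ** (mat 1 - X)"
    by (simp add: ctranspose_mult ct N_def)
  have "(N ** (mat 1 - X)) ** ((mat 1 + X) ** M) = N ** ((mat 1 - X) ** (mat 1 + X)) ** M"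
    by (simp add: matrix_mul_assoc)
  also have "\<dots> = (N ** (mat 1 + X)) ** ((mat 1 - X) ** M)"
    unfolding comm by (simp add: matrix_mul_assoc)
  finally have 1: "ctranspose ((mat 1 + X) ** M) ** ((mat 1 + X) ** M) = mat 1"
    by (simp add: U N M)
  then show ?thesis
    unfolding unitary_def using matrix_left_right_inverse by blast
qed

lemma zero_islimpt_Reals: "(0 :: complex) islimpt \<real>"
  unfolding islimpt_approachable
proof (intro allI impI)
  fix e :: real
  assume "e > 0"
  then show "\<exists>x'\<in>\<real>. x' \<noteq> 0 \<and> dist x' (0 :: complex) < e"
    by (intro bexI[of _ "of_real (e / 2)"]) auto
qed

text \<open>
  The Cayley transform \<open>(1 + X) (1 - X)\<^sup>-\<^sup>1\<close> of a skew-Hermitian \<open>X\<close> is unitary, and by homogeneity the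
  inverse may be replaced by the adjugate, which makes \<open>F\<close> of the transform an entire function of \<open>X\<close>
  that vanishes for skew-Hermitian \<open>X\<close>. Every matrix is \<open>S + \<i> T\<close> with \<open>S\<close> and \<open>T\<close> skew-Hermitian, so
  the identity theorem on the line \<open>z \<mapsto> S + z T\<close> makes it vanish for all \<open>X\<close>. Every \<open>W\<close> for which
  \<open>W + 1\<close> is invertible is a Cayley transform; these \<open>W\<close> include a neighbourhood of the identity matrix,
  and the identity theorem on the line through the identity matrix and \<open>W\<close> gives the rest.
\<close>

lemma hform_zero_on_unitary:
  fixes F :: "complex ^ 'n ^ 'n \<Rightarrow> complex"
  assumes F: "F \<in> hforms d" and zero: "\<And>U. unitary U \<Longrightarrow> F U = 0"
  shows "F W = 0"
proof -
  let ?C = "\<lambda>X. (mat 1 + X) ** adjugate (mat 1 - X)"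
  have skew: "F (?C X) = 0" if X: "ctranspose X = - X" for X
  proof -
    have det: "det (mat 1 - X) \<noteq> 0" by (rule det_one_minus_skew[OF X])
    then obtain M where M: "(mat 1 - X) ** M = mat 1" "M ** (mat 1 - X) = mat 1"
      using invertible_det_nz invertible_def by metis
    have "?C X = cmul (det (mat 1 - X)) ((mat 1 + X) ** M)"
      by (simp add: adjugate_eq[OF M(2) det] matrix_mult_cmul_right)
    then show ?thesis
      using zero[OF cayley_unitary[OF X M]] by (simp add: hforms_D(2)[OF F])
  qed
  have all: "F (?C X) = 0" for X
  proof -
    \<comment> \<open>The decomposition of \<open>X\<close> into \<open>S + \<i> T\<close> with skew-Hermitian \<open>S\<close> and \<open>T\<close>.\<close>
    define S where "S = cmul (1 / 2) (X - ctranspose X)"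
    define T where "T = cmul (- \<i> / 2) (X + ctranspose X)"
    have X: "X = S + cmul \<i> T"
      by (simp add: vec_eq_iff S_def T_def field_simps)
    have "ctranspose (S + cmul (of_real t) T) = - (S + cmul (of_real t) T)" for t
      by (simp add: vec_eq_iff S_def T_def field_simps)
    then have real: "F (?C (S + cmul z T)) = 0" if "z \<in> \<real>" for z
      using that skew by (auto elim!: Reals_cases)
    have "(\<lambda>z. F (?C (S + cmul z T))) holomorphic_on UNIV"
    proof (rule hform_compose_holomorphic[OF F])
      fix i j
      have "(\<lambda>z. adjugate (mat 1 - (S + cmul z T)) $ k $ j) holomorphic_on UNIV" for k
      proof -
        have "(\<lambda>z. (\<chi> m l. if l = k then (if m = j then 1 else 0)
            else (mat 1 - (S + cmul z T)) $ m $ l) $ m $ l) holomorphic_on UNIV" for m l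
          by (cases "l = k"; cases "m = j") (auto intro!: holomorphic_intros)
        then show ?thesis
          unfolding adjugate_def by (simp add: holomorphic_on_det)
      qed
      then show "(\<lambda>z. ?C (S + cmul z T) $ i $ j) holomorphic_on UNIV"
        by (auto simp: matrix_matrix_mult_def intro!: holomorphic_intros)
    qed
    then have "F (?C (S + cmul \<i> T)) = 0"
      by (rule analytic_continuation[where U = \<real> and \<xi> = 0]) (use zero_islimpt_Reals real in auto)
    then show ?thesis using X by simp
  qed
  have generic: "F W = 0" if det: "det (W + mat 1) \<noteq> 0" for W
  proof -
    obtain P where P: "(W + mat 1) ** P = mat 1" "P ** (W + mat 1) = mat 1"
      using det invertible_det_nz invertible_def by metis
    \<comment> \<open>The inverse Cayley transform of \<open>W\<close>.\<close>
    define X where "X = (W - mat 1) ** P"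
    have WP: "mat 1 = W ** P + P" and X: "X = W ** P - P"
      using P(1) by (simp_all add: X_def matrix_add_rdistrib matrix_diff_rdistrib)
    have minus: "mat 1 - X = cmul 2 P"
      unfolding WP X by (simp add: vec_eq_iff)
    have plus: "mat 1 + X = cmul 2 (W ** P)"
      unfolding WP X by (simp add: vec_eq_iff)
    have inv: "cmul (1 / 2) (W + mat 1) ** (mat 1 - X) = mat 1"
      unfolding minus by (simp add: matrix_mult_cmul_left matrix_mult_cmul_right P)
    have nz: "det (mat 1 - X) \<noteq> 0"
      using inv by (metis invertible_def invertible_det_nz matrix_left_right_inverse)
    have "?C X = cmul (det (mat 1 - X)) ((W ** P) ** (W + mat 1))"
      unfolding adjugate_eq[OF inv nz] unfolding plus
      by (simp add: matrix_mult_cmul_left matrix_mult_cmul_right)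
    also have "(W ** P) ** (W + mat 1) = W"
      by (simp add: P flip: matrix_mul_assoc)
    finally show ?thesis
      using all[of X] nz by (simp add: hforms_D(2)[OF F])
  qed
  let ?L = "\<lambda>w. mat 1 + cmul w (W - mat 1)"
  define V where "V = {w. det (?L w + mat 1) \<noteq> 0}"
  have "(\<lambda>w. det (?L w + mat 1)) holomorphic_on UNIV"
    by (rule holomorphic_on_det) (auto intro!: holomorphic_intros)
  then have "open V"
    unfolding V_def by (intro open_Collect_neq continuous_on_const holomorphic_on_imp_continuous_on)
  moreover have "0 \<in> V"
  proof -
    have "mat 1 + mat 1 = (cmul 2 (mat 1) :: complex ^ 'n ^ 'n)"
      by (simp add: vec_eq_iff)
    moreover have "cmul (1 / 2) (mat 1) ** cmul 2 (mat 1) = (mat 1 :: complex ^ 'n ^ 'n)"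
      by (simp add: matrix_mult_cmul_left)
    ultimately show ?thesis
      unfolding V_def by (simp, metis invertible_def invertible_det_nz matrix_left_right_inverse)
  qed
  ultimately have "0 islimpt V"
    by (simp add: open_imp_islimpt)
  moreover have "F (?L w) = 0" if "w \<in> V" for w
    using that by (intro generic) (simp add: V_def)
  ultimately have "F (?L 1) = 0"
    by (rule analytic_continuation[OF hforms_D(4)[OF F] open_UNIV connected_UNIV subset_UNIV UNIV_I _ _ UNIV_I])
  then show ?thesis by simp
qed

section \<open>Operators commuting with one-sided translations\<close>

text \<open>
  Linearity is expressed for sums with the index type of the interpolation grid, since a definition
  cannot quantify over all index types.
\<close>

definition linear_on_hforms :: "nat \<Rightarrow> ((complex ^ 'n ^ 'n \<Rightarrow> complex) \<Rightarrow> complex ^ 'n ^ 'n \<Rightarrow> complex) \<Rightarrow> bool" where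
  "linear_on_hforms d T \<longleftrightarrow> T \<in> hforms d \<rightarrow> hforms d \<and>
     (\<forall>(K :: ('n \<times> 'n \<Rightarrow> nat) set) c f. finite K \<longrightarrow> (\<forall>k\<in>K. f k \<in> hforms d) \<longrightarrow>
        T (\<lambda>Z. \<Sum>k\<in>K. c k * f k Z) = (\<lambda>Z. \<Sum>k\<in>K. c k * T (f k) Z))"

lemma linear_on_hforms_sum:
  fixes K :: "('n::finite \<times> 'n \<Rightarrow> nat) set" and f :: "_ \<Rightarrow> complex ^ 'n ^ 'n \<Rightarrow> complex"
  assumes "linear_on_hforms d T" "finite K" "\<And>k. k \<in> K \<Longrightarrow> f k \<in> hforms d"
  shows "T (\<lambda>Z. \<Sum>k\<in>K. c k * f k Z) = (\<lambda>Z. \<Sum>k\<in>K. c k * T (f k) Z)"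
  by (rule assms(1)[unfolded linear_on_hforms_def, THEN conjunct2, rule_format, OF assms(2,3)])

text \<open>
  Here \<open>m\<close> is matrix multiplication in one of the two orders. Expanding \<open>p (m W _)\<close> on the grid shows
  that \<open>T (\<lambda>Z. p (m W Z)) Y - T p (m W Y)\<close> is a form in \<open>W\<close>. It vanishes for unitary \<open>W\<close> by hypothesis,
  hence for all \<open>W\<close>; at \<open>Y = 1\<close> this expresses \<open>T p\<close> by translates of \<open>p\<close> on the other side.
\<close>

lemma translation_invariant_operator:
  fixes m :: "complex ^ 'n ^ 'n \<Rightarrow> complex ^ 'n ^ 'n \<Rightarrow> complex ^ 'n ^ 'n"
  assumes T: "linear_on_hforms d T"
    and m_right: "\<And>p W. p \<in> hforms d \<Longrightarrow> (\<lambda>Z. p (m W Z)) \<in> hforms d"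
    and m_left: "\<And>p Z. p \<in> hforms d \<Longrightarrow> (\<lambda>W. p (m W Z)) \<in> hforms d"
    and unit: "\<And>W. m W (mat 1) = W"
    and inv: "\<And>U p. unitary U \<Longrightarrow> p \<in> hforms d \<Longrightarrow> T (\<lambda>Z. p (m U Z)) = (\<lambda>Z. T p (m U Z))"
  shows "\<exists>t. \<forall>p\<in>hforms d. \<forall>W. T p W = (\<Sum>\<kappa>\<in>grid_index d. t \<kappa> * p (m W (grid \<kappa>)))"
proof -
  let ?B = "\<lambda>\<kappa>. hom_part d (grid_basis d \<kappa>)"
  have B: "?B \<kappa> \<in> hforms d" for \<kappa> :: "'n \<times> 'n \<Rightarrow> nat"
    by (rule hom_part_hforms[OF line_hol_grid_basis])
  have TB: "T (?B \<kappa>) \<in> hforms d" for \<kappa>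
    using T B by (auto simp: linear_on_hforms_def)
  have expand: "T (\<lambda>Z. p (m W Z)) Y = (\<Sum>\<kappa>\<in>grid_index d. p (m W (grid \<kappa>)) * T (?B \<kappa>) Y)"
    if p: "p \<in> hforms d" for p W Y
  proof -
    have "(\<lambda>Z. p (m W Z)) = (\<lambda>Z. \<Sum>\<kappa>\<in>grid_index d. p (m W (grid \<kappa>)) * ?B \<kappa> Z)"
      by (rule ext) (rule hform_expansion[OF m_right[OF p]])
    moreover have "T (\<lambda>Z. \<Sum>\<kappa>\<in>grid_index d. p (m W (grid \<kappa>)) * ?B \<kappa> Z)
        = (\<lambda>Z. \<Sum>\<kappa>\<in>grid_index d. p (m W (grid \<kappa>)) * T (?B \<kappa>) Z)"
      by (rule linear_on_hforms_sum[OF T finite_grid_index B])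
    ultimately show ?thesis by simp
  qed
  have comm: "T (\<lambda>Z. p (m W Z)) Y = T p (m W Y)" if p: "p \<in> hforms d" for p W Y
  proof -
    let ?F = "\<lambda>W. (\<Sum>\<kappa>\<in>grid_index d. T (?B \<kappa>) Y * p (m W (grid \<kappa>))) - T p (m W Y)"
    have Tp: "T p \<in> hforms d" using T p by (auto simp: linear_on_hforms_def)
    have "?F \<in> hforms d"
      by (intro hforms_diff hforms_combination finite_grid_index m_left p Tp)
    moreover have "?F U = 0" if "unitary U" for U
      using expand[OF p, of U Y] inv[OF that p] by (simp add: mult.commute)
    ultimately have "?F W = 0"
      by (rule hform_zero_on_unitary)
    then show ?thesis
      using expand[OF p, of W Y] by (simp add: mult.commute)
  qed
  have "T p W = (\<Sum>\<kappa>\<in>grid_index d. T (?B \<kappa>) (mat 1) * p (m W (grid \<kappa>)))" if "p \<in> hforms d" for p W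
    using comm[OF that, of W "mat 1"] expand[OF that, of W "mat 1"] by (simp add: unit mult.commute)
  then show ?thesis
    by (intro exI[of _ "\<lambda>\<kappa>. T (?B \<kappa>) (mat 1)"]) blast
qed

lemma left_right_commute_on_hforms:
  fixes S T :: "(complex ^ 'n ^ 'n \<Rightarrow> complex) \<Rightarrow> complex ^ 'n ^ 'n \<Rightarrow> complex"
  assumes T: "linear_on_hforms d T" and S: "linear_on_hforms d S"
    and left: "\<And>U p. unitary U \<Longrightarrow> p \<in> hforms d \<Longrightarrow> T (\<lambda>Z. p (U ** Z)) = (\<lambda>Z. T p (U ** Z))"
    and right: "\<And>U p. unitary U \<Longrightarrow> p \<in> hforms d \<Longrightarrow> S (\<lambda>Z. p (Z ** U)) = (\<lambda>Z. S p (Z ** U))"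
    and p: "p \<in> hforms d"
  shows "T (S p) = S (T p)"
proof -
  have "\<exists>t. \<forall>p\<in>hforms d. \<forall>W. T p W = (\<Sum>\<kappa>\<in>grid_index d. t \<kappa> * p (W ** grid \<kappa>))"
    by (rule translation_invariant_operator[OF T]) (simp_all add: hforms_mult_left hforms_mult_right left)
  then obtain t where t: "\<And>p W. p \<in> hforms d \<Longrightarrow> T p W = (\<Sum>\<kappa>\<in>grid_index d. t \<kappa> * p (W ** grid \<kappa>))"
    by blast
  have "\<exists>s. \<forall>p\<in>hforms d. \<forall>W. S p W = (\<Sum>\<kappa>\<in>grid_index d. s \<kappa> * p (grid \<kappa> ** W))"
    by (rule translation_invariant_operator[OF S]) (simp_all add: hforms_mult_left hforms_mult_right right)
  then obtain s where s: "\<And>p W. p \<in> hforms d \<Longrightarrow> S p W = (\<Sum>\<kappa>\<in>grid_index d. s \<kappa> * p (grid \<kappa> ** W))"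
    by blast
  have mem: "T p \<in> hforms d" "S p \<in> hforms d"
    using T S p by (auto simp: linear_on_hforms_def)
  show ?thesis
  proof
    fix W
    have "T (S p) W = (\<Sum>\<kappa>\<in>grid_index d. \<Sum>\<mu>\<in>grid_index d. t \<kappa> * (s \<mu> * p (grid \<mu> ** W ** grid \<kappa>)))"
      by (simp add: t[OF mem(2)] s[OF p] sum_distrib_left matrix_mul_assoc)
    also have "\<dots> = (\<Sum>\<mu>\<in>grid_index d. \<Sum>\<kappa>\<in>grid_index d. t \<kappa> * (s \<mu> * p (grid \<mu> ** W ** grid \<kappa>)))"
      by (rule sum.swap)
    also have "\<dots> = S (T p) W"
      by (simp add: s[OF mem(1)] t[OF p] sum_distrib_left algebra_simps)
    finally show "T (S p) W = S (T p) W" .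
  qed
qed

section \<open>Invariance of the measure\<close>

text \<open>
  By Vitali's covering theorem an open set is, up to a null set, a disjoint union of balls, and the
  preimage of a ball under an isometry is a ball of the same radius. The opposite inequality follows by
  applying this to the inverse isometry.
\<close>

lemma emeasure_open_le_isometry:
  fixes \<phi> \<psi> :: "'a::euclidean_space \<Rightarrow> 'a"
  assumes iso: "\<And>x y. dist (\<phi> x) (\<phi> y) = dist x y" and inv: "\<And>x. \<phi> (\<psi> x) = x" "\<And>x. \<psi> (\<phi> x) = x"
    and "open S"
  shows "emeasure lborel S \<le> emeasure lborel (\<phi> -` S)"
proof -
  have vimage_ball: "\<phi> -` ball a r = ball (\<psi> a) r" for a r
    using iso[of "\<psi> a"] inv by auto
  have cont: "continuous_on UNIV \<phi>"
    unfolding continuous_on_iff using iso by auto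
  define K where "K = {(a, r). 0 < r \<and> ball a r \<subseteq> S}"
  obtain C where C: "countable C" "C \<subseteq> K"
    "pairwise (\<lambda>i j. disjnt (ball (fst i) (snd i)) (ball (fst j) (snd j))) C"
    "negligible (S - (\<Union>i\<in>C. ball (fst i) (snd i)))"
  proof (rule Vitali_covering_theorem_balls[of S K fst snd])
    fix x :: 'a and d :: real
    assume "x \<in> S" "0 < d"
    then obtain e where "e > 0" "ball x e \<subseteq> S"
      using \<open>open S\<close> by (auto simp: open_contains_ball)
    then have "(x, min e (d / 2)) \<in> K"
      using \<open>0 < d\<close> by (auto simp: K_def)
    then show "\<exists>i. i \<in> K \<and> x \<in> ball (fst i) (snd i) \<and> snd i < d"
      using \<open>e > 0\<close> \<open>0 < d\<close> by (intro exI[of _ "(x, min e (d / 2))"]) auto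
  qed
  let ?B = "\<lambda>i. ball (fst i) (snd i)"
  have disj: "disjoint_family_on ?B C"
    using C(3) by (auto simp: pairwise_def disjnt_def disjoint_family_on_def)
  then have disj': "disjoint_family_on (\<lambda>i. \<phi> -` ?B i) C"
    by (simp add: disjoint_family_on_def flip: vimage_Int)
  have sub: "(\<Union>i\<in>C. ?B i) \<subseteq> S"
    using C(2) by (force simp: K_def)
  have "S - (\<Union>i\<in>C. ?B i) \<in> null_sets lborel"
  proof -
    have "S - (\<Union>i\<in>C. ?B i) \<in> sets borel"
      using \<open>open S\<close> by (intro sets.Diff borel_open open_UN) auto
    then show ?thesis
      using C(4) by (simp add: negligible_iff_null_sets null_sets_def)
  qed
  then have "emeasure lborel S \<le> emeasure lborel (\<Union>i\<in>C. ?B i)"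
    using emeasure_Un_null_set[of "\<Union>i\<in>C. ?B i" lborel "S - (\<Union>i\<in>C. ?B i)"] sub
    by (simp add: Un_absorb1 Un_Diff_cancel borel_open open_UN)
  also have "\<dots> = (\<integral>\<^sup>+i. emeasure lborel (?B i) \<partial>count_space C)"
    by (rule emeasure_UN_countable[OF _ C(1) disj]) auto
  also have "\<dots> = (\<integral>\<^sup>+i. emeasure lborel (\<phi> -` ?B i) \<partial>count_space C)"
  proof (rule nn_integral_cong)
    fix i
    assume "i \<in> space (count_space C)"
    then have "0 \<le> snd i" using C(2) by (auto simp: K_def)
    then show "emeasure lborel (?B i) = emeasure lborel (\<phi> -` ?B i)"
      by (simp add: vimage_ball emeasure_ball)
  qed
  also have "\<dots> = emeasure lborel (\<Union>i\<in>C. \<phi> -` ?B i)"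
    by (rule emeasure_UN_countable[OF _ C(1) disj', symmetric]) (auto simp: vimage_ball)
  also have "\<dots> \<le> emeasure lborel (\<phi> -` S)"
    using sub open_vimage[OF \<open>open S\<close> cont] by (intro emeasure_mono) auto
  finally show ?thesis .
qed

lemma distr_lborel_isometry:
  fixes \<phi> \<psi> :: "'a::euclidean_space \<Rightarrow> 'a"
  assumes iso: "\<And>x y. dist (\<phi> x) (\<phi> y) = dist x y" and inv: "\<And>x. \<phi> (\<psi> x) = x" "\<And>x. \<psi> (\<phi> x) = x"
  shows "distr lborel lborel \<phi> = lborel"
proof -
  have iso': "dist (\<psi> x) (\<psi> y) = dist x y" for x y
    using iso[of "\<psi> x" "\<psi> y"] inv by simp
  have cont: "continuous_on UNIV \<phi>"
    unfolding continuous_on_iff using iso by auto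
  have meas: "\<phi> \<in> lborel \<rightarrow>\<^sub>M lborel"
    using cont by (simp add: borel_measurable_continuous_onI)
  have open_eq: "emeasure lborel (\<phi> -` S) = emeasure lborel S" if "open S" for S
  proof (rule antisym)
    have "\<psi> -` (\<phi> -` S) = S" using inv by auto
    then show "emeasure lborel (\<phi> -` S) \<le> emeasure lborel S"
      using emeasure_open_le_isometry[of \<psi> \<phi> "\<phi> -` S"] iso' inv open_vimage[OF that cont] by simp
    show "emeasure lborel S \<le> emeasure lborel (\<phi> -` S)"
      by (rule emeasure_open_le_isometry[OF iso inv that])
  qed
  have "emeasure (distr lborel lborel \<phi>) (box l u) = emeasure lborel (box l u)" for l u
    using emeasure_distr[OF meas, of "box l u"] by (simp add: open_eq[OF open_box])
  then have "lborel = distr lborel lborel \<phi>"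
    by (intro lborel_eqI) simp_all
  then show ?thesis by simp
qed

lemma lebesgue_isometry:
  fixes \<phi> \<psi> :: "'a::euclidean_space \<Rightarrow> 'a"
  assumes "\<And>x y. dist (\<phi> x) (\<phi> y) = dist x y" "\<And>x. \<phi> (\<psi> x) = x" "\<And>x. \<psi> (\<phi> x) = x"
  shows "\<phi> \<in> lebesgue \<rightarrow>\<^sub>M lebesgue" "distr lebesgue lebesgue \<phi> = lebesgue"
proof -
  have "continuous_on UNIV \<phi>"
    unfolding continuous_on_iff using assms by auto
  then have m: "\<phi> \<in> lborel \<rightarrow>\<^sub>M lborel"
    by (simp add: borel_measurable_continuous_onI)
  then have m': "\<phi> \<in> lebesgue \<rightarrow>\<^sub>M lborel"
    by (rule measurable_completion)
  have eq: "distr lebesgue lborel \<phi> = lborel"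
    by (simp add: distr_completion[OF m] distr_lborel_isometry[OF assms])
  show "\<phi> \<in> lebesgue \<rightarrow>\<^sub>M lebesgue"
    by (rule completion.measurable_completion2[OF m']) (simp add: eq)
  show "distr lebesgue lebesgue \<phi> = lebesgue"
    using completion.completion_distr_eq[OF m'] by (simp add: eq)
qed

text \<open>
  The two-sided unitary translations are used through these properties only, so that the left and the
  right action need not be treated separately.
\<close>

definition symmetry :: "real \<Rightarrow> (complex ^ 'n ^ 'n \<Rightarrow> complex ^ 'n ^ 'n) \<Rightarrow> (complex ^ 'n ^ 'n \<Rightarrow> complex ^ 'n ^ 'n) \<Rightarrow> bool" where
  "symmetry lam \<phi> \<psi> \<longleftrightarrow> linear \<phi> \<and> linear \<psi> \<and> (\<forall>Z. \<phi> (\<psi> Z) = Z \<and> \<psi> (\<phi> Z) = Z \<and> norm (\<phi> Z) = norm Z \<and>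
     (\<forall>w. \<phi> (cmul w Z) = cmul w (\<phi> Z)) \<and> (\<phi> Z \<in> cartan_domain \<longleftrightarrow> Z \<in> cartan_domain) \<and>
     weight lam (\<phi> Z) = weight lam Z)"

lemma symmetry_D:
  assumes "symmetry lam \<phi> \<psi>"
  shows "linear \<phi>" "linear \<psi>" "\<phi> (\<psi> Z) = Z" "\<psi> (\<phi> Z) = Z" "norm (\<phi> Z) = norm Z" "\<phi> (cmul w Z) = cmul w (\<phi> Z)"
    "\<phi> Z \<in> cartan_domain \<longleftrightarrow> Z \<in> cartan_domain" "weight lam (\<phi> Z) = weight lam Z" "dist (\<phi> X) (\<phi> Y) = dist X Y"
  using assms unfolding symmetry_def dist_norm by (simp_all flip: linear_diff)

lemma symmetry_inverse: "symmetry lam \<phi> \<psi> \<Longrightarrow> symmetry lam \<psi> \<phi>"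
  unfolding symmetry_def by (metis (no_types, lifting))

lemma linear_mult_left: "linear (\<lambda>Z. U ** (Z :: complex ^ 'n ^ 'n))"
  by (rule linearI) (simp_all add: vec_eq_iff matrix_matrix_mult_def scaleR_sum_right ring_distribs sum.distrib)

lemma linear_mult_right: "linear (\<lambda>Z. (Z :: complex ^ 'n ^ 'n) ** U)"
  by (rule linearI) (simp_all add: vec_eq_iff matrix_matrix_mult_def scaleR_sum_right ring_distribs sum.distrib)

lemma symmetry_left:
  fixes U :: "complex ^ 'n ^ 'n"
  assumes U: "unitary U"
  shows "symmetry lam (\<lambda>Z. U ** Z) (\<lambda>Z. ctranspose U ** Z)"
proof -
  have "weight lam (U ** Z) = weight lam Z" for Z
  proof -
    have "mat 1 - (U ** Z) ** ctranspose (U ** Z) = U ** (mat 1 - Z ** ctranspose Z) ** ctranspose U"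
      using U by (simp add: unitary_def ctranspose_mult matrix_diff_ldistrib matrix_diff_rdistrib matrix_mul_assoc)
    then have "det (mat 1 - (U ** Z) ** ctranspose (U ** Z)) = det (U ** ctranspose U) * det (mat 1 - Z ** ctranspose Z)"
      by (simp add: det_mul)
    then show ?thesis using U by (simp add: unitary_def weight_def)
  qed
  then show ?thesis
    unfolding symmetry_def
    by (simp add: linear_mult_left unitary_left_cancel[OF U] norm_mult_unitary_left[OF U]
        matrix_mult_cmul_right cartan_mult_unitary_left[OF U])
qed

lemma symmetry_right:
  fixes U :: "complex ^ 'n ^ 'n"
  assumes U: "unitary U"
  shows "symmetry lam (\<lambda>Z. Z ** U) (\<lambda>Z. Z ** ctranspose U)"
proof -
  have "weight lam (Z ** U) = weight lam Z" for Z
  proof -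
    have "(Z ** U) ** ctranspose (Z ** U) = Z ** (U ** ctranspose U) ** ctranspose Z"
      by (simp add: ctranspose_mult matrix_mul_assoc)
    then show ?thesis using U by (simp add: unitary_def weight_def)
  qed
  then show ?thesis
    unfolding symmetry_def
    by (simp add: linear_mult_right unitary_right_cancel[OF U] norm_mult_unitary_right[OF U]
        matrix_mult_cmul_left cartan_mult_unitary_right[OF U])
qed

abbreviation domain_lebesgue :: "(complex ^ 'n ^ 'n) measure" where
  "domain_lebesgue \<equiv> lebesgue_on cartan_domain"

lemma cartan_domain_sets: "cartan_domain \<in> sets lebesgue" "cartan_domain \<in> sets borel"
  using borel_open[OF open_cartan_domain] by auto

lemma sets_bergman: "sets (bergman_measure lam) = sets domain_lebesgue"
  by (simp add: bergman_measure_def Let_def)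

lemma space_bergman: "space (bergman_measure lam) = cartan_domain"
  by (simp add: bergman_measure_def Let_def)

lemma measurable_bergman: "borel_measurable (bergman_measure lam) = borel_measurable domain_lebesgue"
  by (rule measurable_cong_sets) (simp_all add: sets_bergman)

lemma borel_measurable_continuous_cartan:
  "continuous_on cartan_domain f \<Longrightarrow> f \<in> borel_measurable (bergman_measure lam)"
  unfolding measurable_bergman
  by (rule continuous_imp_measurable_on_sets_lebesgue[OF _ cartan_domain_sets(1)])

lemma weight_measurable: "weight lam \<in> borel_measurable (domain_lebesgue :: (complex ^ 'n ^ 'n) measure)"
proof -
  have "continuous_on cartan_domain (\<lambda>Z :: complex ^ 'n ^ 'n. Re (det (mat 1 - Z ** ctranspose Z)))"
    unfolding det_def ctranspose_def by (intro continuous_intros)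
  then have [measurable]: "(\<lambda>Z :: complex ^ 'n ^ 'n. Re (det (mat 1 - Z ** ctranspose Z))) \<in> borel_measurable domain_lebesgue"
    by (rule continuous_imp_measurable_on_sets_lebesgue[OF _ cartan_domain_sets(1)])
  show ?thesis
    unfolding weight_def by measurable
qed

lemma symmetry_distr_lebesgue:
  fixes \<phi> \<psi> :: "complex ^ 'n ^ 'n \<Rightarrow> complex ^ 'n ^ 'n"
  assumes s: "symmetry lam \<phi> \<psi>"
  shows "\<phi> \<in> domain_lebesgue \<rightarrow>\<^sub>M domain_lebesgue" "distr domain_lebesgue domain_lebesgue \<phi> = domain_lebesgue"
proof -
  note leb = lebesgue_isometry[of \<phi> \<psi>, OF symmetry_D(9)[OF s] symmetry_D(3)[OF s] symmetry_D(4)[OF s]]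
  show m: "\<phi> \<in> domain_lebesgue \<rightarrow>\<^sub>M domain_lebesgue"
    by (rule measurable_restrict_space3[OF leb(1)]) (simp add: symmetry_D(7)[OF s])
  show "distr domain_lebesgue domain_lebesgue \<phi> = domain_lebesgue"
  proof (rule measure_eqI)
    fix A
    assume "A \<in> sets (distr domain_lebesgue domain_lebesgue \<phi>)"
    then have A: "A \<in> sets domain_lebesgue" by simp
    then have A': "A \<subseteq> cartan_domain" "A \<in> sets lebesgue"
      using cartan_domain_sets(1) by (auto simp: sets_restrict_space)
    then have sub: "\<phi> -` A \<subseteq> cartan_domain"
      using symmetry_D(7)[OF s] by auto
    have "emeasure (distr domain_lebesgue domain_lebesgue \<phi>) A = emeasure domain_lebesgue (\<phi> -` A)"
      using emeasure_distr[OF m A] by (simp add: Int_absorb2[OF sub])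
    also have "\<dots> = emeasure lebesgue (\<phi> -` A)"
      by (rule emeasure_restrict_space[OF _ sub]) (simp add: cartan_domain_sets)
    also have "emeasure lebesgue (\<phi> -` A) = emeasure lebesgue (\<phi> -` A \<inter> space lebesgue)" by simp
    also have "\<dots> = emeasure (distr lebesgue lebesgue \<phi>) A"
      by (rule emeasure_distr[OF leb(1) A'(2), symmetric])
    also have "\<dots> = emeasure domain_lebesgue A"
      unfolding leb(2) by (rule emeasure_restrict_space[OF _ A'(1), symmetric]) (simp add: cartan_domain_sets)
    finally show "emeasure (distr domain_lebesgue domain_lebesgue \<phi>) A = emeasure domain_lebesgue A" .
  qed simp
qed

lemma symmetry_distr_bergman:
  fixes \<phi> \<psi> :: "complex ^ 'n ^ 'n \<Rightarrow> complex ^ 'n ^ 'n"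
  assumes s: "symmetry lam \<phi> \<psi>"
  shows "\<phi> \<in> bergman_measure lam \<rightarrow>\<^sub>M bergman_measure lam"
    "distr (bergman_measure lam) (bergman_measure lam) \<phi> = bergman_measure lam"
proof -
  let ?M = "bergman_measure lam :: (complex ^ 'n ^ 'n) measure"
  note L = symmetry_distr_lebesgue[OF s]
  have [measurable]: "weight lam \<in> borel_measurable (domain_lebesgue :: (complex ^ 'n ^ 'n) measure)"
    by (rule weight_measurable)
  define c where "c = 1 / (\<integral>W. weight lam W \<partial>lebesgue_on (cartan_domain :: (complex ^ 'n ^ 'n) set))"
  have M: "?M = density domain_lebesgue (\<lambda>Z. ennreal (c * weight lam Z))"
    by (simp add: bergman_measure_def c_def Let_def)
  show m: "\<phi> \<in> ?M \<rightarrow>\<^sub>M ?M"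
    using L(1) by (simp add: M)
  show "distr ?M ?M \<phi> = ?M"
  proof (rule measure_eqI)
    fix A
    assume "A \<in> sets (distr ?M ?M \<phi>)"
    then have A [measurable]: "A \<in> sets domain_lebesgue" by (simp add: sets_bergman)
    have P [measurable]: "\<phi> -` A \<inter> space domain_lebesgue \<in> sets domain_lebesgue"
      using measurable_sets[OF L(1) A] .
    have "emeasure (distr ?M ?M \<phi>) A = emeasure ?M (\<phi> -` A \<inter> space domain_lebesgue)"
      using A m by (simp add: emeasure_distr sets_bergman space_bergman)
    also have "\<dots> = (\<integral>\<^sup>+Z. ennreal (c * weight lam Z) * indicator (\<phi> -` A \<inter> space domain_lebesgue) Z \<partial>domain_lebesgue)"
      unfolding M by (rule emeasure_density) measurable
    also have "\<dots> = (\<integral>\<^sup>+Z. ennreal (c * weight lam (\<phi> Z)) * indicator A (\<phi> Z) \<partial>domain_lebesgue)"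
      by (rule nn_integral_cong) (simp add: symmetry_D(8)[OF s] indicator_def)
    also have "\<dots> = (\<integral>\<^sup>+Z. ennreal (c * weight lam Z) * indicator A Z \<partial>distr domain_lebesgue domain_lebesgue \<phi>)"
      by (rule nn_integral_distr[OF L(1), symmetric]) measurable
    also have "\<dots> = emeasure ?M A"
      unfolding L(2) M by (rule emeasure_density[symmetric]) measurable
    finally show "emeasure (distr ?M ?M \<phi>) A = emeasure ?M A" .
  qed simp
qed

lemma integral_symmetry:
  fixes f :: "complex ^ 'n ^ 'n \<Rightarrow> complex"
  assumes s: "symmetry lam \<phi> \<psi>" and f: "f \<in> borel_measurable (bergman_measure lam)"
  shows "(\<integral>Z. f (\<phi> Z) \<partial>bergman_measure lam) = (\<integral>Z. f Z \<partial>bergman_measure lam)"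
  using integral_distr[OF symmetry_distr_bergman(1)[OF s] f] by (simp add: symmetry_distr_bergman(2)[OF s])

section \<open>Total mass\<close>

lemma weight_pos: "Z \<in> cartan_domain \<Longrightarrow> 0 < weight lam Z"
  by (simp add: weight_def weight_base_nonzero)

text \<open>
  If the weight is not integrable, its Bochner integral is \<open>0\<close> by convention, the normalising factor is
  \<open>1 / 0 = 0\<close>, and the measure vanishes. Otherwise the factor normalises the total mass to \<open>1\<close>.
\<close>

lemma bergman_measure_cases:
  obtains (unit) "emeasure (bergman_measure lam :: (complex ^ 'n ^ 'n) measure) cartan_domain = 1"
  | (null) "AE Z in (bergman_measure lam :: (complex ^ 'n ^ 'n) measure). False"
proof -
  define I where "I = (\<integral>W. weight lam W \<partial>lebesgue_on (cartan_domain :: (complex ^ 'n ^ 'n) set))"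
  let ?M = "bergman_measure lam :: (complex ^ 'n ^ 'n) measure"
  have M: "?M = density domain_lebesgue (\<lambda>Z. ennreal (1 / I * weight lam Z))"
    by (simp add: bergman_measure_def I_def Let_def)
  have [measurable]: "weight lam \<in> borel_measurable (domain_lebesgue :: (complex ^ 'n ^ 'n) measure)"
    by (rule weight_measurable)
  show ?thesis
  proof (cases "I = 0")
    case True
    have "AE Z in ?M. False"
      unfolding M by (subst AE_density) (simp_all add: True)
    then show ?thesis by (rule null)
  next
    case False
    then have int: "integrable domain_lebesgue (weight lam :: complex ^ 'n ^ 'n \<Rightarrow> real)"
      unfolding I_def using not_integrable_integral_eq by blast
    have "0 \<le> I"
      unfolding I_def by (rule integral_nonneg_AE) (simp add: weight_def)
    have "emeasure ?M (space ?M) = (\<integral>\<^sup>+Z. ennreal (1 / I * weight lam Z) \<partial>(domain_lebesgue :: (complex ^ 'n ^ 'n) measure))"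
      unfolding M by (subst emeasure_density) (auto intro!: nn_integral_cong)
    also have "\<dots> = ennreal (\<integral>Z. 1 / I * weight lam Z \<partial>(domain_lebesgue :: (complex ^ 'n ^ 'n) measure))"
      using \<open>0 \<le> I\<close> by (intro nn_integral_eq_integral integrable_mult_right int) (simp add: weight_def)
    also have "\<dots> = 1"
      using False by (simp add: I_def)
    finally show ?thesis by (intro unit) (simp add: space_bergman)
  qed
qed

lemma AE_lebesgue_imp_bergman: "AE Z in domain_lebesgue. P Z \<Longrightarrow> AE Z in bergman_measure lam. P Z"
proof -
  assume P: "AE Z in domain_lebesgue. P Z"
  note [measurable] = weight_measurable[of lam]
  have "(\<lambda>Z. ennreal (c * weight lam Z)) \<in> borel_measurable domain_lebesgue" for c
    by measurable
  then show "AE Z in bergman_measure lam. P Z"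
    using P unfolding bergman_measure_def Let_def by (subst AE_density) auto
qed

lemma AE_bergman_imp_lebesgue:
  assumes "emeasure (bergman_measure lam :: (complex ^ 'n ^ 'n) measure) cartan_domain = 1"
    and "AE Z in (bergman_measure lam :: (complex ^ 'n ^ 'n) measure). P Z"
  shows "AE Z in domain_lebesgue. P Z"
proof -
  define I where "I = (\<integral>W. weight lam W \<partial>lebesgue_on (cartan_domain :: (complex ^ 'n ^ 'n) set))"
  let ?M = "bergman_measure lam :: (complex ^ 'n ^ 'n) measure"
  have M: "?M = density domain_lebesgue (\<lambda>Z. ennreal (1 / I * weight lam Z))"
    by (simp add: bergman_measure_def I_def Let_def)
  have [measurable]: "weight lam \<in> borel_measurable (domain_lebesgue :: (complex ^ 'n ^ 'n) measure)"
    by (rule weight_measurable)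
  have "I \<noteq> 0"
  proof
    assume "I = 0"
    then have "AE Z in ?M. False"
      unfolding M by (subst AE_density) simp_all
    then have "emeasure ?M (space ?M) = 0"
      by (simp flip: trivial_limit_def ae_filter_eq_bot_iff)
    then show False
      using assms(1) by (simp add: space_bergman)
  qed
  moreover have "0 \<le> I"
    unfolding I_def by (rule integral_nonneg_AE) (simp add: weight_def)
  ultimately have "I > 0" by simp
  have "AE Z in domain_lebesgue. 0 < ennreal (1 / I * weight lam Z) \<longrightarrow> P Z"
    using assms(2) unfolding M by (subst (asm) AE_density) simp_all
  then show ?thesis
    by (rule AE_mp) (rule AE_I2, use \<open>I > 0\<close> weight_pos[of _ lam] in \<open>auto intro!: divide_pos_pos\<close>)
qed

text \<open>
  The weight is positive, so null sets are Lebesgue null sets, and a nonempty open set is not one.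
\<close>

lemma continuous_AE_zero:
  fixes f :: "complex ^ 'n ^ 'n \<Rightarrow> complex"
  assumes p: "emeasure (bergman_measure lam :: (complex ^ 'n ^ 'n) measure) cartan_domain = 1"
    and f: "continuous_on cartan_domain f" and zero: "AE Z in bergman_measure lam. f Z = 0"
    and Z: "Z \<in> cartan_domain"
  shows "f Z = 0"
proof (rule ccontr)
  assume "f Z \<noteq> 0"
  define V where "V = {Z \<in> cartan_domain. f Z \<noteq> 0}"
  have "V = cartan_domain \<inter> f -` (- {0})" by (auto simp: V_def)
  then have "open V"
    using continuous_open_preimage[OF f open_cartan_domain open_Compl[OF closed_singleton[of 0]]] by simp
  have "AE Z in domain_lebesgue. f Z = 0"
    by (rule AE_bergman_imp_lebesgue[OF p zero])
  then have "AE Z in lebesgue. Z \<in> cartan_domain \<longrightarrow> f Z = 0"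
    by (subst (asm) AE_restrict_space_iff) (simp_all add: cartan_domain_sets)
  then have "AE Z in lebesgue. Z \<notin> V"
    by (rule eventually_mono) (simp add: V_def)
  moreover have "V \<in> sets lebesgue"
    using borel_open[OF \<open>open V\<close>] by simp
  ultimately have "V \<in> null_sets lebesgue"
    by (simp only: AE_iff_null_sets)
  then show False
    using open_not_negligible[OF \<open>open V\<close>] \<open>f Z \<noteq> 0\<close> Z by (auto simp: negligible_iff_null_sets V_def)
qed

section \<open>The Bergman space\<close>

lemma bergman_D:
  assumes "f \<in> bergman_space lam"
  shows "f \<in> borel_measurable (bergman_measure lam)" "integrable (bergman_measure lam) (\<lambda>Z. (norm (f Z))\<^sup>2)"
    "mat_holomorphic_on f cartan_domain" "Z \<notin> cartan_domain \<Longrightarrow> f Z = 0"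
  using assms by (auto simp: bergman_space_def L2_def)

lemma borel_measurable_cnj [measurable (raw)]:
  "f \<in> borel_measurable M \<Longrightarrow> (\<lambda>x. cnj (f x)) \<in> borel_measurable M"
  by (rule borel_measurable_continuous_on[of cnj]) (auto intro: continuous_intros)

lemma bergmanI:
  assumes "f \<in> borel_measurable (bergman_measure lam)" "integrable (bergman_measure lam) (\<lambda>Z. (norm (f Z))\<^sup>2)"
    "mat_holomorphic_on f cartan_domain" "\<And>Z. Z \<notin> cartan_domain \<Longrightarrow> f Z = 0"
  shows "f \<in> bergman_space lam"
  using assms by (auto simp: bergman_space_def L2_def)

lemma cmul_eta: "(\<chi> i j. c * W $ i $ j) = cmul c W"
  by (simp add: cmul_def)

lemma has_derivative_cmul_left: "((\<lambda>w. A + cmul w B) has_derivative (\<lambda>h. cmul h B)) (at w)"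
proof -
  have "bounded_linear (\<lambda>h. cmul h B)"
    by (rule linear_conv_bounded_linear[THEN iffD1], rule linearI)
       (simp_all add: vec_eq_iff algebra_simps)
  then show ?thesis
    by (auto intro!: derivative_eq_intros bounded_linear_imp_has_derivative)
qed

lemma mat_holomorphic_imp_line_hol:
  assumes f: "mat_holomorphic_on f S" and "open S"
  shows "line_hol S f"
  unfolding line_hol_def
proof (intro conjI allI)
  show "continuous_on S f"
    using f unfolding mat_holomorphic_on_def
    by (meson continuous_at_imp_continuous_on has_derivative_continuous)
  fix A B
  show "(\<lambda>w. f (A + cmul w B)) holomorphic_on {w. A + cmul w B \<in> S}"
    unfolding holomorphic_on_def
  proof
    fix w
    assume "w \<in> {w. A + cmul w B \<in> S}"
    then obtain L where L: "(f has_derivative L) (at (A + cmul w B))" "\<And>c W. L (cmul c W) = c * L W"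
      using f by (auto simp: mat_holomorphic_on_def cmul_eta)
    have "((\<lambda>w. f (A + cmul w B)) has_derivative (\<lambda>h. L (cmul h B))) (at w)"
      using has_derivative_compose[OF has_derivative_cmul_left L(1)] .
    then have "((\<lambda>w. f (A + cmul w B)) has_field_derivative L B) (at w)"
      by (simp add: L(2) has_field_derivative_def mult_commute_abs)
    then show "(\<lambda>w. f (A + cmul w B)) field_differentiable at w within {w. A + cmul w B \<in> S}"
      unfolding field_differentiable_def using has_field_derivative_at_within by blast
  qed
qed

lemma bergman_line_hol: "f \<in> bergman_space lam \<Longrightarrow> line_hol cartan_domain f"
  by (intro mat_holomorphic_imp_line_hol open_cartan_domain bergman_D(3))

lemma bergman_continuous: "f \<in> bergman_space lam \<Longrightarrow> continuous_on cartan_domain f"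
  using bergman_line_hol line_hol_def by blast

lemma bergman_eqI:
  assumes "f \<in> bergman_space lam" "g \<in> bergman_space lam" "\<And>Z. Z \<in> cartan_domain \<Longrightarrow> f Z = g Z"
  shows "f = g"
  using assms bergman_D(4)[OF assms(1)] bergman_D(4)[OF assms(2)] by (metis ext)

lemma mat_holomorphic_const: "mat_holomorphic_on (\<lambda>Z. c) S"
  unfolding mat_holomorphic_on_def by (auto intro!: exI[of _ "\<lambda>_. 0"])

lemma mat_holomorphic_add:
  assumes "mat_holomorphic_on f S" "mat_holomorphic_on g S"
  shows "mat_holomorphic_on (\<lambda>Z. f Z + g Z) S"
  unfolding mat_holomorphic_on_def cmul_eta
proof
  fix Z
  assume "Z \<in> S"
  then obtain L M where L: "(f has_derivative L) (at Z)" "\<And>c W. L (cmul c W) = c * L W"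
    and M: "(g has_derivative M) (at Z)" "\<And>c W. M (cmul c W) = c * M W"
    using assms unfolding mat_holomorphic_on_def cmul_eta by meson
  show "\<exists>L. ((\<lambda>Z. f Z + g Z) has_derivative L) (at Z) \<and> (\<forall>c W. L (cmul c W) = c * L W)"
    using has_derivative_add[OF L(1) M(1)] by (intro exI[of _ "\<lambda>h. L h + M h"]) (simp add: L M algebra_simps)
qed

lemma mat_holomorphic_mult:
  assumes "mat_holomorphic_on f S" "mat_holomorphic_on g S"
  shows "mat_holomorphic_on (\<lambda>Z. f Z * g Z) S"
  unfolding mat_holomorphic_on_def cmul_eta
proof
  fix Z
  assume "Z \<in> S"
  then obtain L M where L: "(f has_derivative L) (at Z)" "\<And>c W. L (cmul c W) = c * L W"
    and M: "(g has_derivative M) (at Z)" "\<And>c W. M (cmul c W) = c * M W"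
    using assms unfolding mat_holomorphic_on_def cmul_eta by meson
  show "\<exists>L. ((\<lambda>Z. f Z * g Z) has_derivative L) (at Z) \<and> (\<forall>c W. L (cmul c W) = c * L W)"
    using has_derivative_mult[OF L(1) M(1)]
    by (intro exI[of _ "\<lambda>h. f Z * M h + L h * g Z"]) (simp add: L M algebra_simps)
qed

lemma mat_holomorphic_sum:
  "(\<And>k. k \<in> K \<Longrightarrow> mat_holomorphic_on (f k) S) \<Longrightarrow> mat_holomorphic_on (\<lambda>Z. \<Sum>k\<in>K. f k Z) S"
  by (induction K rule: infinite_finite_induct) (auto intro: mat_holomorphic_add mat_holomorphic_const)

lemma mat_holomorphic_prod:
  "(\<And>k. k \<in> K \<Longrightarrow> mat_holomorphic_on (f k) S) \<Longrightarrow> mat_holomorphic_on (\<lambda>Z. \<Prod>k\<in>K. f k Z) S"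
  by (induction K rule: infinite_finite_induct) (auto intro: mat_holomorphic_mult mat_holomorphic_const)

lemma mat_holomorphic_entry: "mat_holomorphic_on (\<lambda>Z :: complex ^ 'n ^ 'n. Z $ i $ j) S"
proof -
  have "bounded_linear (\<lambda>Z :: complex ^ 'n ^ 'n. Z $ i $ j)"
    by (rule bounded_linear_compose[OF bounded_linear_vec_nth bounded_linear_vec_nth])
  then have "((\<lambda>Z :: complex ^ 'n ^ 'n. Z $ i $ j) has_derivative (\<lambda>Z. Z $ i $ j)) (at Z)" for Z
    by (rule bounded_linear_imp_has_derivative)
  then show ?thesis
    unfolding mat_holomorphic_on_def cmul_eta by (intro ballI exI conjI) auto
qed

text \<open>
  The interpolation formula exhibits a form as a polynomial in the matrix entries.
\<close>

lemma mat_holomorphic_hform: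
  assumes p: "p \<in> hforms d"
  shows "mat_holomorphic_on p S"
proof -
  have eq: "p = (\<lambda>Z. \<Sum>\<kappa>\<in>grid_index d. p (grid \<kappa>) * grid_basis d \<kappa> Z)"
    by (rule ext) (rule hform_grid_interpolation[OF p])
  have "mat_holomorphic_on (\<lambda>Z. (Z $ i $ j + (- a)) * inverse b) S" for i j a b
    by (intro mat_holomorphic_mult mat_holomorphic_add mat_holomorphic_const mat_holomorphic_entry)
  then have "mat_holomorphic_on (\<lambda>Z. \<Sum>\<kappa>\<in>grid_index d. p (grid \<kappa>) * grid_basis d \<kappa> Z) S"
    unfolding grid_basis_def lagrange_basis_def
    by (intro mat_holomorphic_sum mat_holomorphic_mult mat_holomorphic_const mat_holomorphic_prod)
       (simp add: divide_inverse)
  then show ?thesis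
    by (subst eq)
qed

lemma norm_add_power2_le:
  fixes x y :: "'a :: real_normed_vector"
  shows "(norm (x + y))\<^sup>2 \<le> 2 * (norm x)\<^sup>2 + 2 * (norm y)\<^sup>2"
proof -
  have "(norm (x + y))\<^sup>2 \<le> (norm x + norm y)\<^sup>2"
    by (intro power_mono norm_triangle_ineq) auto
  also have "\<dots> \<le> 2 * (norm x)\<^sup>2 + 2 * (norm y)\<^sup>2"
    using sum_squares_bound[of "norm x" "norm y"] by (simp add: power2_sum)
  finally show ?thesis .
qed

lemma bergman_add:
  assumes f: "f \<in> bergman_space lam" and g: "g \<in> bergman_space lam"
  shows "(\<lambda>Z. f Z + g Z) \<in> bergman_space lam"
proof (rule bergmanI)
  note [measurable] = bergman_D(1)[OF f] bergman_D(1)[OF g]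
  show "(\<lambda>Z. f Z + g Z) \<in> borel_measurable (bergman_measure lam)" by measurable
  have "integrable (bergman_measure lam) (\<lambda>Z. 2 * (norm (f Z))\<^sup>2 + 2 * (norm (g Z))\<^sup>2)"
    by (intro Bochner_Integration.integrable_add integrable_mult_right bergman_D(2) f g)
  then show "integrable (bergman_measure lam) (\<lambda>Z. (norm (f Z + g Z))\<^sup>2)"
  proof (rule Bochner_Integration.integrable_bound)
    show "AE Z in bergman_measure lam. norm ((norm (f Z + g Z))\<^sup>2) \<le> norm (2 * (norm (f Z))\<^sup>2 + 2 * (norm (g Z))\<^sup>2)"
      by (rule AE_I2) (simp add: norm_add_power2_le)
  qed measurable
qed (use bergman_D(3)[OF f] bergman_D(3)[OF g] bergman_D(4)[OF f] bergman_D(4)[OF g] in \<open>auto intro: mat_holomorphic_add\<close>)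

lemma bergman_scale:
  assumes f: "f \<in> bergman_space lam"
  shows "(\<lambda>Z. c * f Z) \<in> bergman_space lam"
proof (rule bergmanI)
  note [measurable] = bergman_D(1)[OF f]
  show "(\<lambda>Z. c * f Z) \<in> borel_measurable (bergman_measure lam)" by measurable
  show "integrable (bergman_measure lam) (\<lambda>Z. (norm (c * f Z))\<^sup>2)"
    unfolding norm_mult power_mult_distrib by (intro integrable_mult_right bergman_D(2) f)
qed (use bergman_D(3)[OF f] bergman_D(4)[OF f] in \<open>auto intro: mat_holomorphic_mult mat_holomorphic_const\<close>)

lemma bergman_zero: "(\<lambda>Z. 0) \<in> bergman_space lam"
  by (rule bergmanI) (auto intro: mat_holomorphic_const)

lemma bergman_diff:
  assumes "f \<in> bergman_space lam" "g \<in> bergman_space lam"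
  shows "(\<lambda>Z. f Z - g Z) \<in> bergman_space lam"
  using bergman_add[OF assms(1) bergman_scale[OF assms(2), of "-1"]] by simp

lemma bergman_sum:
  "(\<And>k. k \<in> K \<Longrightarrow> f k \<in> bergman_space lam) \<Longrightarrow> (\<lambda>Z. \<Sum>k\<in>K. c k * f k Z) \<in> bergman_space lam"
proof (induction K rule: infinite_finite_induct)
  case (insert k K)
  then show ?case
    using bergman_add[OF bergman_scale[of "f k" lam "c k"], of "\<lambda>Z. \<Sum>k\<in>K. c k * f k Z"] by simp
qed (simp_all add: bergman_zero)

lemma bergman_symmetry:
  fixes f :: "complex ^ 'n ^ 'n \<Rightarrow> complex"
  assumes s: "symmetry lam \<phi> \<psi>" and f: "f \<in> bergman_space lam"
  shows "(\<lambda>Z. f (\<phi> Z)) \<in> bergman_space lam"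
proof (rule bergmanI)
  note m = symmetry_distr_bergman[OF s]
  show "(\<lambda>Z. f (\<phi> Z)) \<in> borel_measurable (bergman_measure lam)"
    using measurable_compose[OF m(1) bergman_D(1)[OF f]] .
  have "integrable (distr (bergman_measure lam) (bergman_measure lam) \<phi>) (\<lambda>Z. (norm (f Z))\<^sup>2)"
    unfolding m(2) by (rule bergman_D(2)[OF f])
  then show "integrable (bergman_measure lam) (\<lambda>Z. (norm (f (\<phi> Z)))\<^sup>2)"
    by (rule integrable_distr[OF m(1)])
  show "mat_holomorphic_on (\<lambda>Z. f (\<phi> Z)) cartan_domain"
    unfolding mat_holomorphic_on_def cmul_eta
  proof
    fix Z :: "complex ^ 'n ^ 'n"
    assume "Z \<in> cartan_domain"
    then have "\<phi> Z \<in> cartan_domain" by (simp add: symmetry_D(7)[OF s])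
    then obtain L where L: "(f has_derivative L) (at (\<phi> Z))" "\<And>c W. L (cmul c W) = c * L W"
      using bergman_D(3)[OF f] unfolding mat_holomorphic_on_def cmul_eta by meson
    have "(\<phi> has_derivative \<phi>) (at Z)"
      using symmetry_D(1)[OF s] by (intro bounded_linear_imp_has_derivative) (simp add: linear_conv_bounded_linear)
    then have "((\<lambda>Z. f (\<phi> Z)) has_derivative (\<lambda>h. L (\<phi> h))) (at Z)"
      using L(1) by (rule has_derivative_compose)
    then show "\<exists>L. ((\<lambda>Z. f (\<phi> Z)) has_derivative L) (at Z) \<and> (\<forall>c W. L (cmul c W) = c * L W)"
      by (intro exI[of _ "\<lambda>h. L (\<phi> h)"]) (simp add: symmetry_D(6)[OF s] L(2))
  qed
qed (simp add: symmetry_D(7)[OF s] bergman_D(4)[OF f])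

text \<open>
  Elements of the Bergman space vanish off the domain, whereas forms live on all matrices.
\<close>

definition cutoff :: "(complex ^ 'n ^ 'n \<Rightarrow> complex) \<Rightarrow> complex ^ 'n ^ 'n \<Rightarrow> complex" where
  "cutoff p Z = (if Z \<in> cartan_domain then p Z else 0)"

text \<open>
  A form is bounded on the bounded domain, and the measure is finite.
\<close>

lemma cutoff_hform_bergman:
  fixes p :: "complex ^ 'n ^ 'n \<Rightarrow> complex"
  assumes unit: "emeasure (bergman_measure lam :: (complex ^ 'n ^ 'n) measure) cartan_domain = 1"
    and p: "p \<in> hforms d"
  shows "cutoff p \<in> bergman_space lam"
proof (rule bergmanI)
  interpret finite_measure "bergman_measure lam :: (complex ^ 'n ^ 'n) measure"
    by (rule finite_measureI) (simp add: unit space_bergman)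
  have c: "continuous_on cartan_domain (cutoff p)"
    using hforms_D(3)[OF p, of cartan_domain] by (rule continuous_on_eq) (simp add: cutoff_def)
  then show m [measurable]: "cutoff p \<in> borel_measurable (bergman_measure lam)"
    by (rule borel_measurable_continuous_cartan)
  have "compact (closure (cartan_domain :: (complex ^ 'n ^ 'n) set))"
    using bounded_cartan_domain by (simp add: compact_closure)
  then have "bounded (p ` closure cartan_domain)"
    by (intro compact_imp_bounded compact_continuous_image hforms_D(3)[OF p])
  then obtain C where "\<And>Z. Z \<in> closure cartan_domain \<Longrightarrow> norm (p Z) \<le> C"
    by (auto simp: bounded_iff)
  then have C: "norm (cutoff p Z) \<le> \<bar>C\<bar>" for Z
    using closure_subset[of cartan_domain] by (force simp: cutoff_def)
  show "integrable (bergman_measure lam) (\<lambda>Z. (norm (cutoff p Z))\<^sup>2)"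
  proof (rule integrable_const_bound[where B = "\<bar>C\<bar>\<^sup>2"])
    show "AE Z in bergman_measure lam. norm ((norm (cutoff p Z))\<^sup>2) \<le> \<bar>C\<bar>\<^sup>2"
      unfolding real_norm_def power_abs abs_norm_cancel by (intro AE_I2 power_mono[OF C norm_ge_zero])
  qed measurable
  show "mat_holomorphic_on (cutoff p) cartan_domain"
    unfolding mat_holomorphic_on_def cmul_eta
  proof
    fix Z :: "complex ^ 'n ^ 'n"
    assume Z: "Z \<in> cartan_domain"
    then obtain L where L: "(p has_derivative L) (at Z)" "\<forall>c W. L (cmul c W) = c * L W"
      using mat_holomorphic_hform[OF p, of cartan_domain] unfolding mat_holomorphic_on_def cmul_eta by meson
    have "(cutoff p has_derivative L) (at Z)"
      by (rule has_derivative_transform_within_open[OF L(1) open_cartan_domain Z]) (simp add: cutoff_def)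
    then show "\<exists>L. (cutoff p has_derivative L) (at Z) \<and> (\<forall>c W. L (cmul c W) = c * L W)"
      using L(2) by blast
  qed
qed (simp add: cutoff_def)

text \<open>
  The second bound depends on \<open>f\<close> only through its norm, hence is uniform over the rotations of \<open>f\<close>;
  this is what Fubini's theorem needs below.
\<close>

lemma symbol_integrable:
  fixes f h :: "complex ^ 'n ^ 'n \<Rightarrow> complex"
  assumes a: "a \<in> borel_measurable (bergman_measure lam)" "AE Z in bergman_measure lam. norm (a Z) \<le> C"
    and f: "f \<in> bergman_space lam" and h: "h \<in> bergman_space lam"
  shows "integrable (bergman_measure lam) (\<lambda>Z. a Z * f Z * cnj (h Z))"
    "(\<integral>Z. norm (a Z * f Z * cnj (h Z)) \<partial>bergman_measure lam)
      \<le> \<bar>C\<bar> * ((\<integral>Z. (norm (f Z))\<^sup>2 \<partial>bergman_measure lam) + (\<integral>Z. (norm (h Z))\<^sup>2 \<partial>bergman_measure lam))"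
proof -
  let ?M = "bergman_measure lam :: (complex ^ 'n ^ 'n) measure"
  note [measurable] = a(1) bergman_D(1)[OF f] bergman_D(1)[OF h]
  let ?g = "\<lambda>Z. \<bar>C\<bar> * ((norm (f Z))\<^sup>2 + (norm (h Z))\<^sup>2)"
  have g: "integrable ?M ?g"
    by (intro Bochner_Integration.integrable_add integrable_mult_right bergman_D(2) f h)
  have bound: "AE Z in ?M. norm (a Z * f Z * cnj (h Z)) \<le> ?g Z"
    using a(2)
  proof (rule eventually_mono)
    fix Z
    assume "norm (a Z) \<le> C"
    moreover have "norm (f Z) * norm (h Z) \<le> (norm (f Z))\<^sup>2 + (norm (h Z))\<^sup>2"
    proof -
      have "0 \<le> norm (f Z) * norm (h Z)" by simp
      then show ?thesis
        using sum_squares_bound[of "norm (f Z)" "norm (h Z)"] by linarith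
    qed
    ultimately have "norm (a Z) * (norm (f Z) * norm (h Z)) \<le> \<bar>C\<bar> * ((norm (f Z))\<^sup>2 + (norm (h Z))\<^sup>2)"
      by (intro mult_mono) auto
    then show "norm (a Z * f Z * cnj (h Z)) \<le> ?g Z"
      by (simp add: norm_mult mult.assoc)
  qed
  show i: "integrable ?M (\<lambda>Z. a Z * f Z * cnj (h Z))"
  proof (rule Bochner_Integration.integrable_bound[OF g])
    show "AE Z in ?M. norm (a Z * f Z * cnj (h Z)) \<le> norm (?g Z)"
      using bound by (rule eventually_mono) simp
  qed measurable
  have "(\<integral>Z. norm (a Z * f Z * cnj (h Z)) \<partial>?M) \<le> (\<integral>Z. ?g Z \<partial>?M)"
    by (rule integral_mono_AE[OF integrable_norm[OF i] g bound])
  also have "\<dots> = \<bar>C\<bar> * ((\<integral>Z. (norm (f Z))\<^sup>2 \<partial>?M) + (\<integral>Z. (norm (h Z))\<^sup>2 \<partial>?M))"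
    using bergman_D(2)[OF f] bergman_D(2)[OF h] by simp
  finally show "(\<integral>Z. norm (a Z * f Z * cnj (h Z)) \<partial>?M)
      \<le> \<bar>C\<bar> * ((\<integral>Z. (norm (f Z))\<^sup>2 \<partial>?M) + (\<integral>Z. (norm (h Z))\<^sup>2 \<partial>?M))" .
qed

lemma inner_integrable:
  assumes f: "f \<in> bergman_space lam" and h: "h \<in> bergman_space lam"
  shows "integrable (bergman_measure lam) (\<lambda>Z. f Z * cnj (h Z))"
  using symbol_integrable(1)[of "\<lambda>_. 1" lam 1 f h] assms by simp

lemma bergman_norm_zero:
  fixes f :: "complex ^ 'n ^ 'n \<Rightarrow> complex"
  assumes unit: "emeasure (bergman_measure lam :: (complex ^ 'n ^ 'n) measure) cartan_domain = 1"
    and f: "f \<in> bergman_space lam" and zero: "(\<integral>Z. (norm (f Z))\<^sup>2 \<partial>bergman_measure lam) = 0"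
  shows "f = (\<lambda>Z. 0)"
proof (rule bergman_eqI[OF f bergman_zero])
  have "AE Z in bergman_measure lam. (norm (f Z))\<^sup>2 = 0"
    using zero integral_nonneg_eq_0_iff_AE[OF bergman_D(2)[OF f]] by simp
  then have "AE Z in bergman_measure lam. f Z = 0" by simp
  then show "f Z = 0" if "Z \<in> cartan_domain" for Z
    using continuous_AE_zero[OF unit bergman_continuous[OF f]] that by blast
qed

text \<open>
  Test with \<open>h = f - g\<close>, whose norm then vanishes; continuity turns this into equality everywhere.
\<close>

lemma bergman_weak_eq:
  fixes f g :: "complex ^ 'n ^ 'n \<Rightarrow> complex"
  assumes unit: "emeasure (bergman_measure lam :: (complex ^ 'n ^ 'n) measure) cartan_domain = 1"
    and f: "f \<in> bergman_space lam" and g: "g \<in> bergman_space lam"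
    and eq: "\<And>h. h \<in> bergman_space lam \<Longrightarrow> L2_inner lam f h = L2_inner lam g h"
  shows "f = g"
proof -
  let ?d = "\<lambda>Z. f Z - g Z"
  have d: "?d \<in> bergman_space lam" by (rule bergman_diff[OF f g])
  have "complex_of_real (\<integral>Z. (norm (?d Z))\<^sup>2 \<partial>bergman_measure lam) = (\<integral>Z. ?d Z * cnj (?d Z) \<partial>bergman_measure lam)"
    by (simp only: integral_complex_of_real[symmetric] complex_norm_square)
  also have "\<dots> = L2_inner lam f ?d - L2_inner lam g ?d"
    unfolding L2_inner_def left_diff_distrib
    by (rule Bochner_Integration.integral_diff[OF inner_integrable[OF f d] inner_integrable[OF g d]])
  also have "\<dots> = 0" using eq[OF d] by simp
  finally have "?d = (\<lambda>Z. 0)"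
    by (intro bergman_norm_zero[OF unit d]) simp
  then show ?thesis by (simp add: fun_eq_iff)
qed

section \<open>Operators with an invariant symbol\<close>

lemma bounded_ops_D:
  assumes "T \<in> bounded_ops lam"
  shows "f \<in> bergman_space lam \<Longrightarrow> T f \<in> bergman_space lam"
    "f \<in> bergman_space lam \<Longrightarrow> g \<in> bergman_space lam \<Longrightarrow> T (\<lambda>Z. f Z + g Z) = (\<lambda>Z. T f Z + T g Z)"
    "f \<in> bergman_space lam \<Longrightarrow> T (\<lambda>Z. c * f Z) = (\<lambda>Z. c * T f Z)"
    "f \<notin> bergman_space lam \<Longrightarrow> T f = undefined"
    "\<exists>C. \<forall>f\<in>bergman_space lam. L2_norm lam (T f) \<le> C * L2_norm lam f"
  using assms unfolding bounded_ops_def by auto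

text \<open>
  The weak description of a Toeplitz operator, free of the choice made in the definition of the
  projection.
\<close>

definition has_symbol :: "real \<Rightarrow> ('n::finite) operator \<Rightarrow> (complex ^ 'n ^ 'n \<Rightarrow> complex) \<Rightarrow> bool" where
  "has_symbol lam T a \<longleftrightarrow> T \<in> bounded_ops lam \<and> a \<in> borel_measurable (bergman_measure lam) \<and>
     (\<exists>C. AE Z in bergman_measure lam. norm (a Z) \<le> C) \<and>
     (\<forall>f\<in>bergman_space lam. \<forall>h\<in>bergman_space lam. L2_inner lam (T f) h = L2_inner lam (\<lambda>Z. a Z * f Z) h)"

text \<open>
  Change of variables in \<open>\<langle>a (f \<circ> \<phi>), h\<rangle>\<close>: both the measure and the symbol are invariant.
\<close>

lemma has_symbol_symmetry:
  fixes T :: "('n::finite) operator"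
  assumes unit: "emeasure (bergman_measure lam :: (complex ^ 'n ^ 'n) measure) cartan_domain = 1"
    and T: "has_symbol lam T a" and s: "symmetry lam \<phi> \<psi>"
    and inv: "AE Z in bergman_measure lam. a (\<phi> Z) = a Z" and f: "f \<in> bergman_space lam"
  shows "T (\<lambda>Z. f (\<phi> Z)) = (\<lambda>Z. T f (\<phi> Z))"
proof (rule bergman_weak_eq[OF unit])
  have Tb: "T \<in> bounded_ops lam" using T by (simp add: has_symbol_def)
  note f\<phi> = bergman_symmetry[OF s f] and Tf = bounded_ops_D(1)[OF Tb f]
  show "T (\<lambda>Z. f (\<phi> Z)) \<in> bergman_space lam" by (rule bounded_ops_D(1)[OF Tb f\<phi>])
  show "(\<lambda>Z. T f (\<phi> Z)) \<in> bergman_space lam" by (rule bergman_symmetry[OF s Tf])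
  fix h :: "complex ^ 'n ^ 'n \<Rightarrow> complex"
  assume h: "h \<in> bergman_space lam"
  define k where "k = (\<lambda>Z. h (\<psi> Z))"
  have k: "k \<in> bergman_space lam"
    unfolding k_def by (rule bergman_symmetry[OF symmetry_inverse[OF s] h])
  have k\<phi>: "k (\<phi> Z) = h Z" for Z
    by (simp add: k_def symmetry_D(4)[OF s])
  have [measurable]: "a \<in> borel_measurable (bergman_measure lam)" using T by (simp add: has_symbol_def)
  note [measurable] = bergman_D(1)[OF f] bergman_D(1)[OF h] bergman_D(1)[OF f\<phi>] bergman_D(1)[OF k] bergman_D(1)[OF Tf]
  let ?G = "\<lambda>Z. a Z * f Z * cnj (k Z)"
  have G: "?G \<in> borel_measurable (bergman_measure lam)" by measurable
  have "L2_inner lam (T (\<lambda>Z. f (\<phi> Z))) h = (\<integral>Z. a Z * f (\<phi> Z) * cnj (h Z) \<partial>bergman_measure lam)"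
    using T f\<phi> h by (simp add: has_symbol_def L2_inner_def)
  also have "\<dots> = (\<integral>Z. ?G (\<phi> Z) \<partial>bergman_measure lam)"
  proof (rule integral_cong_AE)
    show "(\<lambda>Z. ?G (\<phi> Z)) \<in> borel_measurable (bergman_measure lam)"
      using measurable_compose[OF symmetry_distr_bergman(1)[OF s] G] .
    show "AE Z in bergman_measure lam. a Z * f (\<phi> Z) * cnj (h Z) = ?G (\<phi> Z)"
      using inv by (rule eventually_mono) (simp add: k\<phi>)
  qed measurable
  also have "\<dots> = (\<integral>Z. ?G Z \<partial>bergman_measure lam)"
    by (rule integral_symmetry[OF s G])
  also have "\<dots> = L2_inner lam (T f) k"
    using T f k by (simp add: has_symbol_def L2_inner_def)
  also have "\<dots> = (\<integral>Z. T f (\<phi> Z) * cnj (k (\<phi> Z)) \<partial>bergman_measure lam)"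
    unfolding L2_inner_def by (rule integral_symmetry[OF s, symmetric]) measurable
  also have "\<dots> = L2_inner lam (\<lambda>Z. T f (\<phi> Z)) h"
    by (simp add: L2_inner_def k\<phi>)
  finally show "L2_inner lam (T (\<lambda>Z. f (\<phi> Z))) h = L2_inner lam (\<lambda>Z. T f (\<phi> Z)) h" .
qed

section \<open>Homogeneous parts commute with the operators\<close>

lemma line_hol_cong:
  assumes "line_hol S f" "\<And>Z. Z \<in> S \<Longrightarrow> f Z = g Z"
  shows "line_hol S g"
  unfolding line_hol_def
proof (intro conjI allI)
  show "continuous_on S g"
    using assms continuous_on_eq unfolding line_hol_def by blast
  show "(\<lambda>w. g (A + cmul w B)) holomorphic_on {w. A + cmul w B \<in> S}" for A B
  proof (rule holomorphic_transform)
    show "(\<lambda>w. f (A + cmul w B)) holomorphic_on {w. A + cmul w B \<in> S}"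
      using assms(1) unfolding line_hol_def by blast
  qed (simp add: assms(2))
qed

lemma hom_part_cutoff:
  assumes f: "line_hol cartan_domain f" and Z: "Z \<in> cartan_domain"
  shows "hom_part d (cutoff f) Z = hom_part d f Z"
proof -
  have c: "line_hol cartan_domain (cutoff f)"
    by (rule line_hol_cong[OF f]) (simp add: cutoff_def)
  show ?thesis
    unfolding hom_part_integral[OF f Z] hom_part_integral[OF c Z]
    using cmul_in_cartan_domain[OF Z] by (simp add: cutoff_def)
qed

lemma symmetry_cmul:
  assumes "norm w = 1"
  shows "symmetry lam (cmul w :: complex ^ 'n ^ 'n \<Rightarrow> _) (cmul (cnj w))"
proof -
  have ct: "ctranspose (cmul w (mat 1)) = (cmul (cnj w) (mat 1) :: complex ^ 'n ^ 'n)"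
    by (simp add: vec_eq_iff mat_def)
  from symmetry_left[OF unitary_scalar[OF assms, where 'n = 'n], of lam] show ?thesis
    unfolding ct by (simp add: matrix_mult_cmul_left)
qed

definition circle_measure :: "real measure" where
  "circle_measure = restrict_space lborel {0..1}"

lemma finite_circle_measure: "finite_measure circle_measure"
  unfolding circle_measure_def by (rule finite_measureI) (simp add: emeasure_restrict_space space_restrict_space)

lemma hom_part_circle_integral:
  assumes f: "line_hol cartan_domain f" and Z: "Z \<in> cartan_domain"
  shows "hom_part d f Z = (\<integral>t. f (cmul (circ t) Z) / circ t ^ d \<partial>circle_measure)"
proof -
  let ?g = "\<lambda>t. f (cmul (circ t) Z) / circ t ^ d"
  have "continuous_on cartan_domain f"
    using f by (simp add: line_hol_def)
  then have "continuous_on {0..1} (\<lambda>t. f (cmul (circ t) Z))"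
    by (rule continuous_on_compose2) (use cmul_in_cartan_domain[OF Z] in \<open>auto intro!: continuous_intros\<close>)
  then have "continuous_on {0..1} ?g"
    by (intro continuous_on_divide continuous_on_power continuous_on_circ continuous_on_id) auto
  then have "set_integrable lborel {0..1} ?g"
    by (rule borel_integrable_atLeastAtMost')
  then have "(LINT t:{0..1}|lborel. ?g t) = hom_part d f Z"
    unfolding hom_part_integral[OF f Z] by (rule set_borel_integral_eq_integral(2))
  then show ?thesis
    unfolding circle_measure_def set_lebesgue_integral_def by (subst integral_restrict_space) simp_all
qed

lemma rotated_joint_measurable:
  fixes f :: "complex ^ 'n ^ 'n \<Rightarrow> complex"
  assumes f: "f \<in> bergman_space lam"
  shows "(\<lambda>(t, Z). f (cmul (circ t) Z) / circ t ^ d) \<in> borel_measurable (circle_measure \<Otimes>\<^sub>M bergman_measure lam)"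
proof -
  let ?P = "circle_measure \<Otimes>\<^sub>M (bergman_measure lam :: (complex ^ 'n ^ 'n) measure)"
  have "(\<lambda>Z. indicator cartan_domain Z *\<^sub>R f Z) \<in> borel_measurable borel"
    by (rule borel_measurable_continuous_on_indicator[OF cartan_domain_sets(2) bergman_continuous[OF f]])
  moreover have "(\<lambda>Z. indicator cartan_domain Z *\<^sub>R f Z) = f"
    using bergman_D(4)[OF f] by (auto simp: indicator_def fun_eq_iff)
  ultimately have [measurable]: "f \<in> borel_measurable borel" by simp
  have "(\<lambda>t. t) \<in> borel_measurable circle_measure"
    unfolding circle_measure_def by (intro measurable_restrict_space1) simp
  then have t [measurable]: "fst \<in> borel_measurable ?P"
    by (rule measurable_compose[OF measurable_fst])
  have "(\<lambda>Z :: complex ^ 'n ^ 'n. Z) \<in> borel_measurable (bergman_measure lam)"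
    by (rule borel_measurable_continuous_cartan) (rule continuous_on_id)
  then have Z [measurable]: "snd \<in> borel_measurable ?P"
    by (rule measurable_compose[OF measurable_snd])
  have [measurable]: "(\<lambda>x. cmul (circ (fst x)) (snd x)) \<in> borel_measurable ?P"
    by (rule borel_measurable_continuous_Pair[OF t Z]) (intro continuous_intros)
  have [measurable]: "(\<lambda>x. circ (fst x)) \<in> borel_measurable ?P"
    by (rule borel_measurable_continuous_on[OF _ t]) (intro continuous_intros)
  show ?thesis
    unfolding case_prod_beta' by measurable
qed

text \<open>
  Fubini's theorem for the circle average that produces the homogeneous part. The integrals over the
  domain are bounded uniformly in \<open>t\<close> because rotations preserve the norm.
\<close>

lemma inner_hom_part:
  fixes a f h :: "complex ^ 'n ^ 'n \<Rightarrow> complex"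
  assumes unit: "emeasure (bergman_measure lam :: (complex ^ 'n ^ 'n) measure) cartan_domain = 1"
    and a: "a \<in> borel_measurable (bergman_measure lam)" "AE Z in bergman_measure lam. norm (a Z) \<le> C"
    and f: "f \<in> bergman_space lam" and h: "h \<in> bergman_space lam"
  shows "L2_inner lam (\<lambda>Z. a Z * cutoff (hom_part d f) Z) h
    = (\<integral>t. L2_inner lam (\<lambda>Z. a Z * f (cmul (circ t) Z)) h / circ t ^ d \<partial>circle_measure)"
proof -
  let ?M = "bergman_measure lam :: (complex ^ 'n ^ 'n) measure" and ?N = circle_measure
  interpret M: finite_measure ?M
    by (rule finite_measureI) (simp add: unit space_bergman)
  interpret N: finite_measure ?N by (rule finite_circle_measure)
  interpret P: pair_sigma_finite ?N ?M ..
  define G where "G t Z = a Z * (f (cmul (circ t) Z) / circ t ^ d) * cnj (h Z)" for t Z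
  note [measurable] = a(1) bergman_D(1)[OF h] rotated_joint_measurable[OF f, of d]
  have G_meas: "case_prod G \<in> borel_measurable (?N \<Otimes>\<^sub>M ?M)"
  proof -
    have "(\<lambda>x. a (snd x) * (\<lambda>(t, Z). f (cmul (circ t) Z) / circ t ^ d) x * cnj (h (snd x))) \<in> borel_measurable (?N \<Otimes>\<^sub>M ?M)"
      by measurable
    then show ?thesis by (simp add: G_def case_prod_beta')
  qed
  have rot: "(\<lambda>Z. f (cmul (circ t) Z) / circ t ^ d) \<in> bergman_space lam" for t
    using bergman_scale[OF bergman_symmetry[OF symmetry_cmul[OF norm_circ] f], of "1 / circ t ^ d" t] by simp
  have norm_rot: "(\<integral>Z. (norm (f (cmul (circ t) Z) / circ t ^ d))\<^sup>2 \<partial>?M) = (\<integral>Z. (norm (f Z))\<^sup>2 \<partial>?M)" for t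
  proof -
    note s = symmetry_cmul[OF norm_circ, of lam t]
    note [measurable] = bergman_D(1)[OF f]
    have "(\<integral>Z. (norm (f (cmul (circ t) Z)))\<^sup>2 \<partial>?M) = (\<integral>Z. (norm (f Z))\<^sup>2 \<partial>distr ?M ?M (cmul (circ t)))"
      by (rule integral_distr[OF symmetry_distr_bergman(1)[OF s], symmetric]) measurable
    then show ?thesis
      by (simp add: symmetry_distr_bergman(2)[OF s] norm_divide norm_power)
  qed
  have "integrable (?N \<Otimes>\<^sub>M ?M) (case_prod G)"
  proof (rule P.Fubini_integrable[OF G_meas])
    define B where "B = \<bar>C\<bar> * ((\<integral>Z. (norm (f Z))\<^sup>2 \<partial>?M) + (\<integral>Z. (norm (h Z))\<^sup>2 \<partial>?M))"
    have "(\<integral>Z. norm (G t Z) \<partial>?M) \<le> B" for t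
      using symbol_integrable(2)[OF a rot[of t] h] unfolding norm_rot G_def B_def .
    moreover have "0 \<le> (\<integral>Z. norm (G t Z) \<partial>?M)" for t by simp
    moreover have "(\<lambda>t. \<integral>Z. norm (G t Z) \<partial>?M) \<in> borel_measurable ?N"
      using G_meas by (intro M.borel_measurable_lebesgue_integral) (simp add: case_prod_beta')
    ultimately show "integrable ?N (\<lambda>t. \<integral>Z. norm (case_prod G (t, Z)) \<partial>?M)"
      by (intro N.integrable_const_bound[where B = B]) auto
    show "AE t in ?N. integrable ?M (\<lambda>Z. case_prod G (t, Z))"
      using symbol_integrable(1)[OF a rot h] by (simp add: G_def)
  qed
  note fub = P.Fubini_integral[OF this]
  have "L2_inner lam (\<lambda>Z. a Z * cutoff (hom_part d f) Z) h = (\<integral>Z. (\<integral>t. G t Z \<partial>?N) \<partial>?M)"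
    unfolding L2_inner_def
  proof (rule Bochner_Integration.integral_cong[OF refl])
    fix Z
    assume "Z \<in> space ?M"
    then have "cutoff (hom_part d f) Z = (\<integral>t. f (cmul (circ t) Z) / circ t ^ d \<partial>?N)"
      by (simp add: space_bergman cutoff_def hom_part_circle_integral[OF bergman_line_hol[OF f]])
    then show "a Z * cutoff (hom_part d f) Z * cnj (h Z) = (\<integral>t. G t Z \<partial>?N)"
      by (simp only: G_def integral_mult_right_zero integral_mult_left_zero)
  qed
  also have "\<dots> = (\<integral>t. (\<integral>Z. G t Z \<partial>?M) \<partial>?N)" by (rule fub)
  also have "\<dots> = (\<integral>t. L2_inner lam (\<lambda>Z. a Z * f (cmul (circ t) Z)) h / circ t ^ d \<partial>?N)"
    by (simp add: L2_inner_def G_def)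
  finally show ?thesis .
qed

text \<open>
  Under the circle average, \<open>a f (e\<^sup>i\<^sup>\<theta> Z)\<close> may be replaced by \<open>(T f) (e\<^sup>i\<^sup>\<theta> Z)\<close>, because \<open>T\<close> commutes with
  rotations; then the average is taken back inside, this time with symbol \<open>1\<close>.
\<close>

lemma has_symbol_hom_part:
  fixes T :: "('n::finite) operator"
  assumes unit: "emeasure (bergman_measure lam :: (complex ^ 'n ^ 'n) measure) cartan_domain = 1"
    and T: "has_symbol lam T a" and inv: "\<And>t. AE Z in bergman_measure lam. a (cmul (circ t) Z) = a Z"
    and f: "f \<in> bergman_space lam"
  shows "T (cutoff (hom_part d f)) = cutoff (hom_part d (T f))"
proof (rule bergman_weak_eq[OF unit])
  have Tb: "T \<in> bounded_ops lam" using T by (simp add: has_symbol_def)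
  obtain C where a: "a \<in> borel_measurable (bergman_measure lam)" "AE Z in bergman_measure lam. norm (a Z) \<le> C"
    using T by (auto simp: has_symbol_def)
  note Tf = bounded_ops_D(1)[OF Tb f]
  have cut: "cutoff (hom_part d g) \<in> bergman_space lam" if "g \<in> bergman_space lam" for g :: "complex ^ 'n ^ 'n \<Rightarrow> complex"
    by (rule cutoff_hform_bergman[OF unit hom_part_hforms[OF bergman_line_hol[OF that]]])
  show "T (cutoff (hom_part d f)) \<in> bergman_space lam" by (rule bounded_ops_D(1)[OF Tb cut[OF f]])
  show "cutoff (hom_part d (T f)) \<in> bergman_space lam" by (rule cut[OF Tf])
  fix h :: "complex ^ 'n ^ 'n \<Rightarrow> complex"
  assume h: "h \<in> bergman_space lam"
  have rot: "L2_inner lam (\<lambda>Z. a Z * f (cmul (circ t) Z)) h = L2_inner lam (\<lambda>Z. 1 * T f (cmul (circ t) Z)) h" for t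
  proof -
    note s = symmetry_cmul[OF norm_circ, of lam t]
    have "L2_inner lam (\<lambda>Z. a Z * f (cmul (circ t) Z)) h = L2_inner lam (T (\<lambda>Z. f (cmul (circ t) Z))) h"
      using T bergman_symmetry[OF s f] h by (simp add: has_symbol_def)
    then show ?thesis
      by (simp add: has_symbol_symmetry[OF unit T s inv f])
  qed
  have "L2_inner lam (T (cutoff (hom_part d f))) h = L2_inner lam (\<lambda>Z. a Z * cutoff (hom_part d f) Z) h"
    using T cut[OF f] h by (simp add: has_symbol_def)
  also have "\<dots> = (\<integral>t. L2_inner lam (\<lambda>Z. 1 * T f (cmul (circ t) Z)) h / circ t ^ d \<partial>circle_measure)"
    unfolding inner_hom_part[OF unit a f h] rot ..
  also have "\<dots> = L2_inner lam (\<lambda>Z. 1 * cutoff (hom_part d (T f)) Z) h"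
    by (rule inner_hom_part[OF unit _ _ Tf h, symmetric, of _ 1]) simp_all
  finally show "L2_inner lam (T (cutoff (hom_part d f))) h = L2_inner lam (cutoff (hom_part d (T f))) h"
    by simp
qed

section \<open>Commutation of left- and right-invariant symbols\<close>

lemma bounded_ops_sum:
  fixes T :: "('n::finite) operator"
  assumes T: "T \<in> bounded_ops lam" and "finite K" "\<And>k. k \<in> K \<Longrightarrow> f k \<in> bergman_space lam"
  shows "T (\<lambda>Z. \<Sum>k\<in>K. c k * f k Z) = (\<lambda>Z. \<Sum>k\<in>K. c k * T (f k) Z)"
  using assms(2,3)
proof (induction K rule: finite_induct)
  case empty
  show ?case
    using bounded_ops_D(3)[OF T bergman_zero, of 0] by simp
next
  case (insert k K)
  then have "T (\<lambda>Z. c k * f k Z + (\<Sum>k\<in>K. c k * f k Z)) = (\<lambda>Z. T (\<lambda>Z. c k * f k Z) Z + T (\<lambda>Z. \<Sum>k\<in>K. c k * f k Z) Z)"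
    by (intro bounded_ops_D(2)[OF T] bergman_scale bergman_sum) auto
  then show ?case
    using insert bounded_ops_D(3)[OF T, of "f k" "c k"] by simp
qed

text \<open>
  The operator that \<open>T\<close> induces on forms of degree \<open>d\<close>.
\<close>

definition compression :: "nat \<Rightarrow> ('n::finite) operator \<Rightarrow> ('n::finite) operator" where
  "compression d T p = hom_part d (T (cutoff p))"

lemma hom_part_precompose: "(\<And>w Z. \<phi> (cmul w Z) = cmul w (\<phi> Z)) \<Longrightarrow> hom_part d (\<lambda>Z. g (\<phi> Z)) Z = hom_part d g (\<phi> Z)"
  by (simp add: hom_part_def)

lemma compression_properties:
  fixes T :: "('n::finite) operator"
  assumes unit: "emeasure (bergman_measure lam :: (complex ^ 'n ^ 'n) measure) cartan_domain = 1"
    and T: "has_symbol lam T a" and inv: "\<And>t. AE Z in bergman_measure lam. a (cmul (circ t) Z) = a Z"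
  shows "linear_on_hforms d (compression d T)"
    "p \<in> hforms d \<Longrightarrow> cutoff (compression d T p) = T (cutoff p)"
    "p \<in> hforms d \<Longrightarrow> symmetry lam \<phi> \<psi> \<Longrightarrow> AE Z in bergman_measure lam. a (\<phi> Z) = a Z \<Longrightarrow>
       compression d T (\<lambda>Z. p (\<phi> Z)) = (\<lambda>Z. compression d T p (\<phi> Z))"
proof -
  have Tb: "T \<in> bounded_ops lam" using T by (simp add: has_symbol_def)
  have cut: "cutoff p \<in> bergman_space lam" if "p \<in> hforms d" for p :: "complex ^ 'n ^ 'n \<Rightarrow> complex"
    by (rule cutoff_hform_bergman[OF unit that])
  have Tcut: "line_hol cartan_domain (T (cutoff p))" if "p \<in> hforms d" for p
    by (rule bergman_line_hol[OF bounded_ops_D(1)[OF Tb cut[OF that]]])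
  show "linear_on_hforms d (compression d T)"
    unfolding linear_on_hforms_def
  proof (intro conjI allI impI)
    show "compression d T \<in> hforms d \<rightarrow> hforms d"
      using hom_part_hforms[OF Tcut] by (auto simp: compression_def)
    fix K :: "('n \<times> 'n \<Rightarrow> nat) set" and c and f :: "_ \<Rightarrow> complex ^ 'n ^ 'n \<Rightarrow> complex"
    assume K: "finite K" and f: "\<forall>k\<in>K. f k \<in> hforms d"
    have "cutoff (\<lambda>Z. \<Sum>k\<in>K. c k * f k Z) = (\<lambda>Z. \<Sum>k\<in>K. c k * cutoff (f k) Z)"
      by (auto simp: cutoff_def)
    then have "T (cutoff (\<lambda>Z. \<Sum>k\<in>K. c k * f k Z)) = (\<lambda>Z. \<Sum>k\<in>K. c k * T (cutoff (f k)) Z)"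
      using bounded_ops_sum[OF Tb K, of "\<lambda>k. cutoff (f k)" c] cut f by simp
    then show "compression d T (\<lambda>Z. \<Sum>k\<in>K. c k * f k Z) = (\<lambda>Z. \<Sum>k\<in>K. c k * compression d T (f k) Z)"
      unfolding compression_def using hom_part_sum[OF K, of "\<lambda>k. T (cutoff (f k))" d c] Tcut f by auto
  qed
  show "cutoff (compression d T p) = T (cutoff p)" if p: "p \<in> hforms d"
  proof -
    have "line_hol cartan_domain p"
      using hforms_D(1)[OF p] by (rule line_hol_subset) simp
    then have "cutoff (hom_part d (cutoff p)) = cutoff p"
      by (auto simp: cutoff_def[of "hom_part d (cutoff p)"] cutoff_def[of p] hom_part_cutoff hom_part_hform[OF p])
    then show ?thesis
      using has_symbol_hom_part[OF unit T inv cut[OF p], of d] by (simp add: compression_def)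
  qed
  assume p: "p \<in> hforms d" and s: "symmetry lam \<phi> \<psi>" and inv': "AE Z in bergman_measure lam. a (\<phi> Z) = a Z"
  have "cutoff (\<lambda>Z. p (\<phi> Z)) = (\<lambda>Z. cutoff p (\<phi> Z))"
    by (simp add: cutoff_def symmetry_D(7)[OF s] fun_eq_iff)
  then have "T (cutoff (\<lambda>Z. p (\<phi> Z))) = (\<lambda>Z. T (cutoff p) (\<phi> Z))"
    using has_symbol_symmetry[OF unit T s inv' cut[OF p]] by simp
  then show "compression d T (\<lambda>Z. p (\<phi> Z)) = (\<lambda>Z. compression d T p (\<phi> Z))"
    by (intro ext) (simp add: compression_def hom_part_precompose[OF symmetry_D(6)[OF s]])
qed

text \<open>
  The homogeneous parts of \<open>T (S f)\<close> and \<open>S (T f)\<close> arise by applying \<open>T S\<close> and \<open>S T\<close> to the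
  homogeneous parts of \<open>f\<close>, where the induced operators commute; and a holomorphic function is
  determined by its homogeneous parts.
\<close>

lemma left_right_operators_commute:
  fixes S T :: "('n::finite) operator"
  assumes unit: "emeasure (bergman_measure lam :: (complex ^ 'n ^ 'n) measure) cartan_domain = 1"
    and T: "has_symbol lam T a" and S: "has_symbol lam S b"
    and left: "\<And>U. unitary U \<Longrightarrow> AE Z in bergman_measure lam. a (U ** Z) = a Z"
    and right: "\<And>U. unitary U \<Longrightarrow> AE Z in bergman_measure lam. b (Z ** U) = b Z"
    and f: "f \<in> bergman_space lam"
  shows "T (S f) = S (T f)"
proof -
  have a: "AE Z in bergman_measure lam. a (cmul (circ t) Z) = a Z" for t
    using left[OF unitary_scalar[OF norm_circ], of t] by (simp add: matrix_mult_cmul_left)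
  have b: "AE Z in bergman_measure lam. b (cmul (circ t) Z) = b Z" for t
    using right[OF unitary_scalar[OF norm_circ], of t] by (simp add: matrix_mult_cmul_right)
  note Tc = compression_properties[OF unit T a] and Sc = compression_properties[OF unit S b]
  have Tb: "T \<in> bounded_ops lam" and Sb: "S \<in> bounded_ops lam"
    using T S by (simp_all add: has_symbol_def)
  have on_forms: "T (S (cutoff p)) = S (T (cutoff p))" if p: "p \<in> hforms d" for p d
  proof -
    have mem: "compression d S p \<in> hforms d" "compression d T p \<in> hforms d"
      using Sc(1)[of d] Tc(1)[of d] p by (auto simp: linear_on_hforms_def)
    have "compression d T (compression d S p) = compression d S (compression d T p)"
    proof (rule left_right_commute_on_hforms[OF Tc(1) Sc(1) _ _ p])
      show "compression d T (\<lambda>Z. q (U ** Z)) = (\<lambda>Z. compression d T q (U ** Z))"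
        if "unitary U" "q \<in> hforms d" for U q
        by (rule Tc(3)[OF that(2) symmetry_left[OF that(1)] left[OF that(1)]])
      show "compression d S (\<lambda>Z. q (Z ** U)) = (\<lambda>Z. compression d S q (Z ** U))"
        if "unitary U" "q \<in> hforms d" for U q
        by (rule Sc(3)[OF that(2) symmetry_right[OF that(1)] right[OF that(1)]])
    qed
    then show ?thesis
      by (metis Tc(2) Sc(2) mem p)
  qed
  let ?g = "\<lambda>Z. T (S f) Z - S (T f) Z"
  note Sf = bounded_ops_D(1)[OF Sb f] and Tf = bounded_ops_D(1)[OF Tb f]
  note TSf = bounded_ops_D(1)[OF Tb Sf] and STf = bounded_ops_D(1)[OF Sb Tf]
  have parts: "hom_part d (T (S f)) Z = hom_part d (S (T f)) Z" if Z: "Z \<in> cartan_domain" for d Z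
  proof -
    have "cutoff (hom_part d (T (S f))) = T (S (cutoff (hom_part d f)))"
      by (simp add: has_symbol_hom_part[OF unit T a Sf] has_symbol_hom_part[OF unit S b f])
    also have "\<dots> = S (T (cutoff (hom_part d f)))"
      by (rule on_forms[OF hom_part_hforms[OF bergman_line_hol[OF f]]])
    also have "\<dots> = cutoff (hom_part d (S (T f)))"
      by (simp add: has_symbol_hom_part[OF unit S b Tf] has_symbol_hom_part[OF unit T a f])
    finally show ?thesis
      using Z by (auto simp: cutoff_def fun_eq_iff split: if_splits)
  qed
  have "hom_part d ?g Z = 0" if "Z \<in> cartan_domain" for d Z
    using hom_part_sum[of "{True, False}" "\<lambda>k. if k then T (S f) else S (T f)" d "\<lambda>k. if k then 1 else -1" Z]
      parts[OF that, of d] bergman_line_hol[OF TSf] bergman_line_hol[OF STf] by simp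
  then have "?g Z = 0" if "Z \<in> cartan_domain" for Z
    using hom_part_zero_imp_zero[OF bergman_line_hol[OF bergman_diff[OF TSf STf]]] that by blast
  then show ?thesis
    by (intro bergman_eqI[OF TSf STf]) simp
qed

section \<open>Bounded operators\<close>

lemma L2_norm_nonneg: "0 \<le> L2_norm lam f"
  by (simp add: L2_norm_def)

text \<open>
  A triangle inequality up to a factor, obtained from the parallelogram bound under the integral. The
  boundedness of sums and limits equal to \<open>0\<close> are insensitive to the factor.
\<close>

lemma L2_norm_add:
  assumes f: "f \<in> bergman_space lam" and g: "g \<in> bergman_space lam"
  shows "L2_norm lam (\<lambda>Z. f Z + g Z) \<le> 2 * (L2_norm lam f + L2_norm lam g)"
proof -
  let ?n = "\<lambda>f. \<integral>Z. (norm (f Z))\<^sup>2 \<partial>bergman_measure lam"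
  have nn: "0 \<le> ?n f" "0 \<le> ?n g" by simp_all
  have "?n (\<lambda>Z. f Z + g Z) \<le> (\<integral>Z. 2 * (norm (f Z))\<^sup>2 + 2 * (norm (g Z))\<^sup>2 \<partial>bergman_measure lam)"
    by (intro integral_mono Bochner_Integration.integrable_add integrable_mult_right bergman_D(2) f g bergman_add norm_add_power2_le)
  also have "\<dots> = 2 * ?n f + 2 * ?n g"
    using bergman_D(2)[OF f] bergman_D(2)[OF g] by simp
  also have "\<dots> \<le> (2 * (sqrt (?n f) + sqrt (?n g)))\<^sup>2"
  proof -
    have "0 \<le> sqrt (?n f) * sqrt (?n g)" using nn by simp
    then show ?thesis using nn by (simp add: power_mult_distrib power2_sum)
  qed
  finally have "sqrt (?n (\<lambda>Z. f Z + g Z)) \<le> 2 * (sqrt (?n f) + sqrt (?n g))"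
    by (intro real_le_lsqrt) (use nn in auto)
  then show ?thesis by (simp add: L2_norm_def)
qed

lemma L2_norm_scale: "L2_norm lam (\<lambda>Z. c * f Z) = norm c * L2_norm lam f"
  by (simp add: L2_norm_def norm_mult power_mult_distrib real_sqrt_mult)

lemma L2_norm_zero_imp:
  fixes f :: "complex ^ 'n ^ 'n \<Rightarrow> complex"
  assumes unit: "emeasure (bergman_measure lam :: (complex ^ 'n ^ 'n) measure) cartan_domain = 1"
    and f: "f \<in> bergman_space lam" and "L2_norm lam f = 0"
  shows "f = (\<lambda>Z. 0)"
  using bergman_norm_zero[OF unit f] assms(3) by (simp add: L2_norm_def)

lemma bounded_opsI:
  assumes "\<And>f. f \<in> bergman_space lam \<Longrightarrow> T f \<in> bergman_space lam"
    "\<And>f. f \<notin> bergman_space lam \<Longrightarrow> T f = undefined"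
    "\<And>f g. f \<in> bergman_space lam \<Longrightarrow> g \<in> bergman_space lam \<Longrightarrow> T (\<lambda>Z. f Z + g Z) = (\<lambda>Z. T f Z + T g Z)"
    "\<And>c f. f \<in> bergman_space lam \<Longrightarrow> T (\<lambda>Z. c * f Z) = (\<lambda>Z. c * T f Z)"
    "\<And>f. f \<in> bergman_space lam \<Longrightarrow> L2_norm lam (T f) \<le> C * L2_norm lam f"
  shows "T \<in> bounded_ops lam"
  unfolding bounded_ops_def mem_Collect_eq
  by (intro conjI exI[of _ C] ballI allI PiE_I) (use assms in auto)

lemma bounded_ops_bound:
  assumes "T \<in> bounded_ops lam"
  obtains C where "0 \<le> C" "\<And>f. f \<in> bergman_space lam \<Longrightarrow> L2_norm lam (T f) \<le> C * L2_norm lam f"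
proof -
  obtain C where C: "\<And>f. f \<in> bergman_space lam \<Longrightarrow> L2_norm lam (T f) \<le> C * L2_norm lam f"
    using bounded_ops_D(5)[OF assms] by blast
  have "L2_norm lam (T f) \<le> \<bar>C\<bar> * L2_norm lam f" if "f \<in> bergman_space lam" for f
    using C[OF that] mult_right_mono[OF abs_ge_self L2_norm_nonneg, of C lam f] by linarith
  then show ?thesis by (intro that[of "\<bar>C\<bar>"]) auto
qed

lemma op_apply:
  assumes "f \<in> bergman_space lam"
  shows "op_id lam f = f" "op_add lam S T f = (\<lambda>Z. S f Z + T f Z)" "op_scale lam c T f = (\<lambda>Z. c * T f Z)"
    "op_mult lam S T f = S (T f)"
  using assms by (simp_all add: op_id_def op_add_def op_scale_def op_mult_def compose_def)

lemma op_undefined: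
  assumes "f \<notin> bergman_space lam"
  shows "op_id lam f = undefined" "op_add lam S T f = undefined" "op_scale lam c T f = undefined"
    "op_mult lam S T f = undefined"
  using assms by (simp_all add: op_id_def op_add_def op_scale_def op_mult_def compose_def)

lemma op_id_bounded: "op_id lam \<in> bounded_ops lam"
  by (rule bounded_opsI[where C = 1]) (simp_all add: op_apply op_undefined bergman_add bergman_scale)

lemma op_scale_bounded:
  assumes T: "T \<in> bounded_ops lam"
  shows "op_scale lam c T \<in> bounded_ops lam"
proof -
  obtain C where C: "\<And>f. f \<in> bergman_space lam \<Longrightarrow> L2_norm lam (T f) \<le> C * L2_norm lam f"
    by (rule bounded_ops_bound[OF T]) blast
  show ?thesis
  proof (rule bounded_opsI[where C = "norm c * C"])
    show "L2_norm lam (op_scale lam c T f) \<le> norm c * C * L2_norm lam f" if "f \<in> bergman_space lam" for f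
      using mult_left_mono[OF C[OF that] norm_ge_zero[of c]] by (simp add: op_apply that L2_norm_scale mult.assoc)
  qed (simp_all add: op_apply op_undefined bergman_add bergman_scale bounded_ops_D(1-3)[OF T] algebra_simps)
qed

lemma op_add_bounded:
  assumes S: "S \<in> bounded_ops lam" and T: "T \<in> bounded_ops lam"
  shows "op_add lam S T \<in> bounded_ops lam"
proof -
  obtain B where B: "\<And>f. f \<in> bergman_space lam \<Longrightarrow> L2_norm lam (S f) \<le> B * L2_norm lam f"
    by (rule bounded_ops_bound[OF S]) blast
  obtain C where C: "\<And>f. f \<in> bergman_space lam \<Longrightarrow> L2_norm lam (T f) \<le> C * L2_norm lam f"
    by (rule bounded_ops_bound[OF T]) blast
  show ?thesis
  proof (rule bounded_opsI[where C = "2 * (B + C)"])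
    show "L2_norm lam (op_add lam S T f) \<le> 2 * (B + C) * L2_norm lam f" if f: "f \<in> bergman_space lam" for f
      using L2_norm_add[OF bounded_ops_D(1)[OF S f] bounded_ops_D(1)[OF T f]] B[OF f] C[OF f]
      by (simp add: op_apply f algebra_simps)
  qed (simp_all add: op_apply op_undefined bergman_add bergman_scale bounded_ops_D(1-3)[OF T]
        bounded_ops_D(1-3)[OF S] algebra_simps)
qed

lemma op_mult_bounded:
  assumes S: "S \<in> bounded_ops lam" and T: "T \<in> bounded_ops lam"
  shows "op_mult lam S T \<in> bounded_ops lam"
proof -
  obtain B where B: "0 \<le> B" "\<And>f. f \<in> bergman_space lam \<Longrightarrow> L2_norm lam (S f) \<le> B * L2_norm lam f"
    by (rule bounded_ops_bound[OF S]) blast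
  obtain C where C: "\<And>f. f \<in> bergman_space lam \<Longrightarrow> L2_norm lam (T f) \<le> C * L2_norm lam f"
    by (rule bounded_ops_bound[OF T]) blast
  show ?thesis
  proof (rule bounded_opsI[where C = "B * C"])
    show "L2_norm lam (op_mult lam S T f) \<le> B * C * L2_norm lam f" if f: "f \<in> bergman_space lam" for f
      using order_trans[OF B(2)[OF bounded_ops_D(1)[OF T f]] mult_left_mono[OF C[OF f] B(1)]]
      by (simp add: op_apply f mult.assoc)
  qed (simp_all add: op_apply op_undefined bergman_add bergman_scale bounded_ops_D(1-3)[OF T] bounded_ops_D(1-3)[OF S])
qed

lemma op_norm_bound:
  fixes T :: "('n::finite) operator"
  assumes unit: "emeasure (bergman_measure lam :: (complex ^ 'n ^ 'n) measure) cartan_domain = 1"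
    and T: "T \<in> bounded_ops lam" and f: "f \<in> bergman_space lam"
  shows "L2_norm lam (T f) \<le> op_norm lam T * L2_norm lam f"
proof (cases "L2_norm lam f = 0")
  case True
  then have "f = (\<lambda>Z. 0)" by (rule L2_norm_zero_imp[OF unit f])
  then have "T f = (\<lambda>Z. 0)"
    using bounded_ops_D(3)[OF T f, of 0] by simp
  then show ?thesis using True by (simp add: L2_norm_def)
next
  case False
  let ?n = "L2_norm lam f" and ?B = "{f \<in> bergman_space lam. L2_norm lam f \<le> 1}"
  have n: "?n > 0" using False L2_norm_nonneg[of lam f] by simp
  obtain C where C: "0 \<le> C" "\<And>f. f \<in> bergman_space lam \<Longrightarrow> L2_norm lam (T f) \<le> C * L2_norm lam f"
    by (rule bounded_ops_bound[OF T]) blast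
  have "L2_norm lam (T g) \<le> C" if "g \<in> ?B" for g
    using C(2)[of g] mult_left_mono[of "L2_norm lam g" 1 C] that C(1) by simp
  then have bdd: "bdd_above ((\<lambda>f. L2_norm lam (T f)) ` ?B)"
    by (intro bdd_aboveI2[of _ _ C])
  let ?g = "\<lambda>Z. of_real (1 / ?n) * f Z"
  have "?g \<in> ?B"
    using n by (simp add: bergman_scale[OF f] L2_norm_scale[of lam "of_real (1 / ?n)"] norm_divide del: of_real_divide)
  then have "L2_norm lam (T ?g) \<le> op_norm lam T"
    unfolding op_norm_def by (rule cSUP_upper[OF _ bdd])
  moreover have "L2_norm lam (T ?g) = L2_norm lam (T f) / ?n"
    using n unfolding bounded_ops_D(3)[OF T f] L2_norm_scale by (simp add: norm_divide)
  ultimately have "L2_norm lam (T f) / ?n \<le> op_norm lam T" by (simp only:)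
  then show ?thesis using n by (simp add: pos_divide_le_eq)
qed

section \<open>Generated algebras\<close>

lemma closed_unital_bounded_ops: "closed_unital_subalgebra lam (bounded_ops lam)"
  unfolding closed_unital_subalgebra_def norm_closed_def
  by (auto intro: op_id_bounded op_scale_bounded op_add_bounded op_mult_bounded)

text \<open>
  The hull is an intersection that may be taken over algebras of bounded operators, since these operators
  themselves form one that contains \<open>G\<close>.
\<close>

lemma closed_unital_generated:
  assumes "G \<subseteq> bounded_ops lam"
  shows "closed_unital_subalgebra lam (banach_algebra_gen lam G)"
proof -
  let ?F = "{M. closed_unital_subalgebra lam M \<and> G \<subseteq> M}"
  have gen: "banach_algebra_gen lam G = \<Inter> ?F"
    by (simp add: banach_algebra_gen_def hull_def)
  have B: "bounded_ops lam \<in> ?F" using assms closed_unital_bounded_ops by blast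
  have F: "M \<subseteq> bounded_ops lam \<and> op_id lam \<in> M \<and> (\<forall>S\<in>M. \<forall>T\<in>M. op_add lam S T \<in> M) \<and>
     (\<forall>c. \<forall>T\<in>M. op_scale lam c T \<in> M) \<and> (\<forall>S\<in>M. \<forall>T\<in>M. op_mult lam S T \<in> M) \<and> norm_closed lam M"
    if "M \<in> ?F" for M
    using that unfolding closed_unital_subalgebra_def by blast
  have "norm_closed lam (\<Inter> ?F)"
    unfolding norm_closed_def
  proof (intro allI ballI impI InterI)
    fix X T M
    assume T: "T \<in> bounded_ops lam" and M: "M \<in> ?F"
      and X: "(\<forall>k. X k \<in> \<Inter> ?F) \<and> (\<lambda>k. op_norm lam (op_add lam (X k) (op_scale lam (- 1) T))) \<longlonglongrightarrow> 0"
    then have "\<forall>k. X k \<in> M" by blast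
    then show "T \<in> M"
      using F[OF M] X T unfolding norm_closed_def by blast
  qed
  moreover have "\<Inter> ?F \<subseteq> bounded_ops lam" using B by blast
  moreover have "op_id lam \<in> \<Inter> ?F" using F by blast
  moreover have "\<forall>S\<in>\<Inter> ?F. \<forall>T\<in>\<Inter> ?F. op_add lam S T \<in> \<Inter> ?F" using F by blast
  moreover have "\<forall>c. \<forall>T\<in>\<Inter> ?F. op_scale lam c T \<in> \<Inter> ?F" using F by blast
  moreover have "\<forall>S\<in>\<Inter> ?F. \<forall>T\<in>\<Inter> ?F. op_mult lam S T \<in> \<Inter> ?F" using F by blast
  ultimately show ?thesis
    unfolding gen closed_unital_subalgebra_def by blast
qed

lemma generators_in_generated: "G \<subseteq> banach_algebra_gen lam G"
  unfolding banach_algebra_gen_def by (rule hull_subset)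

definition commutant :: "real \<Rightarrow> ('n::finite) operator set \<Rightarrow> 'n operator set" where
  "commutant lam G = {X \<in> bounded_ops lam. \<forall>Y\<in>G. \<forall>f\<in>bergman_space lam. X (Y f) = Y (X f)}"

lemma commute_iff:
  "op_mult lam S T = op_mult lam T S \<longleftrightarrow> (\<forall>f\<in>bergman_space lam. S (T f) = T (S f))"
proof
  assume eq: "op_mult lam S T = op_mult lam T S"
  show "\<forall>f\<in>bergman_space lam. S (T f) = T (S f)"
    using fun_cong[OF eq] by (metis op_apply(4))
next
  assume "\<forall>f\<in>bergman_space lam. S (T f) = T (S f)"
  then show "op_mult lam S T = op_mult lam T S"
    unfolding op_mult_def compose_def by (intro restrict_ext) simp
qed

text \<open>
  Closedness in norm: if \<open>X\<^sub>k\<close> commutes with \<open>Y\<close> and \<open>D\<^sub>k = X\<^sub>k - T\<close> tends to \<open>0\<close>, then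
  \<open>T Y - Y T = Y D\<^sub>k - D\<^sub>k Y\<close> tends to \<open>0\<close> and does not depend on \<open>k\<close>.
\<close>

lemma closed_unital_commutant:
  fixes G :: "('n::finite) operator set"
  assumes unit: "emeasure (bergman_measure lam :: (complex ^ 'n ^ 'n) measure) cartan_domain = 1"
    and G: "G \<subseteq> bounded_ops lam"
  shows "closed_unital_subalgebra lam (commutant lam G)"
proof -
  have Gb: "Y \<in> bounded_ops lam" if "Y \<in> G" for Y using G that by blast
  have closed: "T (Y f) = Y (T f)"
    if T: "T \<in> bounded_ops lam" and X: "\<And>k. X k \<in> commutant lam G"
      and lim: "(\<lambda>k. op_norm lam (op_add lam (X k) (op_scale lam (- 1) T))) \<longlonglongrightarrow> 0"
      and Y: "Y \<in> G" and f: "f \<in> bergman_space lam"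
    for T X Y f
  proof -
    define D where "D k = op_add lam (X k) (op_scale lam (- 1) T)" for k
    note Yb = Gb[OF Y]
    note Yf = bounded_ops_D(1)[OF Yb f] and Tf = bounded_ops_D(1)[OF T f]
    have Xb: "X k \<in> bounded_ops lam" and XY: "X k (Y f) = Y (X k f)" for k
      using X[of k] Y f by (auto simp: commutant_def)
    have Db: "D k \<in> bounded_ops lam" for k
      unfolding D_def by (intro op_add_bounded op_scale_bounded Xb T)
    obtain C where C: "0 \<le> C" "\<And>f. f \<in> bergman_space lam \<Longrightarrow> L2_norm lam (Y f) \<le> C * L2_norm lam f"
      by (rule bounded_ops_bound[OF Yb]) blast
    let ?g = "\<lambda>Z. T (Y f) Z - Y (T f) Z"
    have g: "?g \<in> bergman_space lam"
      by (intro bergman_diff bounded_ops_D(1)[OF T] bounded_ops_D(1)[OF Yb] Yf Tf)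
    have "L2_norm lam ?g \<le> 2 * (L2_norm lam (Y f) + C * L2_norm lam f) * op_norm lam (D k)" for k
    proof -
      note Df = bounded_ops_D(1)[OF Db[of k] f] and DYf = bounded_ops_D(1)[OF Db[of k] Yf]
      have "Y (D k f) = (\<lambda>Z. Y (X k f) Z - Y (T f) Z)"
        using bounded_ops_D(2)[OF Yb bounded_ops_D(1)[OF Xb f] bergman_scale[OF Tf, of "- 1"]]
          bounded_ops_D(3)[OF Yb Tf, of "- 1"]
        by (simp add: D_def op_apply f)
      then have "?g = (\<lambda>Z. Y (D k f) Z + - 1 * D k (Y f) Z)"
        by (simp add: D_def op_apply Yf XY fun_eq_iff)
      then have "L2_norm lam ?g \<le> 2 * (L2_norm lam (Y (D k f)) + L2_norm lam (D k (Y f)))"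
        using L2_norm_add[OF bounded_ops_D(1)[OF Yb Df] bergman_scale[OF DYf, of "- 1"]]
        by (simp only: L2_norm_scale) simp
      also have "L2_norm lam (Y (D k f)) \<le> C * (op_norm lam (D k) * L2_norm lam f)"
        by (rule order_trans[OF C(2)[OF Df] mult_left_mono[OF op_norm_bound[OF unit Db f] C(1)]])
      also have "L2_norm lam (D k (Y f)) \<le> op_norm lam (D k) * L2_norm lam (Y f)"
        by (rule op_norm_bound[OF unit Db Yf])
      finally show ?thesis by (simp add: algebra_simps)
    qed
    moreover have "(\<lambda>k. 2 * (L2_norm lam (Y f) + C * L2_norm lam f) * op_norm lam (D k)) \<longlonglongrightarrow> 0"
      using tendsto_mult_left[OF lim, of "2 * (L2_norm lam (Y f) + C * L2_norm lam f)"] by (simp add: D_def)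
    ultimately have "L2_norm lam ?g \<le> 0"
      by (intro LIMSEQ_le_const) auto
    then have "?g = (\<lambda>Z. 0)"
      using L2_norm_nonneg[of lam ?g] by (intro L2_norm_zero_imp[OF unit g]) simp
    then show ?thesis by (simp add: fun_eq_iff)
  qed
  have "norm_closed lam (commutant lam G)"
    unfolding norm_closed_def
  proof (intro allI ballI impI)
    fix X T
    assume T: "T \<in> bounded_ops lam"
      and X: "(\<forall>k. X k \<in> commutant lam G) \<and> (\<lambda>k. op_norm lam (op_add lam (X k) (op_scale lam (- 1) T))) \<longlonglongrightarrow> 0"
    then show "T \<in> commutant lam G"
      using closed[OF T, of X] by (simp add: commutant_def)
  qed
  then show ?thesis
    unfolding closed_unital_subalgebra_def
    by (auto simp: commutant_def op_apply op_apply[OF bounded_ops_D(1)[OF Gb]] op_id_bounded op_add_bounded op_scale_bounded op_mult_bounded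
        bounded_ops_D(1) bounded_ops_D(2)[OF Gb] bounded_ops_D(3)[OF Gb] bergman_scale)
qed

text \<open>
  The generators lie in their own commutant, so the generated algebra does; hence the generators lie in
  the commutant of the generated algebra, so the generated algebra lies in its own commutant.
\<close>

lemma generated_commutative:
  fixes G :: "('n::finite) operator set"
  assumes unit: "emeasure (bergman_measure lam :: (complex ^ 'n ^ 'n) measure) cartan_domain = 1"
    and G: "G \<subseteq> bounded_ops lam" and comm: "commutative_ops lam G"
  shows "commutative_ops lam (banach_algebra_gen lam G)"
proof -
  let ?A = "banach_algebra_gen lam G"
  have A: "?A \<subseteq> bounded_ops lam"
    using closed_unital_generated[OF G] by (simp add: closed_unital_subalgebra_def)
  have "G \<subseteq> commutant lam G"
    using G comm by (auto simp: commutant_def commutative_ops_def commute_iff)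
  then have "?A \<subseteq> commutant lam G"
    using closed_unital_commutant[OF unit G] unfolding banach_algebra_gen_def by (rule hull_minimal)
  then have "G \<subseteq> commutant lam ?A"
    using G by (auto simp: commutant_def subset_iff)
  then have "?A \<subseteq> commutant lam ?A"
    using closed_unital_commutant[OF unit A] unfolding banach_algebra_gen_def by (rule hull_minimal)
  then show ?thesis
    by (auto simp: commutative_ops_def commute_iff commutant_def)
qed

text \<open>
  An unbounded \<open>T\<close> lies in no algebra of bounded operators, so the hull is an empty intersection. It
  then contains all functions, among them the two constant ones with values \<open>0\<close> and \<open>1\<close>, which do not
  commute. Thus the commutativity assumption carries the information that a Toeplitz operator is a
  well-defined bounded operator.
\<close>

lemma commutative_generated_imp_bounded:
  fixes T :: "('n::finite) operator"
  assumes "commutative_ops lam (banach_algebra_gen lam {T})"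
  shows "T \<in> bounded_ops lam"
proof (rule ccontr)
  assume "T \<notin> bounded_ops lam"
  then have "{M. closed_unital_subalgebra lam M \<and> {T} \<subseteq> M} = {}"
    unfolding closed_unital_subalgebra_def by blast
  then have "banach_algebra_gen lam {T} = UNIV"
    unfolding banach_algebra_gen_def hull_def by (simp only: Inter_empty)
  then have "op_mult lam (\<lambda>_ _. 0) (\<lambda>_ _. 1) = op_mult lam (\<lambda>_ _. 1) ((\<lambda>_ _. 0) :: 'n operator)"
    using assms unfolding commutative_ops_def by blast
  moreover have "(\<lambda>Z. 0) \<in> (bergman_space lam :: (complex ^ 'n ^ 'n \<Rightarrow> complex) set)"
    by (rule bergman_zero)
  ultimately have "(\<lambda>Z :: complex ^ 'n ^ 'n. 0 :: complex) = (\<lambda>Z. 1)"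
    unfolding commute_iff by blast
  then show False
    by (simp add: fun_eq_iff)
qed

text \<open>
  All norms vanish, so the identity converges to every bounded operator.
\<close>

lemma null_measure_full_algebra:
  fixes M :: "('n::finite) operator set"
  assumes null: "AE Z in (bergman_measure lam :: (complex ^ 'n ^ 'n) measure). False"
    and M: "closed_unital_subalgebra lam M"
  shows "bounded_ops lam \<subseteq> M"
proof
  fix T :: "'n operator"
  assume T: "T \<in> bounded_ops lam"
  have "L2_norm lam f = 0" for f :: "complex ^ 'n ^ 'n \<Rightarrow> complex"
    using null unfolding L2_norm_def by (subst integral_eq_zero_AE) (auto elim: eventually_mono)
  moreover have "{f \<in> bergman_space lam. L2_norm lam f \<le> 1} \<noteq> ({} :: (complex ^ 'n ^ 'n \<Rightarrow> complex) set)"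
    using bergman_zero calculation by force
  ultimately have "op_norm lam X = 0" for X :: "'n operator"
    unfolding op_norm_def by simp
  then have "(\<lambda>k. op_norm lam (op_add lam (op_id lam) (op_scale lam (- 1) T))) \<longlonglongrightarrow> 0" by simp
  moreover have "norm_closed lam M" "op_id lam \<in> M"
    using M unfolding closed_unital_subalgebra_def by blast+
  ultimately show "T \<in> M"
    unfolding norm_closed_def using T by (elim allE[of _ "\<lambda>_. op_id lam"] ballE[of _ _ T]) auto
qed

section \<open>Toeplitz operators\<close>

text \<open>
  If \<open>a f\<close> has an orthogonal projection for every \<open>f\<close>, then \<open>a\<close> itself is a symbol. Otherwise linearity
  forces the operator to be \<open>0\<close>, and then \<open>0\<close> is a symbol. Both symbols inherit the invariance of \<open>a\<close>.
\<close>

lemma toeplitz_has_symbol: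
  fixes a :: "complex ^ 'n ^ 'n \<Rightarrow> complex"
  assumes unit: "emeasure (bergman_measure lam :: (complex ^ 'n ^ 'n) measure) cartan_domain = 1"
    and a: "a \<in> Linf" and T: "toeplitz lam a \<in> bounded_ops lam"
  shows "has_symbol lam (toeplitz lam a) a \<or> has_symbol lam (toeplitz lam a) (\<lambda>Z. 0)"
proof -
  let ?T = "toeplitz lam a"
  obtain C where am: "a \<in> borel_measurable (bergman_measure lam)" and aC: "AE Z in bergman_measure lam. norm (a Z) \<le> C"
    using a AE_lebesgue_imp_bergman by (auto simp: Linf_def measurable_bergman)
  define proj where "proj f g \<longleftrightarrow> g \<in> bergman_space lam \<and>
    (\<forall>h\<in>bergman_space lam. L2_inner lam (\<lambda>Z. a Z * f Z - g Z) h = 0)" for f g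
  have T_eq: "?T f = (THE g. proj f g)" if "f \<in> bergman_space lam" for f
    using that by (simp add: toeplitz_def bergman_proj_def proj_def)
  have inner: "L2_inner lam (\<lambda>Z. a Z * f Z - g Z) h = L2_inner lam (\<lambda>Z. a Z * f Z) h - L2_inner lam g h"
    if "f \<in> bergman_space lam" "g \<in> bergman_space lam" "h \<in> bergman_space lam" for f g h
    unfolding L2_inner_def left_diff_distrib
    by (rule Bochner_Integration.integral_diff[OF symbol_integrable(1)[OF am aC that(1,3)] inner_integrable[OF that(2,3)]])
  have unique: "g = g'" if "f \<in> bergman_space lam" "proj f g" "proj f g'" for f g g'
    using that by (intro bergman_weak_eq[OF unit]) (auto simp: proj_def inner)
  have proj_comb: "proj (\<lambda>Z. c * f Z + c' * f' Z) (\<lambda>Z. c * g Z + c' * g' Z)"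
    if f: "f \<in> bergman_space lam" "proj f g" and f': "f' \<in> bergman_space lam" "proj f' g'" for c c' f f' g g'
    unfolding proj_def
  proof (intro conjI ballI)
    have g: "g \<in> bergman_space lam" "g' \<in> bergman_space lam"
      using f f' by (simp_all add: proj_def)
    then show "(\<lambda>Z. c * g Z + c' * g' Z) \<in> bergman_space lam"
      by (intro bergman_add bergman_scale)
    fix h :: "complex ^ 'n ^ 'n \<Rightarrow> complex"
    assume h: "h \<in> bergman_space lam"
    let ?d = "\<lambda>Z. (a Z * f Z - g Z) * cnj (h Z)" and ?d' = "\<lambda>Z. (a Z * f' Z - g' Z) * cnj (h Z)"
    have "integrable (bergman_measure lam) ?d" "integrable (bergman_measure lam) ?d'"
      unfolding left_diff_distrib
      by (intro Bochner_Integration.integrable_diff symbol_integrable(1)[OF am aC] inner_integrable f f' g h)+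
    moreover have "(\<integral>Z. ?d Z \<partial>bergman_measure lam) = 0" "(\<integral>Z. ?d' Z \<partial>bergman_measure lam) = 0"
      using f f' h by (simp_all add: proj_def L2_inner_def)
    ultimately have "(\<integral>Z. c * ?d Z + c' * ?d' Z \<partial>bergman_measure lam) = 0"
      by simp
    then show "L2_inner lam (\<lambda>Z. a Z * (c * f Z + c' * f' Z) - (c * g Z + c' * g' Z)) h = 0"
      by (simp add: L2_inner_def algebra_simps)
  qed
  show ?thesis
  proof (cases "\<forall>f\<in>bergman_space lam. \<exists>g. proj f g")
    case True
    have "proj f (?T f)" if "f \<in> bergman_space lam" for f
      unfolding T_eq[OF that] using True unique[OF that] that by (metis theI)
    then have "L2_inner lam (?T f) h = L2_inner lam (\<lambda>Z. a Z * f Z) h"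
      if "f \<in> bergman_space lam" "h \<in> bergman_space lam" for f h
      using that inner[OF that(1) bounded_ops_D(1)[OF T that(1)] that(2)] by (simp add: proj_def)
    then show ?thesis
      using T am aC by (auto simp: has_symbol_def)
  next
    case False
    then obtain f0 where f0: "f0 \<in> bergman_space lam" "\<And>g. \<not> proj f0 g" by blast
    \<comment> \<open>The definite description has the same unspecified value \<open>u\<close> at every \<open>f\<close> without projection.\<close>
    define u where "u = (THE g :: complex ^ 'n ^ 'n \<Rightarrow> complex. False)"
    have T_u: "?T f = u" if "f \<in> bergman_space lam" "\<And>g. \<not> proj f g" for f
      using T_eq[OF that(1)] that(2) by (simp add: u_def)
    \<comment> \<open>Doubling \<open>f0\<close> keeps the value \<open>u\<close>, so \<open>2 u = u\<close>.\<close>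
    have "\<not> proj (\<lambda>Z. 2 * f0 Z) g" for g
    proof
      assume "proj (\<lambda>Z. 2 * f0 Z) g"
      from proj_comb[OF bergman_scale[OF f0(1)] this bergman_scale[OF f0(1)] this, of "1 / 2" 0]
      show False using f0(2) by simp
    qed
    then have "(\<lambda>Z. 2 * u Z) = u"
      using T_u[OF f0] T_u[OF bergman_scale[OF f0(1), of 2]] bounded_ops_D(3)[OF T f0(1), of 2] by simp
    then have u: "u = (\<lambda>Z. 0)" by (simp add: fun_eq_iff)
    have T0: "?T f = (\<lambda>Z. 0)" if f: "f \<in> bergman_space lam" for f
    proof (cases "\<exists>g. proj f g")
      case True
      then obtain g where g: "proj f g" by blast
      \<comment> \<open>Adding \<open>f0\<close> to \<open>f\<close> destroys the projection, and \<open>T (f + f0) = T f + T f0\<close>.\<close>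
      have "\<not> proj (\<lambda>Z. f Z + f0 Z) k" for k
      proof
        assume "proj (\<lambda>Z. f Z + f0 Z) k"
        from proj_comb[OF bergman_add[OF f f0(1)] this f g, of 1 "- 1"] show False
          using f0(2) by simp
      qed
      then have "?T (\<lambda>Z. f Z + f0 Z) = (\<lambda>Z. 0)"
        using T_u[OF bergman_add[OF f f0(1)]] u by simp
      then show ?thesis
        using bounded_ops_D(2)[OF T f f0(1)] T_u[OF f0] u by simp
    next
      case False
      then show ?thesis using T_u[OF f] u by blast
    qed
    then have "has_symbol lam ?T (\<lambda>Z. 0)"
      using T unfolding has_symbol_def by (auto simp: L2_inner_def intro!: exI[of _ 0])
    then show ?thesis ..
  qed
qed

text \<open>
  Both sides of the assumption are transported by \<open>Z \<mapsto> U Z\<close>, which preserves null sets and does not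
  change \<open>Z\<^sup>* Z\<close>. Whatever value \<open>mat_sqrt\<close> takes, it is the same at \<open>Z\<close> and at \<open>U Z\<close>.
\<close>

lemma left_invariant_symbol:
  fixes a :: "complex ^ 'n ^ 'n \<Rightarrow> complex"
  assumes a: "AE Z in domain_lebesgue. a Z = a (mat_sqrt (ctranspose Z ** Z))" and U: "unitary U"
  shows "AE Z in bergman_measure lam. a (U ** Z) = a Z"
proof -
  note d = symmetry_distr_lebesgue[OF symmetry_left[OF U, of lam]]
  have moved: "AE Z in domain_lebesgue. a (U ** Z) = a (mat_sqrt (ctranspose (U ** Z) ** (U ** Z)))"
    by (rule AE_distrD[OF d(1), unfolded d(2), OF a])
  have eq: "ctranspose (U ** Z) ** (U ** Z) = ctranspose Z ** Z" for Z :: "complex ^ 'n ^ 'n"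
    unfolding ctranspose_mult matrix_mul_assoc[symmetric] unitary_left_cancel(1)[OF U] ..
  have "AE Z in domain_lebesgue. a (U ** Z) = a Z"
    using moved a unfolding eq by eventually_elim simp
  then show ?thesis by (rule AE_lebesgue_imp_bergman)
qed

lemma right_invariant_symbol:
  fixes b :: "complex ^ 'n ^ 'n \<Rightarrow> complex"
  assumes b: "AE Z in domain_lebesgue. b Z = b (mat_sqrt (Z ** ctranspose Z))" and U: "unitary U"
  shows "AE Z in bergman_measure lam. b (Z ** U) = b Z"
proof -
  note d = symmetry_distr_lebesgue[OF symmetry_right[OF U, of lam]]
  have moved: "AE Z in domain_lebesgue. b (Z ** U) = b (mat_sqrt ((Z ** U) ** ctranspose (Z ** U)))"
    by (rule AE_distrD[OF d(1), unfolded d(2), OF b])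
  have eq: "(Z ** U) ** ctranspose (Z ** U) = Z ** ctranspose Z" for Z :: "complex ^ 'n ^ 'n"
    unfolding ctranspose_mult matrix_mul_assoc unitary_right_cancel(1)[OF U] ..
  have "AE Z in domain_lebesgue. b (Z ** U) = b Z"
    using moved b unfolding eq by eventually_elim simp
  then show ?thesis by (rule AE_lebesgue_imp_bergman)
qed

lemma toeplitz_commute:
  fixes a b :: "complex ^ 'n ^ 'n \<Rightarrow> complex"
  assumes unit: "emeasure (bergman_measure lam :: (complex ^ 'n ^ 'n) measure) cartan_domain = 1"
    and a: "a \<in> Linf" "toeplitz lam a \<in> bounded_ops lam" "AE Z in domain_lebesgue. a Z = a (mat_sqrt (ctranspose Z ** Z))"
    and b: "b \<in> Linf" "toeplitz lam b \<in> bounded_ops lam" "AE Z in domain_lebesgue. b Z = b (mat_sqrt (Z ** ctranspose Z))"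
    and f: "f \<in> bergman_space lam"
  shows "toeplitz lam a (toeplitz lam b f) = toeplitz lam b (toeplitz lam a f)"
proof -
  obtain a' where a': "has_symbol lam (toeplitz lam a) a'" "a' = a \<or> a' = (\<lambda>Z. 0)"
    using toeplitz_has_symbol[OF unit a(1,2)] by blast
  obtain b' where b': "has_symbol lam (toeplitz lam b) b'" "b' = b \<or> b' = (\<lambda>Z. 0)"
    using toeplitz_has_symbol[OF unit b(1,2)] by blast
  show ?thesis
  proof (rule left_right_operators_commute[OF unit a'(1) b'(1) _ _ f])
    show "AE Z in bergman_measure lam. a' (U ** Z) = a' Z" if "unitary U" for U
      using a'(2) left_invariant_symbol[OF a(3) that] by auto
    show "AE Z in bergman_measure lam. b' (Z ** U) = b' Z" if "unitary U" for U
      using b'(2) right_invariant_symbol[OF b(3) that] by auto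
  qed
qed

theorem corollary4p21:
  fixes lam :: real and a b :: "complex ^ 'n ^ 'n \<Rightarrow> complex"
  assumes "CARD('n) \<ge> 2"
    and "lam > 2 * real CARD('n) - 1"
    and "a \<in> Linf" and "b \<in> Linf"
    and "AE Z in lebesgue_on cartan_domain. a Z = a (mat_sqrt (ctranspose Z ** Z))"
    and "commutative_ops lam (banach_algebra_gen lam {toeplitz lam a})"
    and "\<not> adjoint_closed lam (banach_algebra_gen lam {toeplitz lam a})"
    and "\<not> commutative_ops lam (cstar_algebra_gen lam {toeplitz lam a})"
    and "AE Z in lebesgue_on cartan_domain. b Z = b (mat_sqrt (Z ** ctranspose Z))"
    and "commutative_ops lam (banach_algebra_gen lam {toeplitz lam b})"
    and "\<not> adjoint_closed lam (banach_algebra_gen lam {toeplitz lam b})"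
    and "\<not> commutative_ops lam (cstar_algebra_gen lam {toeplitz lam b})"
  shows "commutative_ops lam (banach_algebra_gen lam {toeplitz lam a, toeplitz lam b})
    \<and> \<not> adjoint_closed lam (banach_algebra_gen lam {toeplitz lam a, toeplitz lam b})
    \<and> \<not> commutative_ops lam (cstar_algebra_gen lam {toeplitz lam a, toeplitz lam b})"
proof -
  let ?A = "toeplitz lam a" and ?B = "toeplitz lam b"
  have bounded: "?A \<in> bounded_ops lam" "?B \<in> bounded_ops lam"
    using assms(6,10) by (auto dest: commutative_generated_imp_bounded)
  then have G: "{?A, ?B} \<subseteq> bounded_ops lam" by simp
  note closed = closed_unital_generated[OF G]
  have comm: "commutative_ops lam (banach_algebra_gen lam {?A, ?B})"
  proof (cases rule: bergman_measure_cases[where 'n = 'n and lam = lam])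
    case unit
    have "commutative_ops lam {?A, ?B}"
      using toeplitz_commute[OF unit assms(3) bounded(1) assms(5) assms(4) bounded(2) assms(9)]
      by (auto simp: commutative_ops_def commute_iff)
    then show ?thesis
      by (rule generated_commutative[OF unit G])
  next
    case null
    \<comment> \<open>Every closed unital subalgebra is now the algebra of all bounded operators.\<close>
    have "banach_algebra_gen lam {?A, ?B} \<subseteq> bounded_ops lam"
      using closed by (simp add: closed_unital_subalgebra_def)
    also have "\<dots> \<subseteq> banach_algebra_gen lam {?A}"
      using bounded by (intro null_measure_full_algebra[OF null] closed_unital_generated) simp
    finally show ?thesis
      using assms(6) unfolding commutative_ops_def by blast
  qed
  moreover have "\<not> adjoint_closed lam (banach_algebra_gen lam {?A, ?B})"
  proof
    assume adj: "adjoint_closed lam (banach_algebra_gen lam {?A, ?B})"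
    have "?A \<in> banach_algebra_gen lam {?A, ?B}"
      using generators_in_generated by blast
    then have "cstar_algebra_gen lam {?A} \<subseteq> banach_algebra_gen lam {?A, ?B}"
      unfolding cstar_algebra_gen_def using closed adj by (intro hull_minimal) auto
    then show False
      using comm assms(8) unfolding commutative_ops_def by blast
  qed
  moreover have "cstar_algebra_gen lam {?A} \<subseteq> cstar_algebra_gen lam {?A, ?B}"
    unfolding cstar_algebra_gen_def by (rule hull_mono) simp
  then have "\<not> commutative_ops lam (cstar_algebra_gen lam {?A, ?B})"
    using assms(8) unfolding commutative_ops_def by blast
  ultimately show ?thesis by blast
qed

end
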